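(* Let $\underline{\omega}=(\omega_1,\omega_2)\in\mathbb{R}_+^2$ be a generic irrational ordered pair, and let $\Lambda>0$, $\tau>1$. Consider, for either choice of sign $\pm$ (focusing or defocusing), the quasi-resonant cubic nonlinear Schrödinger initial value problem $$ i\partial_t\psi=\Delta\psi\pm(|\psi|^2\psi)^*,\quad x\in\mathbb{T}^2_{\underline{\omega}},\ t\in\mathbb{R},\qquad \psi(0)=\psi_0, $$ where $(|\psi|^2\psi)^*$ denotes the cubic nonlinearity restricted to $(\Lambda,\tau)$-quasi-resonant interactions. Then this initial value problem is globally well-posed for $\psi_0\in L^2(\mathbb{T}^2_{\underline{\omega}})$.
   Context: $\mathbb{T}^2_{\underline{\omega}}=\mathbb{R}/\omega_1\mathbb{Z}\times\mathbb{R}/\omega_2\mathbb{Z}$ is the flat torus. For $k=(m,\ell)\in\mathbb{Z}^2$ write $\hat\psi_k$ for the coefficient of $e^{2\pi i(m x_1/\omega_1+\ell x_2/\omega_2)}$ in the Fourier series of $\psi$, and let $\lambda_k=4\pi^2(m^2/\omega_1^2+\ell^2/\omega_2^2)$ be the corresponding eigenvalue of $-\Delta$. Generic irrational ordered pair: $\alpha=\omega_1^2/\omega_2^2$ is irrational and is not well-approximated by rationals, in the sense that for every $C>0$ and every $\sigma>0$ there are only finitely many $(p,q)\in\mathbb{Z}\times\mathbb{Z}_+$ with $|p/q-\alpha|\le C/q^{2+\sigma}$ (such $\alpha$ form a full-measure set). $(\Lambda,\tau)$-quasi-resonant quartet: $(k_1,k_2,k_3,k_4)\in(\mathbb{Z}^2)^4$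 with $k_1+k_2-k_3-k_4=0$ and $$|\lambda_{k_1}+\lambda_{k_2}-\lambda_{k_3}-\lambda_{k_4}|\le\frac{\Lambda}{(|k_1|^2+|k_2|^2+|k_3|^2+|k_4|^2)^{1+\tau}},$$ where the quartet with all $k_i=0$ is counted as quasi-resonant. The restricted nonlinearity is defined by $$\widehat{\big((|\psi|^2\psi)^*\big)}_k=\sum \hat\psi_{k_1}\hat\psi_{k_2}\overline{\hat\psi_{k_3}},$$ the sum being over $(k_1,k_2,k_3)$ such that $(k_1,k_2,k_3,k)$ is a $(\Lambda,\tau)$-quasi-resonant quartet. Globally well-posed in $L^2$: for every $\psi_0\in L^2$ there is a unique solution $\psi\in C(\mathbb{R};L^2(\mathbb{T}^2_{\underline{\omega}}))$ (the equation being understood in the Duhamel sense, equivalently coefficientwise in Fourier space), and it depends continuously on $\psi_0$ on bounded time intervals. *)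

theory Defs
  imports "HOL-Analysis.Analysis"
begin

definition not_well_approximable :: "real \<Rightarrow> bool" where
  "not_well_approximable \<alpha> \<longleftrightarrow>
     (\<forall>C>0. \<forall>\<sigma>>0. finite {(p :: int, q :: int).
        q > 0 \<and> \<bar>of_int p / of_int q - \<alpha>\<bar> \<le> C / (of_int q powr (2 + \<sigma>))})"

definition generic_irrational_pair :: "real \<Rightarrow> real \<Rightarrow> bool" where
  "generic_irrational_pair \<omega>1 \<omega>2 \<longleftrightarrow>
     \<omega>1 > 0 \<and> \<omega>2 > 0 \<and> \<omega>1\<^sup>2 / \<omega>2\<^sup>2 \<notin> \<rat> \<and> not_well_approximable (\<omega>1\<^sup>2 / \<omega>2\<^sup>2)"

text \<open>
  Functions on the torus are doubly periodic functions on the plane; they are integrated over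
  one period cell. Elements of \<open>L\<^sup>2\<close> are represented by functions, so equality in \<open>L\<^sup>2\<close> is
  almost-everywhere equality on the cell.
\<close>

definition torus_measure :: "real \<Rightarrow> real \<Rightarrow> (real \<times> real) measure" where
  "torus_measure \<omega>1 \<omega>2 = lebesgue_on ({0..<\<omega>1} \<times> {0..<\<omega>2})"

definition torus_periodic :: "real \<Rightarrow> real \<Rightarrow> (real \<times> real \<Rightarrow> complex) \<Rightarrow> bool" where
  "torus_periodic \<omega>1 \<omega>2 f \<longleftrightarrow>
     (\<forall>x y. f (x + \<omega>1, y) = f (x, y) \<and> f (x, y + \<omega>2) = f (x, y))"

definition torus_L2 :: "real \<Rightarrow> real \<Rightarrow> (real \<times> real \<Rightarrow> complex) set" where
  "torus_L2 \<omega>1 \<omega>2 = {f. torus_periodic \<omega>1 \<omega>2 f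
     \<and> f \<in> borel_measurable (torus_measure \<omega>1 \<omega>2)
     \<and> integrable (torus_measure \<omega>1 \<omega>2) (\<lambda>x. (cmod (f x))\<^sup>2)}"

definition torus_L2_norm :: "real \<Rightarrow> real \<Rightarrow> (real \<times> real \<Rightarrow> complex) \<Rightarrow> real" where
  "torus_L2_norm \<omega>1 \<omega>2 f = sqrt (\<integral>x. (cmod (f x))\<^sup>2 \<partial>torus_measure \<omega>1 \<omega>2)"

definition torus_L2_dist ::
  "real \<Rightarrow> real \<Rightarrow> (real \<times> real \<Rightarrow> complex) \<Rightarrow> (real \<times> real \<Rightarrow> complex) \<Rightarrow> real" where
  "torus_L2_dist \<omega>1 \<omega>2 f g = torus_L2_norm \<omega>1 \<omega>2 (\<lambda>x. f x - g x)"

definition fourier_coeff ::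
  "real \<Rightarrow> real \<Rightarrow> (real \<times> real \<Rightarrow> complex) \<Rightarrow> int \<times> int \<Rightarrow> complex" where
  "fourier_coeff \<omega>1 \<omega>2 f = (\<lambda>(m, l).
     (\<integral>x. f x * cis (- (2 * pi * (of_int m * fst x / \<omega>1 + of_int l * snd x / \<omega>2)))
        \<partial>torus_measure \<omega>1 \<omega>2) / of_real (\<omega>1 * \<omega>2))"

definition laplace_eigenvalue :: "real \<Rightarrow> real \<Rightarrow> int \<times> int \<Rightarrow> real" where
  "laplace_eigenvalue \<omega>1 \<omega>2 =
     (\<lambda>(m, l). 4 * pi\<^sup>2 * ((of_int m)\<^sup>2 / \<omega>1\<^sup>2 + (of_int l)\<^sup>2 / \<omega>2\<^sup>2))"

definition freq_norm_sq :: "int \<times> int \<Rightarrow> real" where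
  "freq_norm_sq = (\<lambda>(m, l). (of_int m)\<^sup>2 + (of_int l)\<^sup>2)"

text \<open>
  For the zero quartet the denominator below vanishes, hence the separate disjunct.
\<close>

definition quasi_resonant ::
  "real \<Rightarrow> real \<Rightarrow> real \<Rightarrow> real \<Rightarrow>
   int \<times> int \<Rightarrow> int \<times> int \<Rightarrow> int \<times> int \<Rightarrow> int \<times> int \<Rightarrow> bool" where
  "quasi_resonant \<omega>1 \<omega>2 \<Lambda> \<tau> k1 k2 k3 k4 \<longleftrightarrow>
     k1 + k2 - k3 - k4 = 0 \<and>
     ((k1 = 0 \<and> k2 = 0 \<and> k3 = 0 \<and> k4 = 0) \<or>
      \<bar>laplace_eigenvalue \<omega>1 \<omega>2 k1 + laplace_eigenvalue \<omega>1 \<omega>2 k2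
        - laplace_eigenvalue \<omega>1 \<omega>2 k3 - laplace_eigenvalue \<omega>1 \<omega>2 k4\<bar>
      \<le> \<Lambda> / ((freq_norm_sq k1 + freq_norm_sq k2 + freq_norm_sq k3 + freq_norm_sq k4)
              powr (1 + \<tau>)))"

definition quasi_resonant_triples ::
  "real \<Rightarrow> real \<Rightarrow> real \<Rightarrow> real \<Rightarrow> int \<times> int \<Rightarrow>
   ((int \<times> int) \<times> (int \<times> int) \<times> (int \<times> int)) set" where
  "quasi_resonant_triples \<omega>1 \<omega>2 \<Lambda> \<tau> k = {(k1, k2, k3). quasi_resonant \<omega>1 \<omega>2 \<Lambda> \<tau> k1 k2 k3 k}"

definition cubic_term ::
  "real \<Rightarrow> real \<Rightarrow> (real \<times> real \<Rightarrow> complex) \<Rightarrow>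
   (int \<times> int) \<times> (int \<times> int) \<times> (int \<times> int) \<Rightarrow> complex" where
  "cubic_term \<omega>1 \<omega>2 f = (\<lambda>(k1, k2, k3).
     fourier_coeff \<omega>1 \<omega>2 f k1 * fourier_coeff \<omega>1 \<omega>2 f k2 * cnj (fourier_coeff \<omega>1 \<omega>2 f k3))"

definition restricted_cubic_coeff ::
  "real \<Rightarrow> real \<Rightarrow> real \<Rightarrow> real \<Rightarrow> (real \<times> real \<Rightarrow> complex) \<Rightarrow> int \<times> int \<Rightarrow> complex" where
  "restricted_cubic_coeff \<omega>1 \<omega>2 \<Lambda> \<tau> f k =
     (\<Sum>\<^sub>\<infinity>j\<in>quasi_resonant_triples \<omega>1 \<omega>2 \<Lambda> \<tau> k. cubic_term \<omega>1 \<omega>2 f j)"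

text \<open>
  Since \<open>-\<Delta>\<close> acts on the mode \<open>k\<close> as multiplication by \<open>\<lambda>\<^sub>k\<close>, the equation
  \<open>\<i> \<partial>\<^sub>t\<psi> = \<Delta>\<psi> + \<epsilon> N(\<psi>)\<close> reads \<open>\<partial>\<^sub>t\<psi>\<^sub>k = \<i> \<lambda>\<^sub>k \<psi>\<^sub>k - \<i> \<epsilon> N(\<psi>)\<^sub>k\<close> for the mode \<open>k\<close>; the last
  conjunct is its Duhamel form. The summability and integrability conjuncts exclude the default
  value that \<open>infsum\<close> and the integral take on families and functions without a sum or integral.
  The interval integral is oriented, so \<open>t\<close> may be negative.
\<close>

definition qr_nls_solution ::
  "real \<Rightarrow> real \<Rightarrow> real \<Rightarrow> real \<Rightarrow> real \<Rightarrow>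
   (real \<times> real \<Rightarrow> complex) \<Rightarrow> (real \<Rightarrow> real \<times> real \<Rightarrow> complex) \<Rightarrow> bool" where
  "qr_nls_solution \<omega>1 \<omega>2 \<Lambda> \<tau> \<epsilon> \<psi>0 \<psi> \<longleftrightarrow>
     (\<forall>t. \<psi> t \<in> torus_L2 \<omega>1 \<omega>2) \<and>
     (\<forall>t. ((\<lambda>s. torus_L2_dist \<omega>1 \<omega>2 (\<psi> s) (\<psi> t)) \<longlongrightarrow> 0) (at t)) \<and>
     (AE x in torus_measure \<omega>1 \<omega>2. \<psi> 0 x = \<psi>0 x) \<and>
     (\<forall>t k. cubic_term \<omega>1 \<omega>2 (\<psi> t) summable_on quasi_resonant_triples \<omega>1 \<omega>2 \<Lambda> \<tau> k) \<and>
     (\<forall>t k. interval_lebesgue_integrable lborel (ereal 0) (ereal t)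
        (\<lambda>s. cis (laplace_eigenvalue \<omega>1 \<omega>2 k * (t - s))
              * restricted_cubic_coeff \<omega>1 \<omega>2 \<Lambda> \<tau> (\<psi> s) k)) \<and>
     (\<forall>t k. fourier_coeff \<omega>1 \<omega>2 (\<psi> t) k =
        cis (laplace_eigenvalue \<omega>1 \<omega>2 k * t) * fourier_coeff \<omega>1 \<omega>2 \<psi>0 k
        - \<i> * of_real \<epsilon> *
          interval_lebesgue_integral lborel (ereal 0) (ereal t)
            (\<lambda>s. cis (laplace_eigenvalue \<omega>1 \<omega>2 k * (t - s))
                  * restricted_cubic_coeff \<omega>1 \<omega>2 \<Lambda> \<tau> (\<psi> s) k))"

definition qr_nls_globally_well_posed ::
  "real \<Rightarrow> real \<Rightarrow> real \<Rightarrow> real \<Rightarrow> real \<Rightarrow> bool" where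
  "qr_nls_globally_well_posed \<omega>1 \<omega>2 \<Lambda> \<tau> \<epsilon> \<longleftrightarrow>
     (\<forall>\<psi>0 \<in> torus_L2 \<omega>1 \<omega>2. \<exists>\<psi>. qr_nls_solution \<omega>1 \<omega>2 \<Lambda> \<tau> \<epsilon> \<psi>0 \<psi>) \<and>
     (\<forall>\<psi>0 \<in> torus_L2 \<omega>1 \<omega>2. \<forall>\<psi> \<phi>.
        qr_nls_solution \<omega>1 \<omega>2 \<Lambda> \<tau> \<epsilon> \<psi>0 \<psi> \<longrightarrow> qr_nls_solution \<omega>1 \<omega>2 \<Lambda> \<tau> \<epsilon> \<psi>0 \<phi> \<longrightarrow>
        (\<forall>t. AE x in torus_measure \<omega>1 \<omega>2. \<psi> t x = \<phi> t x)) \<and>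
     (\<forall>\<psi>0 \<in> torus_L2 \<omega>1 \<omega>2. \<forall>T>0. \<forall>e>0. \<exists>d>0. \<forall>\<phi>0 \<in> torus_L2 \<omega>1 \<omega>2. \<forall>\<psi> \<phi>.
        torus_L2_dist \<omega>1 \<omega>2 \<psi>0 \<phi>0 < d \<longrightarrow>
        qr_nls_solution \<omega>1 \<omega>2 \<Lambda> \<tau> \<epsilon> \<psi>0 \<psi> \<longrightarrow> qr_nls_solution \<omega>1 \<omega>2 \<Lambda> \<tau> \<epsilon> \<phi>0 \<phi> \<longrightarrow>
        (\<forall>t\<in>{-T..T}. torus_L2_dist \<omega>1 \<omega>2 (\<psi> t) (\<phi> t) < e))"

end

theory Submission
  imports Defs
begin

text \<open>
  A quasi-resonant quartet has a pair of defects \<open>(a, b)\<close>, the alternating sums of the squares of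
  its first and second coordinates, with \<open>a + \<omega>1\<^sup>2 / \<omega>2\<^sup>2 * b\<close> so small that, by the Diophantine
  condition, \<open>a = b = 0\<close> for all but finitely many quartets. A quartet with \<open>a = b = 0\<close> is a
  (possibly degenerate) axis-parallel rectangle, so each pair \<open>(k1, k2)\<close> is completed to a
  quasi-resonant quartet by a bounded number of pairs \<open>(k3, k4)\<close>. By Cauchy--Schwarz the restricted
  cubic nonlinearity is then bounded on \<open>\<ell>\<^sup>2\<close>, hence locally Lipschitz, and by its symmetry it
  preserves the \<open>\<ell>\<^sup>2\<close> norm. In the interaction picture the equation is an ordinary differential
  equation with such a field, which is globally well posed; Parseval and Riesz--Fischer carry this
  over to \<open>L\<^sup>2\<close> of the torus.
\<close>

section \<open>Hilbert-space differential equations\<close>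

text \<open>The cube of an \<open>L\<^sup>2\<close> function need not be integrable, so the full
  cubic nonlinearity need not have Fourier coefficients; only the thinness of the quasi-resonant set
  lets the restricted one act on square-summable families. The remaining unbounded term is the
  Laplacian, removed by conjugation with the linear flow. The price is a time-dependent field
  containing a flow that is continuous strongly but not in operator norm, so the abstract
  differential equation asks for continuity only along continuous curves. Conservation of the norm
  is used twice: it excludes blow-up, and it confines two solutions to a common ball on which one
  Lipschitz constant serves for all times. Because the field maps \<open>ell2\<close> to itself,
  every Duhamel solution that is continuous in \<open>L\<^sup>2\<close> is a classical solution in
  the interaction picture, so uniqueness needs no auxiliary space. The return to functions rests on
  completeness of the torus characters, obtained from Stone--Weierstrass on a product of two
  circles.\<close>

lemma radial_retraction_Lipschitz_aux:
  fixes x y :: "'a::real_normed_vector"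
  assumes R: "R > 0" and le: "norm y \<le> norm x"
  shows "norm ((R / max R (norm x)) *\<^sub>R x - (R / max R (norm y)) *\<^sub>R y) \<le> 2 * norm (x - y)"
proof -
  define p q where "p = max R (norm x)" and "q = max R (norm y)"
  have pq: "q \<le> p" "q > 0" "p > 0" "R \<le> p" "norm y \<le> q" using R le by (auto simp: p_def q_def)
  have d: "p - q \<le> norm (x - y)"
    using norm_triangle_ineq2[of x y] le unfolding p_def q_def by linarith
  \<comment> \<open>Change the point at a fixed factor, then the factor at a fixed point; each of
    the two changes costs at most \<open>norm (x - y)\<close>.\<close>
  have "(R / p) *\<^sub>R x - (R / q) *\<^sub>R y = (R / p) *\<^sub>R (x - y) + (R / p - R / q) *\<^sub>R y"
    by (simp add: algebra_simps)
  also have "norm \<dots> \<le> (R / p) * norm (x - y) + \<bar>R / p - R / q\<bar> * norm y"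
    using R pq by (intro norm_triangle_le) (simp)
  also have "(R / p) * norm (x - y) \<le> 1 * norm (x - y)"
    using R pq by (intro mult_right_mono) auto
  also have "\<bar>R / p - R / q\<bar> = R * (p - q) / (p * q)"
    using R pq by (subst abs_of_nonpos) (auto simp: field_simps)
  also have "R * (p - q) / (p * q) * norm y \<le> R * (p - q) / (p * q) * q"
    using R pq by (intro mult_left_mono) auto
  also have "\<dots> = (R / p) * (p - q)" using pq by (simp add: field_simps)
  also have "\<dots> \<le> 1 * norm (x - y)"
    using R pq d by (intro mult_mono) auto
  finally show ?thesis by (simp add: p_def q_def)
qed

text \<open>The map is the radial retraction onto the closed ball of radius \<open>R\<close>, used
  below to cut a field off outside that ball. The constant 2 is available in every normed
  space.\<close>

lemma radial_retraction_Lipschitz: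
  fixes x y :: "'a::real_normed_vector"
  assumes "R > 0"
  shows "norm ((R / max R (norm x)) *\<^sub>R x - (R / max R (norm y)) *\<^sub>R y) \<le> 2 * norm (x - y)"
proof (cases "norm y \<le> norm x")
  case True then show ?thesis using radial_retraction_Lipschitz_aux[OF assms] by blast
next
  case False
  then show ?thesis using radial_retraction_Lipschitz_aux[OF assms, of x y] by (metis linear norm_minus_commute)
qed

lemma continuous_antiderivative:
  fixes g :: "real \<Rightarrow> 'a::banach"
  assumes g: "continuous_on UNIV g"
  obtains V where "V 0 = 0" "\<And>t. (V has_vector_derivative g t) (at t)"
proof -
  define V where "V t = (if t \<ge> 0 then integral {0..t} g else - integral {t..0} g)" for t
  have int: "g integrable_on {a..b}" for a b
    by (intro integrable_continuous_real continuous_on_subset[OF g]) auto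
  \<comment> \<open>Both branches of \<open>V\<close> equal the integral from the common base point
    \<open>-c\<close> up to one constant, so that differentiability at 0 needs no separate
    argument.\<close>
  have V: "V t = integral {-c..t} g - integral {-c..0} g" if "-c \<le> t" "0 \<le> c" for t c
  proof (cases "t \<ge> 0")
    case True
    have "integral {-c..0} g + integral {0..t} g = integral {-c..t} g"
      using that True int by (intro Henstock_Kurzweil_Integration.integral_combine) auto
    then show ?thesis using True by (simp add: V_def algebra_simps)
  next
    case False
    have "integral {-c..t} g + integral {t..0} g = integral {-c..0} g"
      using that False int by (intro Henstock_Kurzweil_Integration.integral_combine) auto
    then show ?thesis using False by (simp add: V_def algebra_simps)
  qed
  have "(V has_vector_derivative g t) (at t)" for t
  proof -
    define c where "c = \<bar>t\<bar> + 1"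
    have "((\<lambda>u. integral {-c..u} g) has_vector_derivative g t) (at t within {-c..c})"
      by (intro integral_has_vector_derivative continuous_on_subset[OF g]) (auto simp: c_def)
    then have "((\<lambda>u. integral {-c..u} g) has_vector_derivative g t) (at t)"
      by (subst (asm) at_within_interior) (auto simp: c_def)
    then have "((\<lambda>u. integral {-c..u} g - integral {-c..0} g) has_vector_derivative g t) (at t)"
      by (auto intro!: derivative_eq_intros)
    then show ?thesis
      by (rule has_vector_derivative_transform_within_open[of _ _ _ "{-c<..<c}"])
         (use V[of c] in \<open>auto simp: c_def\<close>)
  qed
  moreover have "V 0 = 0" by (simp add: V_def)
  ultimately show ?thesis using that by blast
qed

text \<open>The factor \<open>1 / K\<close> gained by integrating the exponential is what turns
  Picard iteration into a contraction in the weighted norm once \<open>K\<close> is large.\<close>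

lemma norm_le_exp_of_derivative:
  fixes D :: "real \<Rightarrow> 'a::real_normed_vector"
  assumes D: "\<And>t. (D has_vector_derivative D' t) (at t)" and D0: "D 0 = 0"
    and bound: "\<And>t. norm (D' t) \<le> C * exp (K * \<bar>t\<bar>)" and K: "K > 0"
  shows "norm (D t) \<le> C / K * exp (K * \<bar>t\<bar>)"
proof -
  have C: "C \<ge> 0" using order_trans[OF norm_ge_zero bound[of 0]] by simp
  have half_line: "norm (G t) \<le> C / K * exp (K * t)"
    if G: "\<And>t. (G has_vector_derivative G' t) (at t)" and G0: "G 0 = 0"
      and bd: "\<And>t. t \<ge> 0 \<Longrightarrow> norm (G' t) \<le> C * exp (K * t)" and t: "t > 0"
    for G G' :: "real \<Rightarrow> 'a" and t
  proof -
    have "norm (G t - G 0) \<le> C / K * exp (K * t) - C / K * exp (K * 0)"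
    proof (rule differentiable_bound_general[OF t])
      show "continuous_on {0..t} G"
        by (meson G continuous_at_imp_continuous_on has_vector_derivative_continuous)
      show "continuous_on {0..t} (\<lambda>s. C / K * exp (K * s))" by (intro continuous_intros)
      show "(G has_vector_derivative G' s) (at s)" for s by (rule G)
      show "((\<lambda>s. C / K * exp (K * s)) has_vector_derivative C * exp (K * s)) (at s)" for s
        using K by (auto intro!: derivative_eq_intros simp: has_real_derivative_iff_has_vector_derivative[symmetric])
      show "norm (G' s) \<le> C * exp (K * s)" if "0 < s" for s using bd that by simp
    qed
    moreover have "0 \<le> C / K" using C K by simp
    ultimately show ?thesis using G0 by simp
  qed
  consider "t > 0" | "t = 0" | "t < 0" by linarith
  then show ?thesis
  proof cases
    case 1
    have "norm (D' s) \<le> C * exp (K * s)" if "s \<ge> 0" for s using bound[of s] that by simp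
    then show ?thesis using half_line[OF D D0 _ 1] 1 by simp
  next
    case 2 then show ?thesis using D0 C K by simp
  next
    case 3
    have "((\<lambda>s. D (- s)) has_vector_derivative - D' (- s)) (at s)" for s
    proof -
      have "(uminus has_vector_derivative - 1) (at s)"
        by (auto intro!: derivative_eq_intros)
      then have "((D \<circ> uminus) has_vector_derivative (- 1) *\<^sub>R D' (- s)) (at s)"
        by (intro vector_diff_chain_at D)
      then show ?thesis by (simp add: o_def)
    qed
    moreover have "norm (- D' (- s)) \<le> C * exp (K * s)" if "s \<ge> 0" for s
      using bound[of "-s"] that by simp
    ultimately have "norm (D (- (- t))) \<le> C / K * exp (K * (- t))"
      using D0 3 by (intro half_line[where G' = "\<lambda>s. - D' (- s)"]) auto
    then show ?thesis using 3 by simp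
  qed
qed

section \<open>Energy identities and global solutions for norm-preserving fields\<close>

lemma has_real_derivative_inner_self:
  fixes u :: "real \<Rightarrow> 'a::real_inner"
  assumes "(u has_vector_derivative u') (at t)"
  shows "((\<lambda>t. inner (u t) (u t)) has_real_derivative 2 * inner u' (u t)) (at t)"
proof -
  have "((\<lambda>t. inner (u t) (u t)) has_derivative (\<lambda>h. inner (u t) (h *\<^sub>R u') + inner (h *\<^sub>R u') (u t))) (at t)"
    using assms unfolding has_vector_derivative_def by (intro has_derivative_inner) auto
  then show ?thesis
    by (simp add: has_field_derivative_def inner_commute mult_commute_abs algebra_simps)
qed

lemma norm_const_of_orthogonal_derivative:
  fixes u :: "real \<Rightarrow> 'a::real_inner"
  assumes "\<And>t. (u has_vector_derivative u' t) (at t)" "\<And>t. inner (u' t) (u t) = 0"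
  shows "norm (u t) = norm (u 0)"
proof -
  have "((\<lambda>t. inner (u t) (u t)) has_real_derivative 0) (at t)" for t
    using has_real_derivative_inner_self[OF assms(1)[of t]] assms(2)[of t] by simp
  then have "inner (u t) (u t) = inner (u 0) (u 0)"
    using DERIV_isconst_all by metis
  then show ?thesis by (simp add: norm_eq_sqrt_inner)
qed

text \<open>Groenwall's inequality in both time directions: the bound on
  \<open>\<bar>g' t\<bar>\<close> controls the derivative from both sides, so
  \<open>exp (- c * t) * g t\<close> does not increase and \<open>exp (c * t) * g t\<close> does not
  decrease.\<close>

lemma le_exp_of_derivative_le:
  fixes g :: "real \<Rightarrow> real"
  assumes g: "\<And>t. (g has_real_derivative g' t) (at t)" and le: "\<And>t. \<bar>g' t\<bar> \<le> c * g t"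
  shows "g t \<le> exp (c * \<bar>t\<bar>) * g 0"
proof (cases "t \<ge> 0")
  case True
  have d: "((\<lambda>s. exp (- c * s) * g s) has_real_derivative exp (- c * s) * (g' s - c * g s)) (at s)" for s
    using g by (auto intro!: derivative_eq_intros simp: algebra_simps)
  have "exp (- c * s) * (g' s - c * g s) \<le> 0" for s
    using le[of s] by (intro mult_nonneg_nonpos) auto
  then have "exp (- c * t) * g t \<le> exp (- c * 0) * g 0"
    using d by (intro DERIV_nonpos_imp_nonincreasing[OF True]) blast
  then show ?thesis using True by (simp add: exp_minus field_simps)
next
  case False
  have d: "((\<lambda>s. exp (c * s) * g s) has_real_derivative exp (c * s) * (g' s + c * g s)) (at s)" for s
    using g by (auto intro!: derivative_eq_intros simp: algebra_simps)
  have "exp (c * s) * (g' s + c * g s) \<ge> 0" for s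
    using le[of s] by (intro mult_nonneg_nonneg) auto
  with d have "\<exists>y. ((\<lambda>s. exp (c * s) * g s) has_real_derivative y) (at s) \<and> 0 \<le> y" for s
    by blast
  then have "exp (c * t) * g t \<le> exp (c * 0) * g 0"
    using False by (intro DERIV_nonneg_imp_nondecreasing[of t 0 "\<lambda>s. exp (c * s) * g s"]) linarith
  then have "g t \<le> inverse (exp (c * t)) * g 0"
    by (simp add: field_simps)
  then show ?thesis using False by (simp add: exp_minus)
qed

text \<open>Continuity is required along continuous curves because the field of the application
  contains a linear flow that is strongly but not norm continuous in time. The Lipschitz constant
  depends on the ball but not on the time, and \<open>orthogonal\<close> is conservation of the norm
  in infinitesimal form.\<close>

locale norm_preserving_ode =
  fixes F :: "real \<Rightarrow> 'a::{real_inner,banach} \<Rightarrow> 'a"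
  assumes continuous_along: "continuous_on UNIV u \<Longrightarrow> continuous_on UNIV (\<lambda>t. F t (u t))"
    and locally_Lipschitz:
      "\<exists>L. \<forall>t x y. norm x \<le> R \<longrightarrow> norm y \<le> R \<longrightarrow> norm (F t x - F t y) \<le> L * norm (x - y)"
    and zero: "F t 0 = 0"
    and orthogonal: "inner (F t x) x = 0"
begin

definition solves :: "(real \<Rightarrow> 'a) \<Rightarrow> bool" where
  "solves u \<longleftrightarrow> (\<forall>t. (u has_vector_derivative F t (u t)) (at t))"

lemma norm_solution:
  assumes "solves u" shows "norm (u t) = norm (u 0)"
  using assms orthogonal unfolding solves_def
  by (intro norm_const_of_orthogonal_derivative[where u' = "\<lambda>t. F t (u t)"]) auto

lemma Lipschitz_nonneg:
  obtains L where "L \<ge> 0"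
    "\<And>t x y. norm x \<le> R \<Longrightarrow> norm y \<le> R \<Longrightarrow> norm (F t x - F t y) \<le> L * norm (x - y)"
proof -
  obtain L where L: "\<And>t x y. norm x \<le> R \<Longrightarrow> norm y \<le> R \<Longrightarrow> norm (F t x - F t y) \<le> L * norm (x - y)"
    using locally_Lipschitz by metis
  have "norm (F t x - F t y) \<le> max L 0 * norm (x - y)" if "norm x \<le> R" "norm y \<le> R" for t x y
    using L[OF that, of t] by (smt (verit) mult_right_mono norm_ge_zero)
  then show ?thesis using that[of "max L 0"] by simp
qed

text \<open>Conservation keeps both solutions in the ball of radius \<open>R\<close> for all time,
  so a single local Lipschitz constant drives Groenwall's inequality for the squared distance. The
  constant depends on the ball only, as continuous dependence later requires.\<close>

lemma solutions_close:
  obtains L where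
    "\<And>u v t. solves u \<Longrightarrow> solves v \<Longrightarrow> norm (u 0) \<le> R \<Longrightarrow> norm (v 0) \<le> R \<Longrightarrow>
       norm (u t - v t) \<le> exp (L * \<bar>t\<bar>) * norm (u 0 - v 0)"
proof -
  obtain L where L: "L \<ge> 0"
    "\<And>t x y. norm x \<le> R \<Longrightarrow> norm y \<le> R \<Longrightarrow> norm (F t x - F t y) \<le> L * norm (x - y)"
    using Lipschitz_nonneg by metis
  have "norm (u t - v t) \<le> exp (L * \<bar>t\<bar>) * norm (u 0 - v 0)"
    if u: "solves u" and v: "solves v" and R: "norm (u 0) \<le> R" "norm (v 0) \<le> R" for u v t
  proof -
    define w where "w t = u t - v t" for t
    have w: "(w has_vector_derivative F t (u t) - F t (v t)) (at t)" for t
      unfolding w_def using u v by (auto simp: solves_def intro!: derivative_intros)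
    have "\<bar>2 * inner (F t (u t) - F t (v t)) (w t)\<bar> \<le> (2 * L) * inner (w t) (w t)" for t
    proof -
      have "\<bar>inner (F t (u t) - F t (v t)) (w t)\<bar> \<le> norm (F t (u t) - F t (v t)) * norm (w t)"
        by (rule Cauchy_Schwarz_ineq2)
      also have "\<dots> \<le> (L * norm (w t)) * norm (w t)"
        unfolding w_def using R norm_solution[OF u, of t] norm_solution[OF v, of t]
        by (intro mult_right_mono L(2)) auto
      finally show ?thesis by (simp add: power2_norm_eq_inner[symmetric] power2_eq_square)
    qed
    then have "inner (w t) (w t) \<le> exp (2 * L * \<bar>t\<bar>) * inner (w 0) (w 0)"
      by (rule le_exp_of_derivative_le[OF has_real_derivative_inner_self[OF w]])
    also have "\<dots> = (exp (L * \<bar>t\<bar>) * norm (w 0))\<^sup>2"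
      by (simp add: power_mult_distrib power2_norm_eq_inner exp_double[symmetric] mult_ac)
    finally have "(norm (w t))\<^sup>2 \<le> (exp (L * \<bar>t\<bar>) * norm (w 0))\<^sup>2"
      by (simp add: power2_norm_eq_inner)
    then show ?thesis unfolding w_def[symmetric] by (rule power2_le_imp_le) simp
  qed
  then show ?thesis using that by blast
qed

text \<open>Conservation of the norm allows to truncate the field outside a ball; the truncated field is
  globally Lipschitz, so Picard iteration contracts in a norm with weight \<open>exp (- K * \<bar>t\<bar>)\<close>.\<close>

lemma global_solution:
  obtains u where "solves u" "u 0 = u0"
proof -
  \<comment> \<open>The added 1 keeps the radius positive when \<open>u0 = 0\<close>.\<close>
  define R where "R = norm u0 + 1"
  have R: "R > 0" "norm u0 < R" by (auto simp: R_def add_nonneg_pos)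
  define P where "P x = (R / max R (norm x)) *\<^sub>R x" for x :: 'a
  have P_Lip: "norm (P x - P y) \<le> 2 * norm (x - y)" for x y
    unfolding P_def by (rule radial_retraction_Lipschitz[OF R(1)])
  have P_cont: "continuous_on UNIV P"
    unfolding P_def using R by (intro continuous_intros) (auto simp: max_def)
  have P_norm: "norm (P x) \<le> R" for x
    using R by (auto simp: P_def max_def divide_simps)
  have P_id: "P x = x" if "norm x \<le> R" for x
    using that R by (simp add: P_def max_def)
  obtain L where L: "L \<ge> 0"
    "\<And>t x y. norm x \<le> R \<Longrightarrow> norm y \<le> R \<Longrightarrow> norm (F t x - F t y) \<le> L * norm (x - y)"
    using Lipschitz_nonneg by metis
  \<comment> \<open>The retraction doubles the Lipschitz constant, so the cut-off field has constant
    \<open>2 * L\<close>; this choice makes the contraction factor \<open>2 * L / K\<close> at most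
    1/2.\<close>
  define K where "K = 4 * L + 1"
  have K: "K > 0" "2 * L / K \<le> 1/2" using L by (auto simp: K_def field_simps)
  \<comment> \<open>The unknown \<open>v\<close> stands for
    \<open>exp (- (K * \<bar>t\<bar>)) *\<^sub>R u t\<close>, so the supremum metric on bounded
    continuous functions is the weighted metric for \<open>u\<close>.\<close>
  define g where "g v t = F t (P (exp (K * \<bar>t\<bar>) *\<^sub>R apply_bcontfun v t))" for v :: "real \<Rightarrow>\<^sub>C 'a" and t
  have g_cont: "continuous_on UNIV (g v)" for v
    unfolding g_def
    by (intro continuous_along continuous_on_compose2[OF P_cont] continuous_intros) auto
  have "\<forall>v. \<exists>V. V 0 = 0 \<and> (\<forall>t. (V has_vector_derivative g v t) (at t))"
    using continuous_antiderivative[OF g_cont] by metis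
  then obtain V where V0: "\<And>v. V v 0 = 0" and V: "\<And>v t. (V v has_vector_derivative g v t) (at t)"
    by metis
  have V_cont: "continuous_on UNIV (V v)" for v
    by (meson V continuous_at_imp_continuous_on has_vector_derivative_continuous)
  have g_bound: "norm (g v t) \<le> L * R * exp (K * \<bar>t\<bar>)" for v t
  proof -
    have "norm (g v t) \<le> L * norm (P (exp (K * \<bar>t\<bar>) *\<^sub>R apply_bcontfun v t))"
      using L(2)[OF P_norm, of 0 t] R unfolding g_def by (simp add: zero)
    also have "\<dots> \<le> L * R" using L(1) P_norm by (intro mult_left_mono) auto
    also have "\<dots> \<le> L * R * exp (K * \<bar>t\<bar>)"
        using L(1) R K mult_left_mono[of 1 "exp (K * \<bar>t\<bar>)" "L * R"] by simp
    finally show ?thesis .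
  qed
  define h where "h v t = exp (- (K * \<bar>t\<bar>)) *\<^sub>R (u0 + V v t)" for v t
  have h_bcont: "h v \<in> bcontfun" for v
  proof (rule bcontfun_normI)
    show "continuous_on UNIV (h v)" unfolding h_def by (intro continuous_intros V_cont)
    show "norm (h v t) \<le> norm u0 + L * R / K" for t
    proof -
      have "norm (h v t) \<le> exp (- (K * \<bar>t\<bar>)) * (norm u0 + L * R / K * exp (K * \<bar>t\<bar>))"
        using norm_le_exp_of_derivative[OF V V0 g_bound K(1), of v t]
        unfolding h_def by (auto intro!: norm_triangle_le)
      also have "\<dots> = exp (- (K * \<bar>t\<bar>)) * norm u0 + L * R / K"
        by (simp add: distrib_left exp_minus)
      also have "\<dots> \<le> 1 * norm u0 + L * R / K" using K by (intro add_right_mono mult_right_mono) auto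
      finally show ?thesis by simp
    qed
  qed
  have h_contr: "dist (Bcontfun (h v)) (Bcontfun (h w)) \<le> 1/2 * dist v w" for v w
  proof (rule dist_bound)
    fix t
    have d: "norm (g v s - g w s) \<le> 2 * L * dist v w * exp (K * \<bar>s\<bar>)" for s
    proof -
      have "norm (g v s - g w s)
        \<le> L * norm (P (exp (K * \<bar>s\<bar>) *\<^sub>R apply_bcontfun v s) - P (exp (K * \<bar>s\<bar>) *\<^sub>R apply_bcontfun w s))"
        unfolding g_def by (rule L(2)[OF P_norm P_norm])
      also have "\<dots> \<le> L * (2 * norm (exp (K * \<bar>s\<bar>) *\<^sub>R apply_bcontfun v s - exp (K * \<bar>s\<bar>) *\<^sub>R apply_bcontfun w s))"
        by (intro mult_left_mono P_Lip L)
      also have "\<dots> = 2 * L * exp (K * \<bar>s\<bar>) * dist (apply_bcontfun v s) (apply_bcontfun w s)"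
        by (simp add: scaleR_diff_right[symmetric] dist_norm)
      also have "\<dots> \<le> 2 * L * exp (K * \<bar>s\<bar>) * dist v w"
        using L(1) by (intro mult_left_mono dist_bounded) auto
      finally show ?thesis by (simp add: mult_ac)
    qed
    have "norm (V v t - V w t) \<le> 2 * L * dist v w / K * exp (K * \<bar>t\<bar>)"
      using V V0 d K(1)
      by (intro norm_le_exp_of_derivative[where D = "\<lambda>t. V v t - V w t" and D' = "\<lambda>t. g v t - g w t"]
        has_vector_derivative_diff) simp_all
    then have "exp (- (K * \<bar>t\<bar>)) * norm (V v t - V w t) \<le> exp (- (K * \<bar>t\<bar>)) * (2 * L * dist v w / K * exp (K * \<bar>t\<bar>))"
      by (intro mult_left_mono) auto
    also have "\<dots> = 2 * L / K * dist v w" by (simp add: exp_minus)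
    also have "\<dots> \<le> 1/2 * dist v w" using K by (intro mult_right_mono) auto
    finally show "dist (apply_bcontfun (Bcontfun (h v)) t) (apply_bcontfun (Bcontfun (h w)) t) \<le> 1/2 * dist v w"
      by (simp add: Bcontfun_inverse[OF h_bcont] h_def dist_norm scaleR_diff_right[symmetric])
  qed
  have "\<exists>!v. Bcontfun (h v) = v"
    by (rule banach_fix_type[of "1/2"]) (simp_all only: h_contr, simp_all)
  then obtain v where v: "Bcontfun (h v) = v" by blast
  define u where "u t = u0 + V v t" for t
  have "apply_bcontfun v t = h v t" for t using Bcontfun_inverse[OF h_bcont, of v] v by simp
  then have uv: "exp (K * \<bar>t\<bar>) *\<^sub>R apply_bcontfun v t = u t" for t
    by (simp add: h_def u_def exp_minus)
  have u': "(u has_vector_derivative F t (P (u t))) (at t)" for t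
  proof -
    have "(u has_vector_derivative g v t) (at t)"
      unfolding u_def by (auto intro!: derivative_eq_intros V)
    then show ?thesis by (simp add: g_def uv)
  qed
  \<comment> \<open>The retraction rescales \<open>x\<close> by a positive factor, so the cut-off
    field is still orthogonal to \<open>x\<close>. Hence the norm is constant, the solution never
    leaves the ball, and the cut-off is invisible to it.\<close>
  have "inner (F t (P x)) x = 0" for t x
    using orthogonal[of t "P x"] R by (auto simp: P_def max_def split: if_splits)
  then have "norm (u t) = norm (u 0)" for t
    by (intro norm_const_of_orthogonal_derivative[OF u'])
  then have "P (u t) = u t" for t using R V0 by (intro P_id) (simp add: u_def)
  then have "solves u" using u' by (simp add: solves_def)
  moreover have "u 0 = u0" by (simp add: u_def V0)
  ultimately show ?thesis using that by blast
qed

end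

section \<open>Square-summable families\<close>

text \<open>A type of its own gives access to the class-based theory of Hilbert and Banach spaces
  and of bounded continuous functions. \<open>ell2_of\<close> is unspecified outside the
  square-summable families, so each use needs a summability proof.\<close>

typedef 'a ell2 = "{f :: 'a \<Rightarrow> complex. (\<lambda>k. (cmod (f k))\<^sup>2) summable_on UNIV}"
  morphisms coord ell2_of
  by (rule exI[of _ "\<lambda>_. 0"]) simp

lemma coord_summable: "(\<lambda>k. (cmod (coord x k))\<^sup>2) summable_on UNIV"
  using coord by auto

lemma coord_ell2_of:
  "(\<lambda>k. (cmod (f k))\<^sup>2) summable_on UNIV \<Longrightarrow> coord (ell2_of f) = f"
  by (simp add: ell2_of_inverse)

lemma ell2_eqI: "(\<And>k. coord x k = coord y k) \<Longrightarrow> x = y"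
  by (metis coord_inject ext)

lemma square_summable_bound:
  fixes f :: "'a \<Rightarrow> complex"
  assumes "\<And>A. finite A \<Longrightarrow> (\<Sum>k\<in>A. (cmod (f k))\<^sup>2) \<le> B"
  shows "(\<lambda>k. (cmod (f k))\<^sup>2) summable_on UNIV" "(\<Sum>\<^sub>\<infinity>k. (cmod (f k))\<^sup>2) \<le> B"
proof -
  show "(\<lambda>k. (cmod (f k))\<^sup>2) summable_on UNIV"
    using assms by (intro nonneg_bdd_above_summable_on) (auto intro!: bdd_aboveI2)
  then show "(\<Sum>\<^sub>\<infinity>k. (cmod (f k))\<^sup>2) \<le> B"
    using assms by (intro infsum_le_finite_sums) auto
qed

lemma square_summable_add:
  fixes f g :: "'a \<Rightarrow> complex"
  assumes "(\<lambda>k. (cmod (f k))\<^sup>2) summable_on UNIV" "(\<lambda>k. (cmod (g k))\<^sup>2) summable_on UNIV"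
  shows "(\<lambda>k. (cmod (f k + g k))\<^sup>2) summable_on UNIV"
proof (rule summable_on_comparison_test)
  show "(\<lambda>k. 2 * ((cmod (f k))\<^sup>2 + (cmod (g k))\<^sup>2)) summable_on UNIV"
    by (intro summable_on_cmult_right summable_on_add assms)
  fix k
  have "(cmod (f k + g k))\<^sup>2 \<le> (cmod (f k) + cmod (g k))\<^sup>2"
    by (intro power_mono norm_triangle_ineq) auto
  also have "\<dots> \<le> 2 * ((cmod (f k))\<^sup>2 + (cmod (g k))\<^sup>2)"
    using sum_squares_ge_zero[of "cmod (f k) - cmod (g k)" 0] by (simp add: power2_eq_square algebra_simps)
  finally show "(cmod (f k + g k))\<^sup>2 \<le> 2 * ((cmod (f k))\<^sup>2 + (cmod (g k))\<^sup>2)" .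
qed auto

lemma square_summable_mult:
  fixes f g :: "'a \<Rightarrow> complex"
  assumes "(\<lambda>k. (cmod (f k))\<^sup>2) summable_on UNIV" "\<And>k. cmod (g k) \<le> C"
  shows "(\<lambda>k. (cmod (g k * f k))\<^sup>2) summable_on UNIV"
proof (rule summable_on_comparison_test)
  show "(\<lambda>k. C\<^sup>2 * (cmod (f k))\<^sup>2) summable_on UNIV"
    by (intro summable_on_cmult_right assms)
  show "(cmod (g k * f k))\<^sup>2 \<le> C\<^sup>2 * (cmod (f k))\<^sup>2" for k
    using assms(2)[of k] by (auto simp: norm_mult power_mult_distrib intro!: mult_right_mono power_mono)
qed auto

lemma mult_le_sum_squares: "a * b \<le> a\<^sup>2 + b\<^sup>2" for a b :: real
  using zero_le_power2[of "a + b"] zero_le_power2[of "a - b"] unfolding power2_diff power2_sum by linarith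

lemma square_summable_inner:
  fixes f g :: "'a \<Rightarrow> complex"
  assumes "(\<lambda>k. (cmod (f k))\<^sup>2) summable_on UNIV" "(\<lambda>k. (cmod (g k))\<^sup>2) summable_on UNIV"
  shows "(\<lambda>k. norm (f k * cnj (g k))) summable_on UNIV"
proof (rule Infinite_Sum.abs_summable_on_comparison_test)
  show "(\<lambda>k. norm ((cmod (f k))\<^sup>2 + (cmod (g k))\<^sup>2)) summable_on UNIV"
    using summable_on_add[OF assms] by simp
  show "norm (f k * cnj (g k)) \<le> norm ((cmod (f k))\<^sup>2 + (cmod (g k))\<^sup>2)" for k
    by (simp add: norm_mult mult_le_sum_squares)
qed

lemma summable_Re: "f summable_on A \<Longrightarrow> (\<lambda>x. Re (f x)) summable_on A"
  by (rule summable_on_bounded_linear[OF bounded_linear_Re])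

lemma summable_coord_inner: "(\<lambda>k. Re (coord x k * cnj (coord y k))) summable_on UNIV"
  by (rule summable_Re[OF abs_summable_summable[OF square_summable_inner[OF coord_summable coord_summable]]])

instantiation ell2 :: (type) real_vector
begin

definition zero_ell2 :: "'a ell2" where "0 = ell2_of (\<lambda>_. 0)"
definition plus_ell2 :: "'a ell2 \<Rightarrow> 'a ell2 \<Rightarrow> 'a ell2"
  where "x + y = ell2_of (\<lambda>k. coord x k + coord y k)"
definition uminus_ell2 :: "'a ell2 \<Rightarrow> 'a ell2" where "- x = ell2_of (\<lambda>k. - coord x k)"
definition minus_ell2 :: "'a ell2 \<Rightarrow> 'a ell2 \<Rightarrow> 'a ell2" where "x - y = x + - (y :: 'a ell2)"
definition scaleR_ell2 :: "real \<Rightarrow> 'a ell2 \<Rightarrow> 'a ell2"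
  where "r *\<^sub>R x = ell2_of (\<lambda>k. of_real r * coord x k)"

lemma coord_zero [simp]: "coord 0 k = 0"
  by (simp add: zero_ell2_def coord_ell2_of)

lemma coord_add [simp]: "coord (x + y) k = coord x k + coord y k"
  by (simp add: plus_ell2_def coord_ell2_of square_summable_add coord_summable)

lemma coord_uminus [simp]: "coord (- x) k = - coord x k"
  by (simp add: uminus_ell2_def coord_ell2_of coord_summable)

lemma coord_diff [simp]: "coord (x - y) k = coord x k - coord y k"
  by (simp add: minus_ell2_def)

lemma coord_scaleR [simp]: "coord (r *\<^sub>R x) k = of_real r * coord x k"
  by (simp add: scaleR_ell2_def coord_ell2_of coord_summable
      square_summable_mult[where g = "\<lambda>_. of_real r" and C = "\<bar>r\<bar>"])

instance
proof
  fix x y z :: "'a ell2" and r s :: real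
  show "x + y + z = x + (y + z)" "x + y = y + x" "0 + x = x" "- x + x = 0" "x - y = x + - y"
    "r *\<^sub>R (x + y) = r *\<^sub>R x + r *\<^sub>R y" "(r + s) *\<^sub>R x = r *\<^sub>R x + s *\<^sub>R x"
    "r *\<^sub>R s *\<^sub>R x = (r * s) *\<^sub>R x" "1 *\<^sub>R x = x"
    by (auto intro!: ell2_eqI simp: algebra_simps)
qed

end

instantiation ell2 :: (type) real_inner
begin

text \<open>Real scalars fit here: the cubic field is not complex linear, and the Hermitian pairing
  of the rotated field with its argument is purely imaginary, so that it vanishes after taking the
  real part.\<close>

definition inner_ell2 :: "'a ell2 \<Rightarrow> 'a ell2 \<Rightarrow> real"
  where "inner x y = (\<Sum>\<^sub>\<infinity>k. Re (coord x k * cnj (coord y k)))"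
definition norm_ell2 :: "'a ell2 \<Rightarrow> real" where "norm x = sqrt (inner x (x :: 'a ell2))"
definition dist_ell2 :: "'a ell2 \<Rightarrow> 'a ell2 \<Rightarrow> real" where "dist x y = norm (x - y :: 'a ell2)"
definition sgn_ell2 :: "'a ell2 \<Rightarrow> 'a ell2" where "sgn x = inverse (norm x) *\<^sub>R (x :: 'a ell2)"
definition uniformity_ell2 :: "('a ell2 \<times> 'a ell2) filter"
  where "uniformity_ell2 = (INF e\<in>{0<..}. principal {(x, y). dist x y < e})"
definition open_ell2 :: "'a ell2 set \<Rightarrow> bool"
  where "open_ell2 S \<longleftrightarrow> (\<forall>x\<in>S. \<forall>\<^sub>F (x', y) in uniformity. x' = x \<longrightarrow> y \<in> S)"

lemma inner_self_ell2: "inner x x = (\<Sum>\<^sub>\<infinity>k. (cmod (coord x k))\<^sup>2)"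
  by (simp only: inner_ell2_def complex_norm_square[symmetric] Re_complex_of_real)

instance
proof
  fix x y z :: "'a ell2" and r :: real
  show "dist x y = norm (x - y)" by (rule dist_ell2_def)
  show "sgn x = x /\<^sub>R norm x" by (simp add: sgn_ell2_def)
  show "uniformity = (INF e\<in>{0<..}. principal {(x :: 'a ell2, y). dist x y < e})"
    by (rule uniformity_ell2_def)
  show "open U \<longleftrightarrow> (\<forall>x\<in>U. \<forall>\<^sub>F (x', y) in uniformity. x' = x \<longrightarrow> y \<in> U)" for U :: "'a ell2 set"
    by (rule open_ell2_def)
  show "inner x y = inner y x" by (simp add: inner_ell2_def mult.commute)
  show "inner (x + y) z = inner x z + inner y z"
    unfolding inner_ell2_def using infsum_add[OF summable_coord_inner[of x z] summable_coord_inner[of y z]]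
    by (simp add: algebra_simps)
  show "inner (r *\<^sub>R x) y = r * inner x y"
    unfolding inner_ell2_def infsum_cmult_right'[symmetric] by (simp add: algebra_simps)
  show "0 \<le> inner x x" by (simp add: inner_self_ell2 infsum_nonneg)
  show "inner x x = 0 \<longleftrightarrow> x = 0"
  proof
    assume "inner x x = 0"
    then have "(cmod (coord x k))\<^sup>2 = 0" for k
      using nonneg_infsum_le_0D[of "\<lambda>k. (cmod (coord x k))\<^sup>2" UNIV k] coord_summable[of x]
      by (simp add: inner_self_ell2)
    then show "x = 0" by (intro ell2_eqI) simp
  qed (simp add: inner_ell2_def)
  show "norm x = sqrt (inner x x)" by (rule norm_ell2_def)
qed

end

lemma norm_ell2_power2: "(norm x)\<^sup>2 = (\<Sum>\<^sub>\<infinity>k. (cmod (coord x k))\<^sup>2)"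
  by (simp add: power2_norm_eq_inner inner_self_ell2)

lemma sum_coord_le: "finite A \<Longrightarrow> (\<Sum>k\<in>A. (cmod (coord x k))\<^sup>2) \<le> (norm x)\<^sup>2"
  unfolding norm_ell2_power2 by (intro finite_sum_le_infsum coord_summable) auto

lemma cmod_coord_le: "cmod (coord x k) \<le> norm x"
proof (rule power2_le_imp_le)
  show "(cmod (coord x k))\<^sup>2 \<le> (norm x)\<^sup>2" using sum_coord_le[of "{k}" x] by simp
qed simp

lemma bounded_linear_coord: "bounded_linear (\<lambda>x. coord x k)"
  by (rule bounded_linear_intro[where K = 1])
    (auto simp: scaleR_conv_of_real cmod_coord_le)

text \<open>Bounds on finite sums yield at once that \<open>ell2_of f\<close> is no junk value and
  that its norm is controlled. The norm bounds of multipliers and of the cubic map both come from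
  here.\<close>

lemma ell2_of_bound:
  assumes "\<And>A. finite A \<Longrightarrow> (\<Sum>k\<in>A. (cmod (f k))\<^sup>2) \<le> B\<^sup>2" and "B \<ge> 0"
  shows "coord (ell2_of f) = f" "norm (ell2_of f) \<le> B"
proof -
  show *: "coord (ell2_of f) = f"
    using assms by (intro coord_ell2_of square_summable_bound)
  have "(norm (ell2_of f))\<^sup>2 \<le> B\<^sup>2"
    unfolding norm_ell2_power2 * using assms by (intro square_summable_bound(2))
  then show "norm (ell2_of f) \<le> B" by (rule power2_le_imp_le) (rule assms(2))
qed

instance ell2 :: (type) banach
proof
  fix X :: "nat \<Rightarrow> 'a ell2"
  assume X: "Cauchy X"
  have "Cauchy (\<lambda>n. coord (X n) k)" for k
    using bounded_linear.Cauchy[OF bounded_linear_coord X] .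
  then obtain f where f: "\<And>k. (\<lambda>n. coord (X n) k) \<longlonglongrightarrow> f k"
    unfolding convergent_eq_Cauchy[symmetric] by metis
  \<comment> \<open>Convergence of each coordinate passes only through finite sums; the bound is
    therefore proved for finite \<open>A\<close>, with \<open>N\<close> independent of
    \<open>A\<close>.\<close>
  have close: "\<exists>N. \<forall>n\<ge>N. \<forall>A. finite A \<longrightarrow> (\<Sum>k\<in>A. (cmod (coord (X n) k - f k))\<^sup>2) \<le> e\<^sup>2"
    if "e > 0" for e
  proof -
    obtain N where N: "\<And>m n. m \<ge> N \<Longrightarrow> n \<ge> N \<Longrightarrow> norm (X n - X m) < e"
      using CauchyD[OF X \<open>e > 0\<close>] by blast
    have "(\<Sum>k\<in>A. (cmod (coord (X n) k - f k))\<^sup>2) \<le> e\<^sup>2" if "n \<ge> N" "finite A" for n A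
    proof (rule LIMSEQ_le_const2)
      show "(\<lambda>m. \<Sum>k\<in>A. (cmod (coord (X n) k - coord (X m) k))\<^sup>2) \<longlonglongrightarrow> (\<Sum>k\<in>A. (cmod (coord (X n) k - f k))\<^sup>2)"
        by (intro tendsto_intros f)
      have "(\<Sum>k\<in>A. (cmod (coord (X n - X m) k))\<^sup>2) \<le> e\<^sup>2" if "m \<ge> N" for m
        using sum_coord_le[OF \<open>finite A\<close>, of "X n - X m"] N[OF that \<open>n \<ge> N\<close>]
        power_mono[of "norm (X n - X m)" e 2] by simp
      then show "\<exists>M. \<forall>m\<ge>M. (\<Sum>k\<in>A. (cmod (coord (X n) k - coord (X m) k))\<^sup>2) \<le> e\<^sup>2"
        by auto
    qed
    then show ?thesis by blast
  qed
  have f_sum: "(\<lambda>k. (cmod (f k))\<^sup>2) summable_on UNIV"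
  proof -
    obtain N where N: "\<forall>A. finite A \<longrightarrow> (\<Sum>k\<in>A. (cmod (coord (X N) k - f k))\<^sup>2) \<le> 1\<^sup>2"
      using close[of 1] by auto
    have "(\<lambda>k. (cmod (coord (X N) k - f k))\<^sup>2) summable_on UNIV"
      using N by (intro square_summable_bound(1)) auto
    then have "(\<lambda>k. (cmod (f k - coord (X N) k))\<^sup>2) summable_on UNIV"
      by (simp add: norm_minus_commute)
    from square_summable_add[OF this coord_summable[of "X N"]] show ?thesis by simp
  qed
  have "X \<longlonglongrightarrow> ell2_of f"
  proof (rule metric_LIMSEQ_I)
    fix e :: real assume "e > 0"
    then obtain N where N: "\<And>n A. n \<ge> N \<Longrightarrow> finite A \<Longrightarrow> (\<Sum>k\<in>A. (cmod (coord (X n) k - f k))\<^sup>2) \<le> (e/2)\<^sup>2"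
      using close[of "e/2"] by auto
    have "(norm (X n - ell2_of f))\<^sup>2 \<le> (e/2)\<^sup>2" if "n \<ge> N" for n
      unfolding norm_ell2_power2 using N[OF that]
      by (intro square_summable_bound(2)) (simp add: coord_ell2_of[OF f_sum])
    then have "norm (X n - ell2_of f) \<le> e/2" if "n \<ge> N" for n
      by (rule power2_le_imp_le[OF _ less_imp_le[OF half_gt_zero[OF \<open>e > 0\<close>]]]) (rule that)
    then show "\<exists>N. \<forall>n\<ge>N. dist (X n) (ell2_of f) < e"
      using \<open>e > 0\<close> by (intro exI[of _ N]) (force simp: dist_norm)
  qed
  then show "convergent X" by (auto simp: convergent_def)
qed

section \<open>Resonant cubic interactions\<close>

definition multiplier :: "('a \<Rightarrow> complex) \<Rightarrow> 'a ell2 \<Rightarrow> 'a ell2" where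
  "multiplier w x = ell2_of (\<lambda>k. w k * coord x k)"

context
  fixes w :: "'a \<Rightarrow> complex"
  assumes w: "\<And>k. cmod (w k) \<le> 1"
begin

lemma coord_multiplier: "coord (multiplier w x) k = w k * coord x k"
  unfolding multiplier_def
  by (subst coord_ell2_of) (intro square_summable_mult[OF coord_summable w], simp)

lemma multiplier_diff: "multiplier w x - multiplier w y = multiplier w (x - y)"
  by (rule ell2_eqI) (simp add: coord_multiplier algebra_simps)

lemma norm_multiplier_le: "norm (multiplier w x) \<le> norm x"
  unfolding multiplier_def
proof (rule ell2_of_bound(2))
  show "(\<Sum>k\<in>A. (cmod (w k * coord x k))\<^sup>2) \<le> (norm x)\<^sup>2" if "finite A" for A
  proof -
    have "(\<Sum>k\<in>A. (cmod (w k * coord x k))\<^sup>2) \<le> (\<Sum>k\<in>A. (cmod (coord x k))\<^sup>2)"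
      using w by (intro sum_mono power_mono) (auto simp: norm_mult mult_left_le_one_le)
    also have "\<dots> \<le> (norm x)\<^sup>2" by (rule sum_coord_le[OF that])
    finally show ?thesis .
  qed
qed simp

end

text \<open>The symbols need not be equicontinuous in \<open>k\<close>, so the vector
  \<open>x\<close> is kept fixed: a finite set of coordinates carries almost all of its norm, and
  the finitely many symbols there converge together.\<close>

lemma continuous_multiplier:
  fixes w :: "real \<Rightarrow> 'a \<Rightarrow> complex"
  assumes w: "\<And>t k. cmod (w t k) \<le> 1" and w_cont: "\<And>k. continuous_on UNIV (\<lambda>t. w t k)"
  shows "isCont (\<lambda>t. multiplier (w t) x) s"
proof -
  have "((\<lambda>t. norm (multiplier (w t) x - multiplier (w s) x)) \<longlongrightarrow> 0) (at s)"
  proof (rule tendstoI, unfold dist_real_def)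
    fix e :: real assume e: "e > 0"
    have "((\<lambda>k. (cmod (coord x k))\<^sup>2) has_sum (norm x)\<^sup>2) UNIV"
      unfolding norm_ell2_power2 by (intro has_sum_infsum coord_summable)
    then have "\<forall>\<^sub>F A in finite_subsets_at_top UNIV. dist (\<Sum>k\<in>A. (cmod (coord x k))\<^sup>2) ((norm x)\<^sup>2) < e\<^sup>2 / 8"
      unfolding has_sum_def using e by (intro tendstoD) auto
    \<comment> \<open>Two symbols of modulus at most 1 differ by at most 2, which costs a factor 4
      off \<open>A\<close>: \<open>e\<^sup>2 / 8\<close> becomes \<open>e\<^sup>2 / 2\<close>.
      Together with \<open>e\<^sup>2 / 4\<close> on \<open>A\<close> this stays below
      \<open>e\<^sup>2\<close>.\<close>
    then obtain A where A: "finite A" "dist (\<Sum>k\<in>A. (cmod (coord x k))\<^sup>2) ((norm x)\<^sup>2) < e\<^sup>2 / 8"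
      unfolding eventually_finite_subsets_at_top by auto
    have tail: "(\<Sum>k\<in>B. (cmod (coord x k))\<^sup>2) < e\<^sup>2 / 8" if "finite B" "A \<inter> B = {}" for B
    proof -
      have "(\<Sum>k\<in>A. (cmod (coord x k))\<^sup>2) + (\<Sum>k\<in>B. (cmod (coord x k))\<^sup>2) \<le> (norm x)\<^sup>2"
        using A(1) sum_coord_le[of "A \<union> B" x] that by (simp add: sum.union_disjoint)
      then show ?thesis using A(2) unfolding dist_real_def by linarith
    qed
    have "((\<lambda>t. \<Sum>k\<in>A. (cmod ((w t k - w s k) * coord x k))\<^sup>2) \<longlongrightarrow> (\<Sum>k\<in>A. (cmod ((w s k - w s k) * coord x k))\<^sup>2)) (at s)"
      using w_cont by (intro tendsto_intros) (auto simp: continuous_on_def)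
    then have "((\<lambda>t. \<Sum>k\<in>A. (cmod ((w t k - w s k) * coord x k))\<^sup>2) \<longlongrightarrow> 0) (at s)" by simp
    then have "\<forall>\<^sub>F t in at s. dist (\<Sum>k\<in>A. (cmod ((w t k - w s k) * coord x k))\<^sup>2) 0 < e\<^sup>2 / 4"
      using e by (intro tendstoD) auto
    then show "\<forall>\<^sub>F t in at s. \<bar>norm (multiplier (w t) x - multiplier (w s) x) - 0\<bar> < e"
    proof eventually_elim
      fix t assume t: "dist (\<Sum>k\<in>A. (cmod ((w t k - w s k) * coord x k))\<^sup>2) 0 < e\<^sup>2 / 4"
      let ?y = "multiplier (w t) x - multiplier (w s) x"
      have "(\<Sum>k\<in>B. (cmod (coord ?y k))\<^sup>2) \<le> 3 / 4 * e\<^sup>2" if B: "finite B" for B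
      proof -
        have "(\<Sum>k\<in>B. (cmod (coord ?y k))\<^sup>2) = (\<Sum>k\<in>B. (cmod ((w t k - w s k) * coord x k))\<^sup>2)"
          by (simp add: coord_multiplier w algebra_simps)
        also have "\<dots> \<le> (\<Sum>k\<in>A \<union> (B - A). (cmod ((w t k - w s k) * coord x k))\<^sup>2)"
          using A B by (intro sum_mono2) auto
        also have "\<dots> = (\<Sum>k\<in>A. (cmod ((w t k - w s k) * coord x k))\<^sup>2)
            + (\<Sum>k\<in>B - A. (cmod ((w t k - w s k) * coord x k))\<^sup>2)"
          using A B by (intro sum.union_disjoint) auto
        also have "(\<Sum>k\<in>B - A. (cmod ((w t k - w s k) * coord x k))\<^sup>2) \<le> (\<Sum>k\<in>B - A. 4 * (cmod (coord x k))\<^sup>2)"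
        proof (rule sum_mono)
          fix k
          have "cmod (w t k - w s k) \<le> 2"
            using norm_triangle_ineq4[of "w t k" "w s k"] w[of t k] w[of s k] by linarith
          then have "(cmod (w t k - w s k))\<^sup>2 \<le> 2\<^sup>2" by (intro power_mono) auto
          then show "(cmod ((w t k - w s k) * coord x k))\<^sup>2 \<le> 4 * (cmod (coord x k))\<^sup>2"
            unfolding norm_mult power_mult_distrib by (intro mult_right_mono) auto
        qed
        also have "\<dots> \<le> e\<^sup>2 / 2"
          using tail[of "B - A"] B by (simp add: sum_distrib_left[symmetric])
        finally show ?thesis using t by (simp add: dist_real_def)
      qed
      then have "(norm ?y)\<^sup>2 \<le> 3 / 4 * e\<^sup>2"
        unfolding norm_ell2_power2 by (intro square_summable_bound(2))
      also have "\<dots> < e\<^sup>2" using e by simp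
      finally have "norm ?y < e" by (rule power2_less_imp_less) (use e in simp)
      then show "\<bar>norm ?y - 0\<bar> < e" by simp
    qed
  qed
  then show ?thesis
    unfolding isCont_def by (rule LIM_zero_cancel[OF tendsto_norm_zero_cancel])
qed

text \<open>Multipliers do not increase the norm, so \<open>multiplier (w t) (u t - u s)\<close>
  tends to 0; what remains is continuity at the fixed vector \<open>u s\<close>.\<close>

lemma continuous_on_multiplier:
  fixes w :: "real \<Rightarrow> 'a \<Rightarrow> complex"
  assumes w: "\<And>t k. cmod (w t k) \<le> 1" and w_cont: "\<And>k. continuous_on UNIV (\<lambda>t. w t k)"
    and u: "continuous_on UNIV u"
  shows "continuous_on UNIV (\<lambda>t. multiplier (w t) (u t))"
proof (rule continuous_at_imp_continuous_on, rule ballI)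
  fix s :: real
  have "((\<lambda>t. multiplier (w t) (u s)) \<longlongrightarrow> multiplier (w s) (u s)) (at s)"
    using continuous_multiplier[OF w w_cont] by (simp add: isCont_def)
  moreover have "((\<lambda>t. multiplier (w t) (u t - u s)) \<longlongrightarrow> 0) (at s)"
  proof (rule Lim_null_comparison)
    show "\<forall>\<^sub>F t in at s. norm (multiplier (w t) (u t - u s)) \<le> norm (u t - u s)"
      by (intro always_eventually allI norm_multiplier_le w)
    have "(u \<longlongrightarrow> u s) (at s)" using u by (simp add: continuous_on_def)
    then show "((\<lambda>t. norm (u t - u s)) \<longlongrightarrow> 0) (at s)"
      by (intro tendsto_norm_zero LIM_zero)
  qed
  ultimately have "((\<lambda>t. multiplier (w t) (u s) + multiplier (w t) (u t - u s)) \<longlongrightarrow> multiplier (w s) (u s) + 0) (at s)"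
    by (rule tendsto_add)
  then show "isCont (\<lambda>t. multiplier (w t) (u t)) s"
    by (simp add: isCont_def multiplier_diff[OF w, symmetric])
qed

text \<open>Turns a bound on the number of completions into a bound on sums: \<open>g\<close> takes
  each value at most \<open>M\<close> times, so a sum over quartets or triples costs a factor
  \<open>M\<close> over a sum over pairs or single modes.\<close>

lemma sum_compose_le_of_fibres:
  fixes h :: "'b \<Rightarrow> real"
  assumes "finite F" and fibre: "\<And>y. card {x \<in> F. g x = y} \<le> M"
    and h: "\<And>y. h y \<ge> 0" and B: "\<And>Y. finite Y \<Longrightarrow> sum h Y \<le> B"
  shows "(\<Sum>x\<in>F. h (g x)) \<le> real M * B"
proof -
  have "(\<Sum>x\<in>F. h (g x)) = (\<Sum>y\<in>g ` F. \<Sum>x\<in>{x \<in> F. g x = y}. h (g x))"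
    by (rule sum.image_gen[OF \<open>finite F\<close>])
  also have "\<dots> = (\<Sum>y\<in>g ` F. real (card {x \<in> F. g x = y}) * h y)"
    by (intro sum.cong) auto
  also have "\<dots> \<le> (\<Sum>y\<in>g ` F. real M * h y)"
    using fibre h by (intro sum_mono mult_right_mono) auto
  also have "\<dots> = real M * sum h (g ` F)" by (simp add: sum_distrib_left)
  also have "\<dots> \<le> real M * B" using \<open>finite F\<close> by (intro mult_left_mono B) auto
  finally show ?thesis .
qed

lemma sum_coord_pairs_le:
  assumes "finite Y"
  shows "(\<Sum>(k, l)\<in>Y. (cmod (coord x k))\<^sup>2 * (cmod (coord y l))\<^sup>2) \<le> (norm x * norm y)\<^sup>2"
proof -
  have "(\<Sum>(k, l)\<in>Y. (cmod (coord x k))\<^sup>2 * (cmod (coord y l))\<^sup>2)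
      \<le> (\<Sum>(k, l)\<in>fst ` Y \<times> snd ` Y. (cmod (coord x k))\<^sup>2 * (cmod (coord y l))\<^sup>2)"
    using assms by (intro sum_mono2) (auto simp: image_iff, force+)
  also have "\<dots> = (\<Sum>k\<in>fst ` Y. (cmod (coord x k))\<^sup>2) * (\<Sum>l\<in>snd ` Y. (cmod (coord y l))\<^sup>2)"
    by (simp add: sum_product sum.cartesian_product)
  also have "\<dots> \<le> (norm x)\<^sup>2 * (norm y)\<^sup>2"
    using assms by (intro mult_mono sum_coord_le sum_nonneg) auto
  finally show ?thesis by (simp add: power_mult_distrib)
qed

text \<open>Counting the completions of an incoming pair is enough: by \<open>swap\<close> the same
  count bounds the incoming pairs that belong to a given outgoing pair. The lattice and the
  eigenvalues enter the analysis only through this relation and its count.\<close>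

locale resonance_system =
  fixes Q :: "'k \<Rightarrow> 'k \<Rightarrow> 'k \<Rightarrow> 'k \<Rightarrow> bool" and M :: nat
  assumes swap: "Q k1 k2 k3 k4 \<Longrightarrow> Q k3 k4 k1 k2"
    and finite_completions: "finite {(k3, k4). Q k1 k2 k3 k4}"
    and card_completions: "card {(k3, k4). Q k1 k2 k3 k4} \<le> M"
begin

definition triples :: "'k \<Rightarrow> ('k \<times> 'k \<times> 'k) set" where
  "triples k = {(k1, k2, k3). Q k1 k2 k3 k}"

definition cubic_monomial :: "'k ell2 \<Rightarrow> 'k ell2 \<Rightarrow> 'k ell2 \<Rightarrow> 'k \<times> 'k \<times> 'k \<Rightarrow> complex" where
  "cubic_monomial x y z = (\<lambda>(k1, k2, k3). coord x k1 * coord y k2 * cnj (coord z k3))"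

definition cubic :: "'k ell2 \<Rightarrow> 'k ell2 \<Rightarrow> 'k ell2 \<Rightarrow> 'k ell2" where
  "cubic x y z = ell2_of (\<lambda>k. \<Sum>\<^sub>\<infinity>j\<in>triples k. cubic_monomial x y z j)"

text \<open>Quartets with a given incoming pair \<open>(k1, k2)\<close> inject into the completions
  of that pair, so each product of squares is counted at most \<open>M\<close> times.\<close>

lemma sum_incoming_le:
  assumes "finite G" "G \<subseteq> Sigma UNIV triples"
  shows "(\<Sum>(k, k1, k2, k3)\<in>G. (cmod (coord x k1))\<^sup>2 * (cmod (coord y k2))\<^sup>2) \<le> M * (norm x * norm y)\<^sup>2"
proof -
  have "(\<Sum>q\<in>G. (\<lambda>(k, l). (cmod (coord x k))\<^sup>2 * (cmod (coord y l))\<^sup>2) ((\<lambda>(k, k1, k2, k3). (k1, k2)) q))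
      \<le> M * (norm x * norm y)\<^sup>2"
  proof (rule sum_compose_le_of_fibres[OF assms(1),
        where g = "\<lambda>(k, k1, k2, k3). (k1, k2)"
          and h = "\<lambda>(k, l). (cmod (coord x k))\<^sup>2 * (cmod (coord y l))\<^sup>2"])
    fix p :: "'k \<times> 'k"
    obtain k1 k2 where p: "p = (k1, k2)" by force
    let ?G = "{q \<in> G. (\<lambda>(k, k1, k2, k3). (k1, k2)) q = p}"
    have "card ?G = card ((\<lambda>(k, k1, k2, k3). (k3, k)) ` ?G)"
      by (intro card_image[symmetric]) (auto simp: inj_on_def p)
    also have "\<dots> \<le> card {(k3, k4). Q k1 k2 k3 k4}"
      using assms(2) by (intro card_mono finite_completions) (auto simp: p triples_def)
    also have "\<dots> \<le> M" by (rule card_completions)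
    finally show "card ?G \<le> M" .
  next
    fix Y :: "('k \<times> 'k) set" assume "finite Y"
    then show "(\<Sum>(k, l)\<in>Y. (cmod (coord x k))\<^sup>2 * (cmod (coord y l))\<^sup>2) \<le> (norm x * norm y)\<^sup>2"
      by (rule sum_coord_pairs_le)
  qed auto
  then show ?thesis by (simp add: case_prod_unfold)
qed

text \<open>With \<open>k\<close> and \<open>k3\<close> given, \<open>swap\<close> turns the
  possible \<open>(k1, k2)\<close> into completions of \<open>(k3, k)\<close>, so each
  \<open>k3\<close> occurs at most \<open>M\<close> times among the triples of
  \<open>k\<close>.\<close>

lemma sum_third_le:
  assumes "finite F" "F \<subseteq> triples k"
  shows "(\<Sum>(k1, k2, k3)\<in>F. (cmod (coord z k3))\<^sup>2) \<le> M * (norm z)\<^sup>2"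
proof -
  have "(\<Sum>j\<in>F. (\<lambda>k. (cmod (coord z k))\<^sup>2) ((\<lambda>(k1, k2, k3). k3) j)) \<le> M * (norm z)\<^sup>2"
  proof (rule sum_compose_le_of_fibres[OF assms(1),
        where g = "\<lambda>(k1, k2, k3). k3" and h = "\<lambda>k. (cmod (coord z k))\<^sup>2"])
    fix k3
    let ?F = "{j \<in> F. (\<lambda>(k1, k2, k3). k3) j = k3}"
    have "card ?F = card ((\<lambda>(k1, k2, k3). (k1, k2)) ` ?F)"
      by (intro card_image[symmetric]) (auto simp: inj_on_def)
    also have "\<dots> \<le> card {(k1, k2). Q k3 k k1 k2}"
      using assms(2) swap by (intro card_mono finite_completions) (auto simp: triples_def)
    also have "\<dots> \<le> M" by (rule card_completions)
    finally show "card ?F \<le> M" .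
  qed (auto intro: sum_coord_le)
  then show ?thesis by (simp add: case_prod_unfold)
qed

lemma summable_incoming:
  "(\<lambda>(k, k1, k2, k3). (cmod (coord x k1))\<^sup>2 * (cmod (coord y k2))\<^sup>2) summable_on Sigma UNIV triples"
  using sum_incoming_le by (intro nonneg_bdd_above_summable_on) (auto intro!: bdd_aboveI2)

text \<open>The first factor of Cauchy--Schwarz over the triples of \<open>k\<close>. Its
  summability over all \<open>k\<close> is what makes the output square summable.\<close>

definition incoming :: "'k ell2 \<Rightarrow> 'k ell2 \<Rightarrow> 'k \<Rightarrow> real" where
  "incoming x y k = (\<Sum>\<^sub>\<infinity>(k1, k2, k3)\<in>triples k. (cmod (coord x k1))\<^sup>2 * (cmod (coord y k2))\<^sup>2)"

lemma summable_incoming_fibre: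
  "(\<lambda>(k1, k2, k3). (cmod (coord x k1))\<^sup>2 * (cmod (coord y k2))\<^sup>2) summable_on triples k"
  using summable_on_SigmaD1[OF summable_incoming[of x y], of k] by (simp add: case_prod_unfold)

text \<open>Cauchy--Schwarz with the incoming pair in one factor and the third mode in the other.
  The second factor is bounded uniformly in \<open>k\<close> by \<open>sum_third_le\<close>; the
  first is left to be summed over \<open>k\<close>.\<close>

lemma sum_cubic_monomial_le:
  assumes "finite F" "F \<subseteq> triples k"
  shows "(\<Sum>j\<in>F. cmod (cubic_monomial x y z j)) \<le> sqrt (incoming x y k * (M * (norm z)\<^sup>2))"
proof (rule real_le_rsqrt)
  have "(\<Sum>j\<in>F. cmod (cubic_monomial x y z j)) =
      (\<Sum>j\<in>F. (case j of (k1, k2, k3) \<Rightarrow> cmod (coord x k1) * cmod (coord y k2)) * (case j of (k1, k2, k3) \<Rightarrow> cmod (coord z k3)))"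
    by (simp add: cubic_monomial_def case_prod_unfold norm_mult)
  then have "(\<Sum>j\<in>F. cmod (cubic_monomial x y z j))\<^sup>2 \<le>
      (\<Sum>j\<in>F. (case j of (k1, k2, k3) \<Rightarrow> cmod (coord x k1) * cmod (coord y k2))\<^sup>2) *
      (\<Sum>j\<in>F. (case j of (k1, k2, k3) \<Rightarrow> cmod (coord z k3))\<^sup>2)"
    by (simp only: Cauchy_Schwarz_ineq_sum)
  also have "\<dots> \<le> incoming x y k * (M * (norm z)\<^sup>2)"
  proof (intro mult_mono)
    have "(\<Sum>(k1, k2, k3)\<in>F. (cmod (coord x k1))\<^sup>2 * (cmod (coord y k2))\<^sup>2) \<le> incoming x y k"
      unfolding incoming_def using assms by (intro finite_sum_le_infsum summable_incoming_fibre) auto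
    then show "(\<Sum>j\<in>F. (case j of (k1, k2, k3) \<Rightarrow> cmod (coord x k1) * cmod (coord y k2))\<^sup>2) \<le> incoming x y k"
      by (simp add: case_prod_unfold power_mult_distrib)
    show "(\<Sum>j\<in>F. (case j of (k1, k2, k3) \<Rightarrow> cmod (coord z k3))\<^sup>2) \<le> M * (norm z)\<^sup>2"
      using sum_third_le[OF assms, of z] by (simp add: case_prod_unfold)
  qed (auto intro!: sum_nonneg infsum_nonneg simp: incoming_def)
  finally show "(\<Sum>j\<in>F. cmod (cubic_monomial x y z j))\<^sup>2 \<le> incoming x y k * (M * (norm z)\<^sup>2)" .
qed

lemma cubic_monomial_abs_summable: "(\<lambda>j. cmod (cubic_monomial x y z j)) summable_on triples k"
  using sum_cubic_monomial_le by (intro nonneg_bdd_above_summable_on) (auto intro!: bdd_aboveI2)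

lemma cubic_monomial_summable: "cubic_monomial x y z summable_on triples k"
  by (rule abs_summable_summable[OF cubic_monomial_abs_summable])

text \<open>One factor \<open>M\<close> is the uniform bound on the third mode, the other comes from
  summing \<open>incoming\<close> over \<open>k\<close>; together they are the
  \<open>M\<^sup>2\<close> of the squared bound.\<close>

lemma sum_cubic_coeff_le:
  assumes "finite A"
  shows "(\<Sum>k\<in>A. (cmod (\<Sum>\<^sub>\<infinity>j\<in>triples k. cubic_monomial x y z j))\<^sup>2) \<le> (M * norm x * norm y * norm z)\<^sup>2"
proof -
  have "(\<Sum>k\<in>A. (cmod (\<Sum>\<^sub>\<infinity>j\<in>triples k. cubic_monomial x y z j))\<^sup>2) \<le> (\<Sum>k\<in>A. incoming x y k * (M * (norm z)\<^sup>2))"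
  proof (rule sum_mono)
    fix k
    have "cmod (\<Sum>\<^sub>\<infinity>j\<in>triples k. cubic_monomial x y z j) \<le> (\<Sum>\<^sub>\<infinity>j\<in>triples k. cmod (cubic_monomial x y z j))"
      by (rule norm_infsum_bound[OF cubic_monomial_abs_summable])
    also have "\<dots> \<le> sqrt (incoming x y k * (M * (norm z)\<^sup>2))"
      by (intro infsum_le_finite_sums cubic_monomial_abs_summable sum_cubic_monomial_le)
    finally have "(cmod (\<Sum>\<^sub>\<infinity>j\<in>triples k. cubic_monomial x y z j))\<^sup>2 \<le> (sqrt (incoming x y k * (M * (norm z)\<^sup>2)))\<^sup>2"
      by (intro power_mono) auto
    moreover have "0 \<le> incoming x y k" by (auto simp: incoming_def intro!: infsum_nonneg)
    ultimately show "(cmod (\<Sum>\<^sub>\<infinity>j\<in>triples k. cubic_monomial x y z j))\<^sup>2 \<le> incoming x y k * (M * (norm z)\<^sup>2)"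
      by simp
  qed
  also have "\<dots> = (\<Sum>k\<in>A. incoming x y k) * (M * (norm z)\<^sup>2)" by (rule sum_distrib_right[symmetric])
  also have "(\<Sum>k\<in>A. incoming x y k) \<le> M * (norm x * norm y)\<^sup>2"
  proof -
    let ?f = "\<lambda>(k, k1, k2, k3). (cmod (coord x k1))\<^sup>2 * (cmod (coord y k2))\<^sup>2"
    have s: "?f summable_on Sigma A triples"
      by (rule summable_on_subset_banach[OF summable_incoming]) auto
    have "(\<Sum>k\<in>A. incoming x y k) = infsum (incoming x y) A" using assms by simp
    also have "\<dots> = infsum ?f (Sigma A triples)"
      unfolding incoming_def using infsum_Sigma_banach[OF s] by (simp add: case_prod_unfold)
    also have "\<dots> \<le> M * (norm x * norm y)\<^sup>2"
    proof (rule infsum_le_finite_sums[OF s])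
      fix F assume "finite F" "F \<subseteq> Sigma A triples"
      then show "sum ?f F \<le> M * (norm x * norm y)\<^sup>2" by (intro sum_incoming_le) auto
    qed
    finally show ?thesis .
  qed
  finally show ?thesis by (simp add: power_mult_distrib mult_ac power2_eq_square mult_right_mono)
qed

lemma coord_cubic: "coord (cubic x y z) k = (\<Sum>\<^sub>\<infinity>j\<in>triples k. cubic_monomial x y z j)"
  unfolding cubic_def by (subst ell2_of_bound(1)[OF sum_cubic_coeff_le]) auto

lemma norm_cubic_le: "norm (cubic x y z) \<le> M * norm x * norm y * norm z"
  unfolding cubic_def by (rule ell2_of_bound(2)[OF sum_cubic_coeff_le]) auto

lemma cubic_diff:
  "cubic x x x - cubic y y y = cubic (x - y) x x + cubic y (x - y) x + cubic y y (x - y)"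
proof (rule ell2_eqI)
  fix k
  have eq: "cubic_monomial x x x = (\<lambda>j. cubic_monomial (x - y) x x j + cubic_monomial y (x - y) x j
      + cubic_monomial y y (x - y) j + cubic_monomial y y y j)"
    by (simp add: fun_eq_iff cubic_monomial_def case_prod_unfold algebra_simps)
  have "infsum (cubic_monomial x x x) (triples k) = infsum (cubic_monomial (x - y) x x) (triples k)
      + infsum (cubic_monomial y (x - y) x) (triples k) + infsum (cubic_monomial y y (x - y)) (triples k)
      + infsum (cubic_monomial y y y) (triples k)"
    by (subst eq) (simp add: infsum_add summable_on_add cubic_monomial_summable)
  then show "coord (cubic x x x - cubic y y y) k
      = coord (cubic (x - y) x x + cubic y (x - y) x + cubic y y (x - y)) k"
    by (simp add: coord_cubic)
qed

lemma cubic_Lipschitz: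
  fixes R :: real
  assumes "norm x \<le> R" "norm y \<le> R"
  shows "norm (cubic x x x - cubic y y y) \<le> 3 * M * R\<^sup>2 * norm (x - y)"
proof -
  have R: "0 \<le> R" using assms norm_ge_zero order_trans by blast
  have "norm (cubic x x x - cubic y y y)
      \<le> norm (cubic (x - y) x x) + norm (cubic y (x - y) x) + norm (cubic y y (x - y))"
    unfolding cubic_diff by (intro norm_triangle_le add_mono norm_triangle_ineq order_refl)
  also have "\<dots> \<le> M * norm (x - y) * R * R + M * R * norm (x - y) * R + M * R * R * norm (x - y)"
    using assms R by (intro add_mono order_trans[OF norm_cubic_le] mult_mono) auto
  also have "\<dots> = 3 * M * R\<^sup>2 * norm (x - y)" by (simp add: power2_eq_square algebra_simps)
  finally show ?thesis .
qed

lemma continuous_cubic: "continuous_on UNIV (\<lambda>x. cubic x x x)"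
proof (rule continuous_at_imp_continuous_on, rule ballI)
  fix y :: "'k ell2"
  have "((\<lambda>x. cubic x x x - cubic y y y) \<longlongrightarrow> 0) (at y)"
  proof (rule Lim_null_comparison)
    show "\<forall>\<^sub>F x in at y. norm (cubic x x x - cubic y y y) \<le> 3 * M * (norm y + 1)\<^sup>2 * norm (x - y)"
      unfolding eventually_at
    proof (intro exI[of _ 1] conjI ballI impI)
      fix x assume "x \<noteq> y \<and> dist x y < 1"
      then have "norm x \<le> norm y + 1" using norm_triangle_ineq2[of x y] by (simp add: dist_norm)
      then show "norm (cubic x x x - cubic y y y) \<le> 3 * M * (norm y + 1)\<^sup>2 * norm (x - y)"
        by (intro cubic_Lipschitz) auto
    qed simp
    show "((\<lambda>x. 3 * M * (norm y + 1)\<^sup>2 * norm (x - y)) \<longlongrightarrow> 0) (at y)"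
      by (rule tendsto_eq_intros refl)+ simp
  qed
  then show "isCont (\<lambda>x. cubic x x x) y" unfolding isCont_def by (rule LIM_zero_cancel)
qed

text \<open>Exchanging the incoming with the outgoing pair of a quartet conjugates its contribution to
  the pairing below.\<close>

lemma Im_cubic_pairing: "Im (\<Sum>\<^sub>\<infinity>k. coord (cubic x x x) k * cnj (coord x k)) = 0"
proof -
  define f where "f = (\<lambda>(k, k1, k2, k3). coord x k1 * coord x k2 * cnj (coord x k3) * cnj (coord x k))"
  \<comment> \<open>The fourth member of a quartet comes first, as index of the fibre. In this order
    the exchange of the two pairs is the map below, and it is its own inverse.\<close>
  define \<sigma> where "\<sigma> = (\<lambda>(k :: 'k, k1 :: 'k, k2 :: 'k, k3 :: 'k). (k2, k3, k, k1))"
  have \<sigma>: "bij_betw \<sigma> (Sigma UNIV triples) (Sigma UNIV triples)"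
    by (rule bij_betwI[where g = \<sigma>]) (auto simp: \<sigma>_def triples_def intro: swap)
  \<comment> \<open>The product of four coordinates is at most the sum of the squared incoming
    products of the quartet and of its exchange. This gives absolute summability over all quartets,
    which permits writing the double sum as one sum over quartets.\<close>
  let ?i = "\<lambda>(k, k1, k2, k3). (cmod (coord x k1))\<^sup>2 * (cmod (coord x k2))\<^sup>2"
  have "(\<lambda>q. ?i q + ?i (\<sigma> q)) summable_on Sigma UNIV triples"
    using summable_incoming[of x x] summable_on_reindex_bij_betw[OF \<sigma>, of ?i]
    by (intro summable_on_add) auto
  then have "(\<lambda>q. norm (?i q + ?i (\<sigma> q))) summable_on Sigma UNIV triples"
    by (simp add: case_prod_unfold)
  then have "(\<lambda>q. norm (f q)) summable_on Sigma UNIV triples"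
  proof (rule Infinite_Sum.abs_summable_on_comparison_test)
    show "norm (f q) \<le> norm (?i q + ?i (\<sigma> q))" for q
    proof -
      obtain k k1 k2 k3 where q: "q = (k, k1, k2, k3)" by (cases q)
      show ?thesis
        using mult_le_sum_squares[of "cmod (coord x k1) * cmod (coord x k2)" "cmod (coord x k3) * cmod (coord x k)"]
        by (simp add: q f_def \<sigma>_def norm_mult power_mult_distrib mult_ac)
    qed
  qed
  then have f: "f summable_on Sigma UNIV triples" by (rule abs_summable_summable)
  have "(\<Sum>\<^sub>\<infinity>k. coord (cubic x x x) k * cnj (coord x k)) = (\<Sum>\<^sub>\<infinity>k. \<Sum>\<^sub>\<infinity>j\<in>triples k. f (k, j))"
    by (simp add: coord_cubic f_def cubic_monomial_def case_prod_unfold infsum_cmult_left')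
  also have "\<dots> = infsum f (Sigma UNIV triples)" by (rule infsum_Sigma_banach[OF f])
  finally have S: "(\<Sum>\<^sub>\<infinity>k. coord (cubic x x x) k * cnj (coord x k)) = infsum f (Sigma UNIV triples)" .
  have "f (\<sigma> q) = cnj (f q)" for q by (simp add: f_def \<sigma>_def case_prod_unfold mult_ac)
  then have "infsum f (Sigma UNIV triples) = infsum (\<lambda>q. cnj (f q)) (Sigma UNIV triples)"
    using infsum_reindex_bij_betw[OF \<sigma>, of f] by simp
  also have "\<dots> = cnj (infsum f (Sigma UNIV triples))" by (rule infsum_cnj)
  finally show ?thesis unfolding S by (simp add: complex_eq_iff)
qed

end

section \<open>Quasi-resonant quartets\<close>

definition square_defect :: "int \<Rightarrow> int \<Rightarrow> int \<Rightarrow> int \<Rightarrow> int" where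
  "square_defect a b c d = a\<^sup>2 + b\<^sup>2 - c\<^sup>2 - d\<^sup>2"

text \<open>With equal sums the defect factors as \<open>- 2 * (c - a) * (c - b)\<close>. Applied to
  each coordinate separately, this produces the rectangles.\<close>

lemma square_defect_eq_0_imp:
  assumes "a + b = c + d" "square_defect a b c d = 0"
  shows "c = a \<or> c = b"
proof -
  have d: "d = a + b - c" using assms(1) by simp
  have "2 * ((c - a) * (c - b)) = 0"
    using assms(2) unfolding square_defect_def d by (simp add: power2_eq_square algebra_simps)
  then show ?thesis by simp
qed

lemma freq_norm_sq_nonneg: "freq_norm_sq k \<ge> 0"
  by (simp add: freq_norm_sq_def case_prod_unfold)

lemma freq_norm_sq_ge_1: "k \<noteq> 0 \<Longrightarrow> freq_norm_sq k \<ge> 1"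
proof -
  assume "k \<noteq> 0"
  then have "1 \<le> (fst k)\<^sup>2 + (snd k)\<^sup>2"
    by (cases k) (auto simp: zero_prod_def int_one_le_iff_zero_less sum_power2_gt_zero_iff)
  then have "real_of_int 1 \<le> real_of_int ((fst k)\<^sup>2 + (snd k)\<^sup>2)" by (simp only: of_int_le_iff)
  then show "freq_norm_sq k \<ge> 1" by (simp add: freq_norm_sq_def case_prod_unfold)
qed

lemma abs_coordinates_le:
  assumes "freq_norm_sq k \<le> R"
  shows "\<bar>real_of_int (fst k)\<bar> \<le> R" "\<bar>real_of_int (snd k)\<bar> \<le> R"
proof -
  have sq: "\<bar>real_of_int m\<bar> \<le> (real_of_int m)\<^sup>2" for m
  proof -
    have "\<bar>m\<bar> * 1 \<le> \<bar>m\<bar> * \<bar>m\<bar>"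
    proof (cases "m = 0")
      case False
      then have "1 \<le> \<bar>m\<bar>" by arith
      then show ?thesis by (intro mult_left_mono) auto
    qed simp
    then have "\<bar>m\<bar> \<le> m\<^sup>2" by (simp add: power2_eq_square)
    then have "real_of_int \<bar>m\<bar> \<le> real_of_int (m\<^sup>2)" by (simp only: of_int_le_iff)
    then show ?thesis by simp
  qed
  have "(real_of_int (fst k))\<^sup>2 + (real_of_int (snd k))\<^sup>2 \<le> R"
    using assms by (simp add: freq_norm_sq_def case_prod_unfold)
  then show "\<bar>real_of_int (fst k)\<bar> \<le> R" "\<bar>real_of_int (snd k)\<bar> \<le> R"
    using sq[of "fst k"] sq[of "snd k"] zero_le_power2[of "real_of_int (fst k)"] zero_le_power2[of "real_of_int (snd k)"]
    by linarith+
qed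

lemma finite_freq_ball: "finite {k. freq_norm_sq k \<le> R}"
proof (rule finite_subset)
  show "{k. freq_norm_sq k \<le> R} \<subseteq> {- \<lceil>R\<rceil>..\<lceil>R\<rceil>} \<times> {- \<lceil>R\<rceil>..\<lceil>R\<rceil>}"
  proof
    fix k assume "k \<in> {k. freq_norm_sq k \<le> R}"
    then have "\<bar>real_of_int (fst k)\<bar> \<le> R" "\<bar>real_of_int (snd k)\<bar> \<le> R"
      using abs_coordinates_le by auto
    then have "\<bar>real_of_int (fst k)\<bar> \<le> of_int \<lceil>R\<rceil>" "\<bar>real_of_int (snd k)\<bar> \<le> of_int \<lceil>R\<rceil>"
      by (meson le_of_int_ceiling order_trans)+
    then have "\<bar>fst k\<bar> \<le> \<lceil>R\<rceil>" "\<bar>snd k\<bar> \<le> \<lceil>R\<rceil>"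
      by (simp_all only: of_int_abs[symmetric] of_int_le_iff)
    then show "k \<in> {- \<lceil>R\<rceil>..\<lceil>R\<rceil>} \<times> {- \<lceil>R\<rceil>..\<lceil>R\<rceil>}" by (cases k) auto
  qed
qed simp

lemma quasi_resonant_swap:
  "quasi_resonant \<omega>1 \<omega>2 \<Lambda> \<tau> k1 k2 k3 k4 \<Longrightarrow> quasi_resonant \<omega>1 \<omega>2 \<Lambda> \<tau> k3 k4 k1 k2"
proof -
  assume Q: "quasi_resonant \<omega>1 \<omega>2 \<Lambda> \<tau> k1 k2 k3 k4"
  let ?l = "laplace_eigenvalue \<omega>1 \<omega>2"
  have 1: "\<bar>?l k3 + ?l k4 - ?l k1 - ?l k2\<bar> = \<bar>?l k1 + ?l k2 - ?l k3 - ?l k4\<bar>" by linarith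
  have 2: "freq_norm_sq k3 + freq_norm_sq k4 + freq_norm_sq k1 + freq_norm_sq k2
      = freq_norm_sq k1 + freq_norm_sq k2 + freq_norm_sq k3 + freq_norm_sq k4" by simp
  have "k3 + k4 - k1 - k2 = - (k1 + k2 - k3 - k4)" by simp
  also have "\<dots> = 0" using Q unfolding quasi_resonant_def by simp
  finally have "k3 + k4 - k1 - k2 = 0" .
  then show ?thesis using Q unfolding quasi_resonant_def 1 2 by blast
qed

context
  fixes \<omega>1 \<omega>2 \<Lambda> \<tau> :: real
  assumes generic: "generic_irrational_pair \<omega>1 \<omega>2" and \<Lambda>: "\<Lambda> > 0" and \<tau>: "\<tau> > 0"
begin

definition quartet_size :: "int \<times> int \<Rightarrow> int \<times> int \<Rightarrow> int \<times> int \<Rightarrow> int \<times> int \<Rightarrow> real" where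
  "quartet_size k1 k2 k3 k4 = freq_norm_sq k1 + freq_norm_sq k2 + freq_norm_sq k3 + freq_norm_sq k4"

text \<open>Dividing the eigenvalue defect by \<open>4 * pi\<^sup>2 / \<omega>1\<^sup>2\<close>
  leaves coefficient 1 at \<open>a\<close> and the Diophantine number at \<open>b\<close>; hence the
  constant. A nonzero size excludes the separate disjunct for the zero quartet.\<close>

lemma quasi_resonant_defect_bound:
  assumes Q: "quasi_resonant \<omega>1 \<omega>2 \<Lambda> \<tau> k1 k2 k3 k4" and nz: "quartet_size k1 k2 k3 k4 \<noteq> 0"
    and a: "a = square_defect (fst k1) (fst k2) (fst k3) (fst k4)"
    and b: "b = square_defect (snd k1) (snd k2) (snd k3) (snd k4)"
  shows "\<bar>of_int a + \<omega>1\<^sup>2 / \<omega>2\<^sup>2 * of_int b\<bar>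
    \<le> (\<Lambda> * \<omega>1\<^sup>2 / (4 * pi\<^sup>2)) / quartet_size k1 k2 k3 k4 powr (1 + \<tau>)"
proof -
  have \<omega>: "\<omega>1 > 0" "\<omega>2 > 0" using generic by (auto simp: generic_irrational_pair_def)
  let ?l = "laplace_eigenvalue \<omega>1 \<omega>2" and ?P = "quartet_size k1 k2 k3 k4 powr (1 + \<tau>)"
  have eq: "?l k1 + ?l k2 - ?l k3 - ?l k4 = 4 * pi\<^sup>2 / \<omega>1\<^sup>2 * (of_int a + \<omega>1\<^sup>2 / \<omega>2\<^sup>2 * of_int b)"
  proof -
    have "c * (a1 / p + b1 / q) + c * (a2 / p + b2 / q) - c * (a3 / p + b3 / q) - c * (a4 / p + b4 / q)
        = c / p * ((a1 + a2 - a3 - a4) + p / q * (b1 + b2 - b3 - b4))"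
      if "p > 0" "q > 0" for c p q a1 a2 a3 a4 b1 b2 b3 b4 :: real
      using that by (simp add: field_simps)
    from this[of "\<omega>1\<^sup>2" "\<omega>2\<^sup>2"] \<omega> show ?thesis
      unfolding a b square_defect_def laplace_eigenvalue_def case_prod_unfold by simp
  qed
  have "\<not> (k1 = 0 \<and> k2 = 0 \<and> k3 = 0 \<and> k4 = 0)"
    using nz by (auto simp: quartet_size_def freq_norm_sq_def zero_prod_def)
  then have "\<bar>?l k1 + ?l k2 - ?l k3 - ?l k4\<bar> \<le> \<Lambda> / ?P"
    using Q by (auto simp: quasi_resonant_def quartet_size_def)
  then have "4 * pi\<^sup>2 / \<omega>1\<^sup>2 * \<bar>of_int a + \<omega>1\<^sup>2 / \<omega>2\<^sup>2 * of_int b\<bar> \<le> \<Lambda> / ?P"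
    unfolding eq by (simp add: abs_mult)
  then have "\<omega>1\<^sup>2 / (4 * pi\<^sup>2) * (4 * pi\<^sup>2 / \<omega>1\<^sup>2 * \<bar>of_int a + \<omega>1\<^sup>2 / \<omega>2\<^sup>2 * of_int b\<bar>) \<le> \<omega>1\<^sup>2 / (4 * pi\<^sup>2) * (\<Lambda> / ?P)"
    by (intro mult_left_mono) auto
  also have "\<omega>1\<^sup>2 / (4 * pi\<^sup>2) * (4 * pi\<^sup>2 / \<omega>1\<^sup>2 * \<bar>of_int a + \<omega>1\<^sup>2 / \<omega>2\<^sup>2 * of_int b\<bar>)
      = \<bar>of_int a + \<omega>1\<^sup>2 / \<omega>2\<^sup>2 * of_int b\<bar>"
    using \<omega> by simp
  finally show ?thesis by (simp add: mult_ac)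
qed

text \<open>Lets a negative power of the size be replaced by the same power of
  \<open>\<bar>b\<bar>\<close>, the denominator of the rational approximation to come.\<close>

lemma abs_square_defect_le_size:
  "\<bar>real_of_int (square_defect (fst k1) (fst k2) (fst k3) (fst k4))\<bar> \<le> quartet_size k1 k2 k3 k4"
  "\<bar>real_of_int (square_defect (snd k1) (snd k2) (snd k3) (snd k4))\<bar> \<le> quartet_size k1 k2 k3 k4"
proof -
  have le: "\<bar>a + b - c - d\<bar> \<le> (a + x) + (b + y) + (c + z) + (d + w)"
    if "a \<ge> 0" "b \<ge> 0" "c \<ge> 0" "d \<ge> 0" "x \<ge> 0" "y \<ge> 0" "z \<ge> 0" "w \<ge> 0"
    for a b c d x y z w :: real using that by linarith
  show "\<bar>real_of_int (square_defect (fst k1) (fst k2) (fst k3) (fst k4))\<bar> \<le> quartet_size k1 k2 k3 k4"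
    unfolding quartet_size_def freq_norm_sq_def case_prod_unfold square_defect_def
    using le[of "(of_int (fst k1))\<^sup>2" "(of_int (fst k2))\<^sup>2" "(of_int (fst k3))\<^sup>2" "(of_int (fst k4))\<^sup>2"
        "(of_int (snd k1))\<^sup>2" "(of_int (snd k2))\<^sup>2" "(of_int (snd k3))\<^sup>2" "(of_int (snd k4))\<^sup>2"]
    by simp
  show "\<bar>real_of_int (square_defect (snd k1) (snd k2) (snd k3) (snd k4))\<bar> \<le> quartet_size k1 k2 k3 k4"
    unfolding quartet_size_def freq_norm_sq_def case_prod_unfold square_defect_def
    using le[of "(of_int (snd k1))\<^sup>2" "(of_int (snd k2))\<^sup>2" "(of_int (snd k3))\<^sup>2" "(of_int (snd k4))\<^sup>2"
        "(of_int (fst k1))\<^sup>2" "(of_int (fst k2))\<^sup>2" "(of_int (fst k3))\<^sup>2" "(of_int (fst k4))\<^sup>2"]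
    by (simp add: add_ac)
qed

lemma quartet_size_ge_1: "quartet_size k1 k2 k3 k4 \<noteq> 0 \<Longrightarrow> quartet_size k1 k2 k3 k4 \<ge> 1"
proof -
  assume "quartet_size k1 k2 k3 k4 \<noteq> 0"
  then have "k1 \<noteq> 0 \<or> k2 \<noteq> 0 \<or> k3 \<noteq> 0 \<or> k4 \<noteq> 0"
    by (auto simp: quartet_size_def freq_norm_sq_def zero_prod_def)
  then show ?thesis
    using freq_norm_sq_ge_1[of k1] freq_norm_sq_ge_1[of k2] freq_norm_sq_ge_1[of k3] freq_norm_sq_ge_1[of k4]
      freq_norm_sq_nonneg[of k1] freq_norm_sq_nonneg[of k2] freq_norm_sq_nonneg[of k3] freq_norm_sq_nonneg[of k4]
    unfolding quartet_size_def by argo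
qed

text \<open>Since \<open>\<omega>1\<^sup>2 / \<omega>2\<^sup>2\<close> is irrational, both defects
  vanish exactly when the eigenvalues cancel exactly; these are the quartets that are resonant only
  approximately.\<close>

definition inexact_quartets :: "((int \<times> int) \<times> (int \<times> int) \<times> (int \<times> int) \<times> (int \<times> int)) set" where
  "inexact_quartets = {(k1, k2, k3, k4). quasi_resonant \<omega>1 \<omega>2 \<Lambda> \<tau> k1 k2 k3 k4 \<and>
     (square_defect (fst k1) (fst k2) (fst k3) (fst k4), square_defect (snd k1) (snd k2) (snd k3) (snd k4)) \<noteq> (0, 0)}"

text \<open>Only finitely many pairs of defects occur, because a pair \<open>(a, b)\<close> of defects with
  \<open>b \<noteq> 0\<close> makes \<open>- a / b\<close> a very good rational approximation of \<open>\<omega>1\<^sup>2 / \<omega>2\<^sup>2\<close>. By irrationality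
  each pair bounds the size of its quartets.\<close>

lemma finite_inexact_quartets: "finite inexact_quartets"
proof -
  define \<alpha> where "\<alpha> = \<omega>1\<^sup>2 / \<omega>2\<^sup>2"
  define C where "C = \<Lambda> * \<omega>1\<^sup>2 / (4 * pi\<^sup>2)"
  have \<omega>: "\<omega>1 > 0" "\<omega>2 > 0" and irr: "\<alpha> \<notin> \<rat>" and nwa: "not_well_approximable \<alpha>"
    using generic by (auto simp: generic_irrational_pair_def \<alpha>_def)
  have C: "C > 0" using \<Lambda> \<omega> by (simp add: C_def)
  \<comment> \<open>A defect bound of order \<open>1 + \<tau>\<close> in the size gains one more
    power on division by the denominator, so the Diophantine condition is used with
    \<open>\<sigma> = \<tau>\<close>.\<close>
  define W where "W = {(p :: int, q :: int). q > 0 \<and> \<bar>of_int p / of_int q - \<alpha>\<bar> \<le> C / (of_int q powr (2 + \<tau>))}"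
  have W: "finite W" using nwa C \<tau> unfolding W_def not_well_approximable_def by blast
  \<comment> \<open>The three pieces belong to \<open>b > 0\<close>, \<open>b < 0\<close> and
    \<open>b = 0\<close>. In the last case there is no approximation, but
    \<open>\<bar>a\<bar>\<close> is at most \<open>C\<close> because the size is at least 1.\<close>
  define Y where "Y = ((\<lambda>(p, q). (- p, q)) ` W \<union> (\<lambda>(p, q). (p, - q)) ` W \<union> {- \<lceil>C\<rceil>..\<lceil>C\<rceil>} \<times> {0}) - {(0, 0)}"
  have Y: "finite Y" using W by (simp add: Y_def)
  have Y_nz: "of_int a + \<alpha> * of_int b \<noteq> 0" if "(a, b) \<in> Y" for a b
  proof
    assume eq: "of_int a + \<alpha> * of_int b = 0"
    show False
    proof (cases "b = 0")
      case True then show ?thesis using eq that by (simp add: Y_def)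
    next
      case False
      then have "\<alpha> = - of_int a / of_int b" using eq by (simp add: field_simps)
      then show ?thesis using irr by simp
    qed
  qed
  have inY: "(a, b) \<in> Y" if Q: "quasi_resonant \<omega>1 \<omega>2 \<Lambda> \<tau> k1 k2 k3 k4"
    and a: "a = square_defect (fst k1) (fst k2) (fst k3) (fst k4)"
    and b: "b = square_defect (snd k1) (snd k2) (snd k3) (snd k4)" and ab: "(a, b) \<noteq> (0, 0)"
    for k1 k2 k3 k4 a b
  proof -
    let ?S = "quartet_size k1 k2 k3 k4"
    have le: "\<bar>real_of_int a\<bar> \<le> ?S" "\<bar>real_of_int b\<bar> \<le> ?S"
      unfolding a b by (rule abs_square_defect_le_size)+
    then have S: "?S \<noteq> 0" using ab by auto
    then have S1: "?S \<ge> 1" by (rule quartet_size_ge_1)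
    have bd: "\<bar>of_int a + \<alpha> * of_int b\<bar> \<le> C / ?S powr (1 + \<tau>)"
      unfolding \<alpha>_def C_def by (rule quasi_resonant_defect_bound[OF Q S a b])
    show ?thesis
    proof (cases "b = 0")
      case True
      have "1 \<le> ?S powr (1 + \<tau>)" using S1 \<tau> by (intro ge_one_powr_ge_zero) auto
      then have "C / ?S powr (1 + \<tau>) \<le> C" using C S1 by (simp add: divide_le_eq mult_le_cancel_left1)
      then have "\<bar>real_of_int a\<bar> \<le> C" using bd True by simp
      then have "\<bar>real_of_int a\<bar> \<le> of_int \<lceil>C\<rceil>" by linarith
      then have "\<bar>a\<bar> \<le> \<lceil>C\<rceil>" by (simp only: of_int_abs[symmetric] of_int_le_iff)
      then show ?thesis using True ab by (auto simp: Y_def)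
    next
      case False
      \<comment> \<open>With these signs the denominator is positive and
        \<open>p / q = - a / b\<close>.\<close>
      define q where "q = \<bar>b\<bar>"
      define p where "p = (if b > 0 then - a else a)"
      have q: "q > 0" "real_of_int q \<le> ?S" using False le by (auto simp: q_def)
      have "real_of_int q * \<bar>of_int p / of_int q - \<alpha>\<bar> = \<bar>real_of_int q * (of_int p / of_int q - \<alpha>)\<bar>"
        using q by (simp add: abs_mult)
      also have "real_of_int q * (of_int p / of_int q - \<alpha>) = of_int p - \<alpha> * of_int q"
        using q by (simp add: field_simps)
      also have "\<bar>of_int p - \<alpha> * of_int q\<bar> = \<bar>of_int a + \<alpha> * of_int b\<bar>"
        using False by (auto simp: p_def q_def)
      also have "\<dots> \<le> C / ?S powr (1 + \<tau>)" by (rule bd)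
      also have "\<dots> \<le> C / of_int q powr (1 + \<tau>)"
        using q C \<tau> by (intro divide_left_mono powr_mono2 mult_pos_pos) auto
      finally have "\<bar>of_int p / of_int q - \<alpha>\<bar> \<le> C / of_int q powr (1 + \<tau>) / of_int q"
        using q by (simp add: field_simps)
      also have "\<dots> = C / (of_int q powr (1 + \<tau>) * of_int q powr 1)" using q by simp
      also have "\<dots> = C / of_int q powr (2 + \<tau>)"
        unfolding powr_add[symmetric] by (simp add: add_ac)
      finally have "(p, q) \<in> W" using q by (simp add: W_def)
      moreover have "(a, b) = (if b > 0 then (- p, q) else (p, - q))"
        using False by (auto simp: p_def q_def)
      ultimately show ?thesis using ab
        by (auto simp: Y_def image_iff split: if_splits intro: bexI[of _ "(p, q)"])
    qed
  qed
  \<comment> \<open>The inserted 1 keeps the minimum defined when \<open>Y\<close> is empty.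
    Positivity combines irrationality with the finiteness of \<open>Y\<close>.\<close>
  define \<delta> where "\<delta> = Min (insert 1 ((\<lambda>(a, b). \<bar>of_int a + \<alpha> * of_int b\<bar>) ` Y))"
  have \<delta>: "\<delta> > 0" unfolding \<delta>_def using Y Y_nz by (subst Min_gr_iff) auto
  have \<delta>_le: "\<delta> \<le> \<bar>of_int a + \<alpha> * of_int b\<bar>" if "(a, b) \<in> Y" for a b
    unfolding \<delta>_def using Y that by (intro Min_le) (auto simp: image_iff intro!: bexI[of _ "(a, b)"])
  have size: "quartet_size k1 k2 k3 k4 \<le> C / \<delta>" if "(k1, k2, k3, k4) \<in> inexact_quartets" for k1 k2 k3 k4
  proof -
    let ?S = "quartet_size k1 k2 k3 k4"
    define a where "a = square_defect (fst k1) (fst k2) (fst k3) (fst k4)"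
    define b where "b = square_defect (snd k1) (snd k2) (snd k3) (snd k4)"
    have Q: "quasi_resonant \<omega>1 \<omega>2 \<Lambda> \<tau> k1 k2 k3 k4" and ab: "(a, b) \<noteq> (0, 0)"
      using that by (auto simp: inexact_quartets_def a_def b_def)
    have le: "\<bar>real_of_int a\<bar> \<le> ?S" "\<bar>real_of_int b\<bar> \<le> ?S"
      unfolding a_def b_def by (rule abs_square_defect_le_size)+
    then have S: "?S \<noteq> 0" using ab by auto
    then have S1: "?S \<ge> 1" by (rule quartet_size_ge_1)
    have "\<delta> \<le> \<bar>of_int a + \<alpha> * of_int b\<bar>" by (rule \<delta>_le[OF inY[OF Q a_def b_def ab]])
    also have "\<dots> \<le> C / ?S powr (1 + \<tau>)"
      unfolding \<alpha>_def C_def by (rule quasi_resonant_defect_bound[OF Q S a_def b_def])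
    \<comment> \<open>Lowering the exponent to 1 is allowed as the size is at least 1, and it turns
      the lower bound \<open>\<delta>\<close> on the defect into the bound
      \<open>C / \<delta>\<close> on the size.\<close>
    also have "\<dots> \<le> C / ?S powr 1"
      using S1 C \<tau> by (intro divide_left_mono powr_mono mult_pos_pos) auto
    finally have "\<delta> \<le> C / ?S" using S1 by simp
    then show ?thesis using \<delta> S1 by (simp add: field_simps)
  qed
  let ?B = "{k. freq_norm_sq k \<le> C / \<delta>}"
  have "inexact_quartets \<subseteq> ?B \<times> ?B \<times> ?B \<times> ?B"
  proof (clarify, goal_cases)
    case (1 a b c d e f g h)
    from size[OF this] show ?case
      using freq_norm_sq_nonneg[of "(a, b)"] freq_norm_sq_nonneg[of "(c, d)"]
        freq_norm_sq_nonneg[of "(e, f)"] freq_norm_sq_nonneg[of "(g, h)"]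
      unfolding quartet_size_def by auto
  qed
  then show ?thesis
    by (rule finite_subset) (intro finite_cartesian_product finite_freq_ball)
qed

text \<open>Outside the inexact quartets each coordinate of \<open>k3\<close> agrees with that of
  \<open>k1\<close> or \<open>k2\<close>, and \<open>k4\<close> follows from the sum. This leaves
  four candidates, whence the 4 in the count below.\<close>

lemma completions_subset:
  "{(k3, k4). quasi_resonant \<omega>1 \<omega>2 \<Lambda> \<tau> k1 k2 k3 k4}
    \<subseteq> (\<lambda>k3. (k3, k1 + k2 - k3)) ` ({fst k1, fst k2} \<times> {snd k1, snd k2})
      \<union> (\<lambda>(k1, k2, k3, k4). (k3, k4)) ` inexact_quartets"
proof (rule subsetI)
  fix x assume "x \<in> {(k3, k4). quasi_resonant \<omega>1 \<omega>2 \<Lambda> \<tau> k1 k2 k3 k4}"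
  then obtain k3 k4 where x: "x = (k3, k4)" and Q: "quasi_resonant \<omega>1 \<omega>2 \<Lambda> \<tau> k1 k2 k3 k4" by auto
  show "x \<in> (\<lambda>k3. (k3, k1 + k2 - k3)) ` ({fst k1, fst k2} \<times> {snd k1, snd k2})
      \<union> (\<lambda>(k1, k2, k3, k4). (k3, k4)) ` inexact_quartets"
  proof (cases "(k1, k2, k3, k4) \<in> inexact_quartets")
    case True then show ?thesis by (force simp: x)
  next
    case False
    have sum: "k1 + k2 - k3 - k4 = 0" using Q by (simp add: quasi_resonant_def)
    then have k4: "k4 = k1 + k2 - k3" by (simp add: algebra_simps)
    have "fst k3 = fst k1 \<or> fst k3 = fst k2" "snd k3 = snd k1 \<or> snd k3 = snd k2"
    proof -
      have "square_defect (fst k1) (fst k2) (fst k3) (fst k4) = 0" "square_defect (snd k1) (snd k2) (snd k3) (snd k4) = 0"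
        using False Q by (auto simp: inexact_quartets_def)
      then show "fst k3 = fst k1 \<or> fst k3 = fst k2" "snd k3 = snd k1 \<or> snd k3 = snd k2"
        using square_defect_eq_0_imp[of "fst k1" "fst k2" "fst k3" "fst k4"]
          square_defect_eq_0_imp[of "snd k1" "snd k2" "snd k3" "snd k4"] by (auto simp: k4)
    qed
    then have "k3 \<in> {fst k1, fst k2} \<times> {snd k1, snd k2}" by (cases k3) auto
    then show ?thesis unfolding x k4 by blast
  qed
qed

lemma resonance_system_quasi_resonant:
  "resonance_system (quasi_resonant \<omega>1 \<omega>2 \<Lambda> \<tau>) (4 + card inexact_quartets)"
proof
  fix k1 k2 k3 k4 :: "int \<times> int"
  show "quasi_resonant \<omega>1 \<omega>2 \<Lambda> \<tau> k1 k2 k3 k4 \<Longrightarrow> quasi_resonant \<omega>1 \<omega>2 \<Lambda> \<tau> k3 k4 k1 k2"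
    by (rule quasi_resonant_swap)
  let ?A = "(\<lambda>k3. (k3, k1 + k2 - k3)) ` ({fst k1, fst k2} \<times> {snd k1, snd k2})"
  let ?B = "(\<lambda>(k1, k2, k3, k4). (k3, k4)) ` inexact_quartets"
  have fin: "finite (?A \<union> ?B)" using finite_inexact_quartets by simp
  then show "finite {(k3, k4). quasi_resonant \<omega>1 \<omega>2 \<Lambda> \<tau> k1 k2 k3 k4}"
    using completions_subset finite_subset by blast
  have two: "card {x, y} \<le> 2" for x y :: int by (simp add: card_insert_if)
  have "card {(k3, k4). quasi_resonant \<omega>1 \<omega>2 \<Lambda> \<tau> k1 k2 k3 k4} \<le> card (?A \<union> ?B)"
    by (rule card_mono[OF fin completions_subset])
  also have "\<dots> \<le> card ?A + card ?B" by (rule card_Un_le)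
  also have "card ?A \<le> card ({fst k1, fst k2} \<times> {snd k1, snd k2})" by (intro card_image_le) simp
  also have "\<dots> \<le> 2 * 2" unfolding card_cartesian_product by (intro mult_le_mono two)
  also have "card ?B \<le> card inexact_quartets" by (rule card_image_le[OF finite_inexact_quartets])
  finally show "card {(k3, k4). quasi_resonant \<omega>1 \<omega>2 \<Lambda> \<tau> k1 k2 k3 k4} \<le> 4 + card inexact_quartets"
    by simp
qed

end

section \<open>Fourier series\<close>

text \<open>This is \<open>torus_L2\<close> without periodicity and over any measure, so that
  Bessel's inequality and the Riesz--Fischer theorem can be proved away from the torus.\<close>

definition square_integrable :: "'a measure \<Rightarrow> ('a \<Rightarrow> complex) \<Rightarrow> bool" where
  "square_integrable M f \<longleftrightarrow> f \<in> borel_measurable M \<and> integrable M (\<lambda>x. (cmod (f x))\<^sup>2)"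

lemma square_integrable_mult:
  assumes "square_integrable M f" "square_integrable M g"
  shows "integrable M (\<lambda>x. f x * cnj (g x))"
proof (rule Bochner_Integration.integrable_bound)
  show "integrable M (\<lambda>x. (cmod (f x))\<^sup>2 + (cmod (g x))\<^sup>2)"
    using assms by (auto simp: square_integrable_def)
  show "(\<lambda>x. f x * cnj (g x)) \<in> borel_measurable M"
    using assms by (auto simp: square_integrable_def intro!: borel_measurable_times
        borel_measurable_continuous_on[where f = cnj] continuous_intros)
  show "AE x in M. norm (f x * cnj (g x)) \<le> norm ((cmod (f x))\<^sup>2 + (cmod (g x))\<^sup>2)"
    by (intro AE_I2) (simp add: norm_mult mult_le_sum_squares)
qed

lemma square_integrable_cmult: "square_integrable M f \<Longrightarrow> square_integrable M (\<lambda>x. c * f x)"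
  by (auto simp: square_integrable_def norm_mult power_mult_distrib)

lemma square_integrable_add:
  assumes "square_integrable M f" "square_integrable M g"
  shows "square_integrable M (\<lambda>x. f x + g x)"
proof -
  have [measurable]: "f \<in> borel_measurable M" "g \<in> borel_measurable M"
    using assms by (auto simp: square_integrable_def)
  have "integrable M (\<lambda>x. (cmod (f x + g x))\<^sup>2)"
  proof (rule Bochner_Integration.integrable_bound)
    show "integrable M (\<lambda>x. 2 * ((cmod (f x))\<^sup>2 + (cmod (g x))\<^sup>2))"
      using assms by (auto simp: square_integrable_def)
    have "(cmod (f x + g x))\<^sup>2 \<le> 2 * ((cmod (f x))\<^sup>2 + (cmod (g x))\<^sup>2)" for x
    proof -
      have "(cmod (f x + g x))\<^sup>2 \<le> (cmod (f x) + cmod (g x))\<^sup>2"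
        by (intro power_mono norm_triangle_ineq) auto
      also have "\<dots> \<le> 2 * ((cmod (f x))\<^sup>2 + (cmod (g x))\<^sup>2)"
        using zero_le_power2[of "cmod (f x) - cmod (g x)"] by (simp add: power2_eq_square algebra_simps)
      finally show ?thesis .
    qed
    then show "AE x in M. norm ((cmod (f x + g x))\<^sup>2) \<le> norm (2 * ((cmod (f x))\<^sup>2 + (cmod (g x))\<^sup>2))"
      by (intro AE_I2) simp
  qed simp
  then show ?thesis by (simp add: square_integrable_def)
qed

lemma square_integrable_diff:
  assumes "square_integrable M f" "square_integrable M g"
  shows "square_integrable M (\<lambda>x. f x - g x)"
  using square_integrable_add[OF assms(1) square_integrable_cmult[OF assms(2), of "-1"]] by simp

lemma square_integrable_sum:
  "(\<And>k. k \<in> K \<Longrightarrow> square_integrable M (f k)) \<Longrightarrow> square_integrable M (\<lambda>x. \<Sum>k\<in>K. f k x)"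
  by (induction K rule: infinite_finite_induct)
    (simp_all add: square_integrable_add, simp_all add: square_integrable_def)

text \<open>Fatou's lemma. It serves to put the almost everywhere limit of partial sums into
  \<open>L\<^sup>2\<close>, and to turn bounds on differences of partial sums into a bound on the
  distance to the limit.\<close>

lemma square_integrable_Fatou:
  assumes g: "\<And>n. square_integrable M (g n)" and h[measurable]: "h \<in> borel_measurable M"
    and lim: "AE x in M. (\<lambda>n. g n x) \<longlonglongrightarrow> h x"
    and bound: "\<And>n. (\<integral>x. (cmod (g n x))\<^sup>2 \<partial>M) \<le> C"
  shows "square_integrable M h" "(\<integral>x. (cmod (h x))\<^sup>2 \<partial>M) \<le> C"
proof -
  have [measurable]: "g n \<in> borel_measurable M" for n using g by (simp add: square_integrable_def)
  have "0 \<le> (\<integral>x. (cmod (g 0 x))\<^sup>2 \<partial>M)" by simp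
  then have C: "C \<ge> 0" using bound[of 0] by linarith
  have "(\<integral>\<^sup>+x. ennreal ((cmod (h x))\<^sup>2) \<partial>M) = (\<integral>\<^sup>+x. liminf (\<lambda>n. ennreal ((cmod (g n x))\<^sup>2)) \<partial>M)"
  proof (rule nn_integral_cong_AE, use lim in eventually_elim)
    fix x assume "(\<lambda>n. g n x) \<longlonglongrightarrow> h x"
    then have "(\<lambda>n. ennreal ((cmod (g n x))\<^sup>2)) \<longlonglongrightarrow> ennreal ((cmod (h x))\<^sup>2)"
      by (intro tendsto_intros)
    then show "ennreal ((cmod (h x))\<^sup>2) = liminf (\<lambda>n. ennreal ((cmod (g n x))\<^sup>2))"
      by (intro lim_imp_Liminf[symmetric]) auto
  qed
  also have "\<dots> \<le> liminf (\<lambda>n. \<integral>\<^sup>+x. ennreal ((cmod (g n x))\<^sup>2) \<partial>M)"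
    by (rule nn_integral_liminf) simp
  also have "\<dots> = liminf (\<lambda>n. ennreal (\<integral>x. (cmod (g n x))\<^sup>2 \<partial>M))"
    using g by (subst nn_integral_eq_integral) (auto simp: square_integrable_def)
  also have "\<dots> \<le> liminf (\<lambda>n. ennreal C)"
    using bound by (intro Liminf_mono always_eventually allI ennreal_leI)
  also have "\<dots> = ennreal C" by (intro lim_imp_Liminf) auto
  finally have le: "(\<integral>\<^sup>+x. ennreal ((cmod (h x))\<^sup>2) \<partial>M) \<le> ennreal C" .
  have int: "integrable M (\<lambda>x. (cmod (h x))\<^sup>2)"
  proof (rule integrableI_bounded)
    have "(\<integral>\<^sup>+x. ennreal (norm ((cmod (h x))\<^sup>2)) \<partial>M) \<le> ennreal C" using le by simp
    also have "\<dots> < \<infinity>" by simp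
    finally show "(\<integral>\<^sup>+x. ennreal (norm ((cmod (h x))\<^sup>2)) \<partial>M) < \<infinity>" .
  qed simp
  then show "square_integrable M h" by (simp add: square_integrable_def)
  have "ennreal (\<integral>x. (cmod (h x))\<^sup>2 \<partial>M) \<le> ennreal C"
    using le by (subst (asm) nn_integral_eq_integral[OF int]) auto
  then show "(\<integral>x. (cmod (h x))\<^sup>2 \<partial>M) \<le> C" using C by (simp add: ennreal_le_iff)
qed

text \<open>Characters have modulus 1 rather than norm 1, which matches the division by the area in
  \<open>fourier_coeff\<close>. Completeness is no assumption of the locale but a premise of
  \<open>Parseval\<close>; the torus supplies it later.\<close>

locale orthogonal_characters = finite_measure M for M :: "'a measure" +
  fixes e :: "'k \<Rightarrow> 'a \<Rightarrow> complex" and A :: real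
  assumes A: "A > 0"
    and char_measurable [measurable]: "e k \<in> borel_measurable M"
    and cmod_char: "cmod (e k x) = 1"
    and orthogonality: "(\<integral>x. e j x * cnj (e k x) \<partial>M) = (if j = k then of_real A else 0)"
begin

lemma square_integrable_char: "square_integrable M (e k)"
  by (simp add: square_integrable_def cmod_char)

lemma square_integrable_const: "square_integrable M (\<lambda>x. c)"
  by (simp add: square_integrable_def)

lemma square_integrable_imp_integrable:
  assumes "square_integrable M f" shows "integrable M f"
  using square_integrable_mult[OF assms square_integrable_const[of 1]] by simp

definition coeff :: "('a \<Rightarrow> complex) \<Rightarrow> 'k \<Rightarrow> complex" where
  "coeff f k = (\<integral>x. f x * cnj (e k x) \<partial>M) / of_real A"

definition partial_sum :: "('k \<Rightarrow> complex) \<Rightarrow> 'k set \<Rightarrow> 'a \<Rightarrow> complex" where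
  "partial_sum c K x = (\<Sum>k\<in>K. c k * e k x)"

lemma square_integrable_partial_sum: "square_integrable M (partial_sum c K)"
  unfolding partial_sum_def
  by (intro square_integrable_sum square_integrable_cmult square_integrable_char)

lemma coeff_diff:
  assumes "square_integrable M f" "square_integrable M g"
  shows "coeff (\<lambda>x. f x - g x) k = coeff f k - coeff g k"
  unfolding coeff_def
  using square_integrable_mult[OF assms(1) square_integrable_char[of k]]
    square_integrable_mult[OF assms(2) square_integrable_char[of k]]
  by (simp add: left_diff_distrib diff_divide_distrib)

lemma inner_partial_sum:
  assumes "square_integrable M f"
  shows "(\<integral>x. f x * cnj (partial_sum c K x) \<partial>M) = of_real A * (\<Sum>k\<in>K. cnj (c k) * coeff f k)"
proof -
  have "(\<integral>x. f x * cnj (partial_sum c K x) \<partial>M) = (\<integral>x. (\<Sum>k\<in>K. cnj (c k) * (f x * cnj (e k x))) \<partial>M)"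
    by (simp add: partial_sum_def sum_distrib_left mult_ac)
  also have "\<dots> = (\<Sum>k\<in>K. cnj (c k) * (\<integral>x. f x * cnj (e k x) \<partial>M))"
    using square_integrable_mult[OF assms square_integrable_char]
    by (subst Bochner_Integration.integral_sum) auto
  finally show ?thesis using A by (simp add: coeff_def sum_distrib_left)
qed

lemma coeff_partial_sum:
  assumes "finite K"
  shows "coeff (partial_sum c K) j = (if j \<in> K then c j else 0)"
proof -
  have "(\<integral>x. partial_sum c K x * cnj (e j x) \<partial>M) = (\<integral>x. (\<Sum>k\<in>K. c k * (e k x * cnj (e j x))) \<partial>M)"
    by (simp only: partial_sum_def sum_distrib_right mult.assoc)
  also have "\<dots> = (\<Sum>k\<in>K. c k * (\<integral>x. e k x * cnj (e j x) \<partial>M))"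
    using square_integrable_mult[OF square_integrable_char square_integrable_char]
    by (subst Bochner_Integration.integral_sum) auto
  also have "\<dots> = (\<Sum>k\<in>K. if k = j then c j * of_real A else 0)"
    by (intro sum.cong) (auto simp: orthogonality)
  finally show ?thesis using A assms by (simp add: coeff_def sum.delta)
qed

lemma sum_cnj_self: "(\<Sum>k\<in>K. cnj (c k) * c k) = of_real (\<Sum>k\<in>K. (cmod (c k))\<^sup>2)"
  by (simp only: of_real_sum complex_norm_square mult.commute)

lemma norm_partial_sum:
  assumes "finite K"
  shows "(\<integral>x. (cmod (partial_sum c K x))\<^sup>2 \<partial>M) = A * (\<Sum>k\<in>K. (cmod (c k))\<^sup>2)"
proof -
  have "complex_of_real (\<integral>x. (cmod (partial_sum c K x))\<^sup>2 \<partial>M) = (\<integral>x. partial_sum c K x * cnj (partial_sum c K x) \<partial>M)"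
    by (simp add: complex_norm_square flip: integral_complex_of_real of_real_power)
  also have "\<dots> = of_real A * (\<Sum>k\<in>K. cnj (c k) * c k)"
    using assms by (simp add: inner_partial_sum square_integrable_partial_sum coeff_partial_sum cong: sum.cong)
  also have "\<dots> = of_real (A * (\<Sum>k\<in>K. (cmod (c k))\<^sup>2))"
    by (simp only: of_real_mult sum_cnj_self)
  finally show ?thesis by (simp only: of_real_eq_iff)
qed

lemma Bessel:
  assumes f: "square_integrable M f" and K: "finite K"
  shows "(\<Sum>k\<in>K. (cmod (coeff f k))\<^sup>2) \<le> (\<integral>x. (cmod (f x))\<^sup>2 \<partial>M) / A"
proof -
  let ?s = "partial_sum (coeff f) K"
  note s = square_integrable_partial_sum[of "coeff f" K]
  let ?B = "\<Sum>k\<in>K. (cmod (coeff f k))\<^sup>2"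
  have "(cmod (f x - ?s x))\<^sup>2 = (cmod (f x))\<^sup>2 + (cmod (?s x))\<^sup>2 - 2 * Re (f x * cnj (?s x))" for x
    by (simp only: cmod_power2) (simp add: power2_eq_square algebra_simps)
  then have "(\<integral>x. (cmod (f x - ?s x))\<^sup>2 \<partial>M)
      = (\<integral>x. (cmod (f x))\<^sup>2 + (cmod (?s x))\<^sup>2 - 2 * Re (f x * cnj (?s x)) \<partial>M)" by simp
  also have "\<dots> = (\<integral>x. (cmod (f x))\<^sup>2 \<partial>M) + (\<integral>x. (cmod (?s x))\<^sup>2 \<partial>M) - 2 * Re (\<integral>x. f x * cnj (?s x) \<partial>M)"
  proof -
    have "(\<integral>x. a x + b x - 2 * Re (h x) \<partial>M) = (\<integral>x. a x \<partial>M) + (\<integral>x. b x \<partial>M) - 2 * Re (\<integral>x. h x \<partial>M)"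
      if "integrable M a" "integrable M b" "integrable M h" for a b :: "'a \<Rightarrow> real" and h :: "'a \<Rightarrow> complex"
      using that by simp
    then show ?thesis using f s square_integrable_mult[OF f s] by (simp only: square_integrable_def)
  qed
  also have "(\<integral>x. f x * cnj (?s x) \<partial>M) = of_real (A * ?B)"
    by (simp only: inner_partial_sum[OF f] sum_cnj_self of_real_mult)
  also have "(\<integral>x. (cmod (?s x))\<^sup>2 \<partial>M) = A * ?B" by (rule norm_partial_sum[OF K])
  finally have "(\<integral>x. (cmod (f x - ?s x))\<^sup>2 \<partial>M) = (\<integral>x. (cmod (f x))\<^sup>2 \<partial>M) - A * ?B" by simp
  moreover have "0 \<le> (\<integral>x. (cmod (f x - ?s x))\<^sup>2 \<partial>M)" by simp
  ultimately have "A * ?B \<le> (\<integral>x. (cmod (f x))\<^sup>2 \<partial>M)" by linarith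
  then show ?thesis using A by (simp add: field_simps)
qed

lemma square_summable_coeff:
  assumes "square_integrable M f"
  shows "(\<lambda>k. (cmod (coeff f k))\<^sup>2) summable_on UNIV"
  using Bessel[OF assms] by (intro nonneg_bdd_above_summable_on) (auto intro!: bdd_aboveI2)

text \<open>Integrate the square of \<open>?m * cmod (f x) - ?a\<close>. The inequality is wanted
  because an almost everywhere convergent subsequence will be extracted from a Cauchy sequence in
  \<open>L\<^sup>1\<close>.\<close>

lemma L1_le_L2:
  assumes f: "square_integrable M f"
  shows "(\<integral>x. cmod (f x) \<partial>M)\<^sup>2 \<le> measure M (space M) * (\<integral>x. (cmod (f x))\<^sup>2 \<partial>M)"
proof -
  let ?m = "measure M (space M)" and ?a = "\<integral>x. cmod (f x) \<partial>M" and ?b = "\<integral>x. (cmod (f x))\<^sup>2 \<partial>M"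
  have int: "integrable M (\<lambda>x. cmod (f x))" "integrable M (\<lambda>x. (cmod (f x))\<^sup>2)"
    using f square_integrable_imp_integrable[OF f] by (auto simp: square_integrable_def)
  have "0 \<le> (\<integral>x. (?m * cmod (f x) - ?a)\<^sup>2 \<partial>M)" by simp
  also have "\<dots> = (\<integral>x. ?m\<^sup>2 * (cmod (f x))\<^sup>2 + ?a\<^sup>2 - 2 * ?m * ?a * cmod (f x) \<partial>M)"
    by (simp add: power2_eq_square algebra_simps)
  also have "\<dots> = ?m\<^sup>2 * ?b + ?a\<^sup>2 * ?m - 2 * ?m * ?a * ?a"
    using int by (subst Bochner_Integration.integral_diff) (auto simp: mult.commute)
  finally have "0 \<le> ?m * (?m * ?b - ?a\<^sup>2)" by (simp add: power2_eq_square algebra_simps)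
  \<comment> \<open>On a null space the inequality just derived carries no information, and the left
    side of the claim vanishes instead.\<close>
  moreover have "?a = 0" if "?m = 0"
  proof -
    have "space M \<in> null_sets M" using that by (simp add: null_sets_def emeasure_eq_measure)
    then have "AE x in M. False" by (rule AE_I') auto
    then show ?thesis by (intro integral_eq_zero_AE) auto
  qed
  moreover have "0 \<le> ?m" by simp
  ultimately show ?thesis by (cases "?m = 0") (auto simp: zero_le_mult_iff simp del: measure_nonneg)
qed

text \<open>The limit is returned as an explicit pointwise \<open>lim\<close> of partial sums, and
  not just as some square-integrable function, because periodicity at every point is read off from
  it later.\<close>

lemma Riesz_Fischer:
  assumes c: "(\<lambda>k. (cmod (c k))\<^sup>2) summable_on UNIV"
  obtains F where "square_integrable M (\<lambda>x. lim (\<lambda>n. partial_sum c (F n) x))"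
    "coeff (\<lambda>x. lim (\<lambda>n. partial_sum c (F n) x)) = c"
    "(\<integral>x. (cmod (lim (\<lambda>n. partial_sum c (F n) x)))\<^sup>2 \<partial>M) \<le> A * (\<Sum>\<^sub>\<infinity>k. (cmod (c k))\<^sup>2)"
proof -
  let ?S = "\<Sum>\<^sub>\<infinity>k. (cmod (c k))\<^sup>2"
  \<comment> \<open>The index type has no order; finite sets with tails at most
    \<open>(1/2)^n\<close> replace the usual exhausting sequence.\<close>
  have "\<exists>F. finite F \<and> (\<forall>G. finite G \<longrightarrow> F \<inter> G = {} \<longrightarrow> (\<Sum>k\<in>G. (cmod (c k))\<^sup>2) \<le> (1/2)^n)" for n :: nat
  proof -
    have "((\<lambda>k. (cmod (c k))\<^sup>2) has_sum ?S) UNIV" by (intro has_sum_infsum c)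
    then have "\<forall>\<^sub>F K in finite_subsets_at_top UNIV. dist (\<Sum>k\<in>K. (cmod (c k))\<^sup>2) ?S < (1/2)^n"
      unfolding has_sum_def by (intro tendstoD) auto
    then obtain F where F: "finite F" "dist (\<Sum>k\<in>F. (cmod (c k))\<^sup>2) ?S < (1/2)^n"
      unfolding eventually_finite_subsets_at_top by auto
    have "(\<Sum>k\<in>G. (cmod (c k))\<^sup>2) \<le> (1/2)^n" if "finite G" "F \<inter> G = {}" for G
    proof -
      have "(\<Sum>k\<in>F \<union> G. (cmod (c k))\<^sup>2) \<le> ?S" using F that c by (intro finite_sum_le_infsum) auto
      then show ?thesis using F that unfolding dist_real_def by (simp add: sum.union_disjoint)
    qed
    then show ?thesis using F by blast
  qed
  then obtain F where F: "\<And>n. finite (F n)"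
    and tail: "\<And>n G. finite G \<Longrightarrow> F n \<inter> G = {} \<Longrightarrow> (\<Sum>k\<in>G. (cmod (c k))\<^sup>2) \<le> (1/2)^n"
    by metis
  let ?s = "\<lambda>n. partial_sum c (F n)"
  have s_meas [measurable]: "?s n \<in> borel_measurable M" for n
    using square_integrable_partial_sum by (simp add: square_integrable_def)
  have diff: "(\<integral>x. (cmod (?s i x - ?s j x))\<^sup>2 \<partial>M) \<le> A * (2 * (1/2)^N)" if "i \<ge> N" "j \<ge> N" for i j N
  proof -
    \<comment> \<open>The two partial sums differ by one signed partial sum over the symmetric
      difference. Each half of it avoids one of \<open>F i\<close> and \<open>F j\<close>, so the
      tail bound applies to it.\<close>
    let ?c = "\<lambda>k. if k \<in> F i then c k else - c k"
    let ?P = "F i - F j" and ?Q = "F j - F i"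
    have "?s i x - ?s j x = partial_sum ?c (?P \<union> ?Q) x" for x
    proof -
      have "?s i x = (\<Sum>k\<in>?P. c k * e k x) + (\<Sum>k\<in>F i \<inter> F j. c k * e k x)"
        unfolding partial_sum_def using F by (subst sum.union_disjoint[symmetric]) (auto intro!: sum.cong)
      moreover have "?s j x = (\<Sum>k\<in>?Q. c k * e k x) + (\<Sum>k\<in>F i \<inter> F j. c k * e k x)"
        unfolding partial_sum_def using F by (subst sum.union_disjoint[symmetric]) (auto intro!: sum.cong)
      moreover have "partial_sum ?c (?P \<union> ?Q) x = (\<Sum>k\<in>?P. c k * e k x) + (\<Sum>k\<in>?Q. - (c k * e k x))"
        unfolding partial_sum_def using F
        by (subst sum.union_disjoint) (auto intro!: sum.cong arg_cong2[where f = "(+)"])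
      ultimately show ?thesis by (simp add: sum_negf)
    qed
    then have "(\<integral>x. (cmod (?s i x - ?s j x))\<^sup>2 \<partial>M) = A * (\<Sum>k\<in>?P \<union> ?Q. (cmod (?c k))\<^sup>2)"
      using F by (simp add: norm_partial_sum)
    also have "(\<Sum>k\<in>?P \<union> ?Q. (cmod (?c k))\<^sup>2) = (\<Sum>k\<in>?P. (cmod (c k))\<^sup>2) + (\<Sum>k\<in>?Q. (cmod (c k))\<^sup>2)"
      using F by (subst sum.union_disjoint) (auto intro!: sum.cong arg_cong2[where f = "(+)"])
    also have "\<dots> \<le> (1/2)^j + (1/2)^i" using F by (intro add_mono tail) auto
    also have "\<dots> \<le> (1/2)^N + (1/2)^N" using that by (intro add_mono power_decreasing) auto
    finally show ?thesis using A by simp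
  qed
  have "\<exists>N. \<forall>i\<ge>N. \<forall>j\<ge>N. (LINT x|M. norm (?s i x - ?s j x)) < \<epsilon>" if "\<epsilon> > 0" for \<epsilon>
  proof -
    let ?m = "measure M (space M)"
    have "(\<lambda>N. ?m * (A * (2 * (1/2)^N))) \<longlonglongrightarrow> ?m * (A * (2 * 0))"
      by (intro tendsto_intros LIMSEQ_power_zero) auto
    then have "\<forall>\<^sub>F N in sequentially. ?m * (A * (2 * (1/2)^N)) < \<epsilon>\<^sup>2"
      using that by (intro order_tendstoD) auto
    then obtain N where N: "?m * (A * (2 * (1/2)^N)) < \<epsilon>\<^sup>2" by (meson eventually_sequentially order_refl)
    have "(LINT x|M. norm (?s i x - ?s j x)) < \<epsilon>" if "i \<ge> N" "j \<ge> N" for i j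
    proof (rule power2_less_imp_less)
      have "(LINT x|M. norm (?s i x - ?s j x))\<^sup>2 \<le> ?m * (\<integral>x. (cmod (?s i x - ?s j x))\<^sup>2 \<partial>M)"
        by (intro L1_le_L2 square_integrable_diff square_integrable_partial_sum)
      also have "\<dots> \<le> ?m * (A * (2 * (1/2)^N))" by (intro mult_left_mono diff that) auto
      also have "\<dots> < \<epsilon>\<^sup>2" by (rule N)
      finally show "(LINT x|M. norm (?s i x - ?s j x))\<^sup>2 < \<epsilon>\<^sup>2" .
    qed (use \<open>\<epsilon> > 0\<close> in simp)
    then show ?thesis by blast
  qed
  then obtain r where r: "strict_mono r" "AE x in M. Cauchy (\<lambda>i. ?s (r i) x)"
    using cauchy_L1_AE_cauchy_subseq[of M ?s] square_integrable_imp_integrable square_integrable_partial_sum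
    by blast
  define f where "f x = lim (\<lambda>n. ?s (r n) x)" for x
  have f_meas [measurable]: "f \<in> borel_measurable M"
    unfolding f_def by (rule borel_measurable_lim_metric) simp
  have f_lim: "AE x in M. (\<lambda>n. ?s (r n) x) \<longlonglongrightarrow> f x"
    using r(2) by eventually_elim (simp add: f_def Cauchy_convergent_iff convergent_LIMSEQ_iff)
  have bound: "(\<integral>x. (cmod (?s n x))\<^sup>2 \<partial>M) \<le> A * ?S" for n
    unfolding norm_partial_sum[OF F] using A F c by (intro mult_left_mono finite_sum_le_infsum) auto
  have f: "square_integrable M f" "(\<integral>x. (cmod (f x))\<^sup>2 \<partial>M) \<le> A * ?S"
    using square_integrable_Fatou[OF square_integrable_partial_sum f_meas f_lim bound] by auto
  \<comment> \<open>Coefficients are compared through the partial sum over \<open>F N\<close>: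
    Bessel's inequality for a single mode contributes 2, and the tail outside \<open>F N\<close>
    contributes 1, to the constant 3.\<close>
  have close: "cmod (coeff f k - c k) \<le> 3 * sqrt ((1/2)^N)" for k N
  proof -
    let ?d = "\<lambda>n x. ?s (r (n + N)) x - ?s N x"
    have lim: "AE x in M. (\<lambda>n. ?d n x) \<longlonglongrightarrow> f x - ?s N x"
      using f_lim by eventually_elim (intro tendsto_intros LIMSEQ_ignore_initial_segment)
    have bd: "(\<integral>x. (cmod (?d n x))\<^sup>2 \<partial>M) \<le> A * (2 * (1/2)^N)" for n
      using seq_suble[OF r(1), of "n + N"] by (intro diff) auto
    have d: "(\<integral>x. (cmod (f x - ?s N x))\<^sup>2 \<partial>M) \<le> A * (2 * (1/2)^N)"
      by (rule square_integrable_Fatou(2)[OF _ _ lim bd])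
        (simp_all add: square_integrable_diff square_integrable_partial_sum)
    have "(cmod (coeff f k - coeff (?s N) k))\<^sup>2 \<le> (\<integral>x. (cmod (f x - ?s N x))\<^sup>2 \<partial>M) / A"
      using Bessel[OF square_integrable_diff[OF f(1) square_integrable_partial_sum], of "{k}" c "F N"]
      by (simp add: coeff_diff f square_integrable_partial_sum)
    also have "\<dots> \<le> 2 * (1/2)^N" using d A by (simp add: divide_le_eq mult.commute)
    also have "\<dots> \<le> 4 * (1/2)^N" by simp
    finally have "cmod (coeff f k - coeff (?s N) k) \<le> sqrt (4 * (1/2)^N)" by (rule real_le_rsqrt)
    then have 1: "cmod (coeff f k - coeff (?s N) k) \<le> 2 * sqrt ((1/2)^N)" by (simp add: real_sqrt_mult)
    have "(cmod (coeff (?s N) k - c k))\<^sup>2 \<le> (1/2)^N"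
    proof (cases "k \<in> F N")
      case False
      then show ?thesis using tail[of "{k}" N] by (simp add: coeff_partial_sum[OF F])
    qed (simp add: coeff_partial_sum[OF F])
    then have 2: "cmod (coeff (?s N) k - c k) \<le> sqrt ((1/2)^N)" by (rule real_le_rsqrt)
    have "cmod (coeff f k - c k) \<le> cmod (coeff f k - coeff (?s N) k) + cmod (coeff (?s N) k - c k)"
      using norm_triangle_ineq[of "coeff f k - coeff (?s N) k" "coeff (?s N) k - c k"] by simp
    then show ?thesis using 1 2 by linarith
  qed
  have "coeff f k = c k" for k
  proof -
    have "(\<lambda>N. 3 * sqrt ((1/2)^N)) \<longlonglongrightarrow> 3 * sqrt 0"
      by (intro tendsto_intros LIMSEQ_power_zero) auto
    then have "cmod (coeff f k - c k) \<le> 3 * sqrt 0"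
      by (rule LIMSEQ_le_const) (auto intro: close)
    then show ?thesis by simp
  qed
  then have "coeff f = c" by blast
  then show ?thesis using that[of "\<lambda>n. F (r n)"] f unfolding f_def by simp
qed

text \<open>Completeness turns Bessel's inequality and the norm bound of Riesz--Fischer into Parseval's
  identity.\<close>

lemma Parseval:
  assumes complete: "\<And>f. square_integrable M f \<Longrightarrow> (\<And>k. coeff f k = 0) \<Longrightarrow> AE x in M. f x = 0"
    and f: "square_integrable M f"
  shows "(\<integral>x. (cmod (f x))\<^sup>2 \<partial>M) = A * (\<Sum>\<^sub>\<infinity>k. (cmod (coeff f k))\<^sup>2)"
proof (rule antisym)
  obtain F where F: "square_integrable M (\<lambda>x. lim (\<lambda>n. partial_sum (coeff f) (F n) x))"
    "coeff (\<lambda>x. lim (\<lambda>n. partial_sum (coeff f) (F n) x)) = coeff f"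
    "(\<integral>x. (cmod (lim (\<lambda>n. partial_sum (coeff f) (F n) x)))\<^sup>2 \<partial>M) \<le> A * (\<Sum>\<^sub>\<infinity>k. (cmod (coeff f k))\<^sup>2)"
    using Riesz_Fischer[OF square_summable_coeff[OF f]] by blast
  have [measurable]: "f \<in> borel_measurable M"
    "(\<lambda>x. lim (\<lambda>n. partial_sum (coeff f) (F n) x)) \<in> borel_measurable M"
    using f F(1) by (auto simp: square_integrable_def)
  have "AE x in M. f x - lim (\<lambda>n. partial_sum (coeff f) (F n) x) = 0"
    using F f by (intro complete square_integrable_diff) (simp_all add: coeff_diff)
  then have "(\<integral>x. (cmod (f x))\<^sup>2 \<partial>M) = (\<integral>x. (cmod (lim (\<lambda>n. partial_sum (coeff f) (F n) x)))\<^sup>2 \<partial>M)"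
    by (intro integral_cong_AE) (auto)
  then show "(\<integral>x. (cmod (f x))\<^sup>2 \<partial>M) \<le> A * (\<Sum>\<^sub>\<infinity>k. (cmod (coeff f k))\<^sup>2)" using F(3) by simp
  have "(\<Sum>\<^sub>\<infinity>k. (cmod (coeff f k))\<^sup>2) \<le> (\<integral>x. (cmod (f x))\<^sup>2 \<partial>M) / A"
    by (intro infsum_le_finite_sums square_summable_coeff[OF f] Bessel[OF f])
  then show "A * (\<Sum>\<^sub>\<infinity>k. (cmod (coeff f k))\<^sup>2) \<le> (\<integral>x. (cmod (f x))\<^sup>2 \<partial>M)"
    using A by (simp add: field_simps)
qed

end

section \<open>Torus characters and their orthogonality\<close>

definition torus_char :: "real \<Rightarrow> real \<Rightarrow> int \<times> int \<Rightarrow> real \<times> real \<Rightarrow> complex" where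
  "torus_char \<omega>1 \<omega>2 k x = cis (2 * pi * (of_int (fst k) * fst x / \<omega>1 + of_int (snd k) * snd x / \<omega>2))"

lemma torus_char_add: "torus_char \<omega>1 \<omega>2 (j + k) x = torus_char \<omega>1 \<omega>2 j x * torus_char \<omega>1 \<omega>2 k x"
  by (simp add: torus_char_def cis_mult add_divide_distrib algebra_simps)

lemma torus_char_0 [simp]: "torus_char \<omega>1 \<omega>2 0 x = 1"
  by (simp add: torus_char_def)

lemma cnj_torus_char: "cnj (torus_char \<omega>1 \<omega>2 k x) = torus_char \<omega>1 \<omega>2 (- k) x"
  by (simp add: torus_char_def cis_cnj algebra_simps)

lemma cmod_torus_char [simp]: "cmod (torus_char \<omega>1 \<omega>2 k x) = 1"
  by (simp add: torus_char_def)

lemma continuous_torus_char: "continuous_on S (torus_char \<omega>1 \<omega>2 k)"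
  unfolding torus_char_def cis_conv_exp by (cases "\<omega>1 = 0"; cases "\<omega>2 = 0") (auto intro!: continuous_intros)

lemma integral_cis_period:
  fixes n :: int
  assumes w: "w > 0"
  shows "integral {0..w} (\<lambda>x. cis (2 * pi * of_int n * x / w)) = (if n = 0 then of_real w else 0)"
proof (cases "n = 0")
  case True
  then show ?thesis using w by (simp add: scaleR_conv_of_real)
next
  case False
  define a where "a = 2 * pi * of_int n / w"
  have a: "a \<noteq> 0" using False w by (simp add: a_def)
  have "((\<lambda>x. cis (a * x)) has_integral cis (a * w) / (\<i> * of_real a) - cis (a * 0) / (\<i> * of_real a)) {0..w}"
  proof (rule fundamental_theorem_of_calculus)
    show "((\<lambda>x. cis (a * x) / (\<i> * of_real a)) has_vector_derivative cis (a * x)) (at x within {0..w})" for x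
    proof -
      have "((\<lambda>z. exp (\<i> * of_real a * z) / (\<i> * of_real a)) has_field_derivative exp (\<i> * of_real a * of_real x)) (at (of_real x))"
        using a by (auto intro!: derivative_eq_intros)
      from has_vector_derivative_real_field[OF this] show ?thesis
        by (simp add: cis_conv_exp mult.assoc)
    qed
  qed (use w in simp)
  moreover have "cis (a * w) = 1"
    using w cis_multiple_2pi[of "of_int n"] by (simp add: a_def)
  ultimately have "integral {0..w} (\<lambda>x. cis (a * x)) = 0" by (simp add: integral_unique)
  then show ?thesis using False by (simp add: a_def)
qed

context
  fixes \<omega>1 \<omega>2 :: real
  assumes \<omega>: "\<omega>1 > 0" "\<omega>2 > 0"
begin

abbreviation "torus_cell \<equiv> {0..<\<omega>1} \<times> {0..<\<omega>2}"
abbreviation "\<mu> \<equiv> torus_measure \<omega>1 \<omega>2"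
abbreviation "\<eta> \<equiv> torus_char \<omega>1 \<omega>2"

lemma torus_cell_lmeasurable: "torus_cell \<in> lmeasurable"
proof (rule bounded_set_imp_lmeasurable)
  have "torus_cell \<subseteq> cbox (0, 0) (\<omega>1, \<omega>2)" by (auto simp: cbox_Pair_eq)
  then show "bounded torus_cell" using bounded_cbox bounded_subset by blast
  show "torus_cell \<in> sets lebesgue" by (intro sets_completionI_sets) (simp add: borel_Times)
qed

lemma torus_cell_sets: "torus_cell \<in> sets lebesgue"
  using torus_cell_lmeasurable by (rule fmeasurableD)

lemma space_torus_measure: "space \<mu> = torus_cell"
  by (simp add: torus_measure_def space_restrict_space)

lemma finite_torus_measure: "finite_measure \<mu>"
  unfolding torus_measure_def by (rule finite_measure_lebesgue_on[OF torus_cell_lmeasurable])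

lemma continuous_measurable_torus: "continuous_on UNIV h \<Longrightarrow> h \<in> borel_measurable \<mu>"
  for h :: "real \<times> real \<Rightarrow> 'b::euclidean_space"
  unfolding torus_measure_def
  by (intro continuous_imp_measurable_on_sets_lebesgue torus_cell_sets) (rule continuous_on_subset, auto)

lemma integral_torus_char: "(\<integral>x. \<eta> k x \<partial>\<mu>) = (if k = 0 then of_real (\<omega>1 * \<omega>2) else 0)"
proof -
  interpret finite_measure \<mu> by (rule finite_torus_measure)
  have "integrable \<mu> (\<eta> k)"
    by (rule integrable_const_bound[where B = 1])
      (auto intro!: continuous_measurable_torus continuous_torus_char)
  then have "(\<integral>x. \<eta> k x \<partial>\<mu>) = integral torus_cell (\<eta> k)"
    unfolding torus_measure_def by (rule lebesgue_integral_eq_integral[OF _ torus_cell_sets])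
  also have "\<dots> = integral (cbox (0, 0) (\<omega>1, \<omega>2)) (\<eta> k)"
  proof (rule integral_spike_set)
    show "negligible {x \<in> torus_cell - cbox (0, 0) (\<omega>1, \<omega>2). \<eta> k x \<noteq> 0}"
      by (rule negligible_subset[OF negligible_empty]) (auto simp: cbox_Pair_eq)
    show "negligible {x \<in> cbox (0, 0) (\<omega>1, \<omega>2) - torus_cell. \<eta> k x \<noteq> 0}"
      by (rule negligible_subset[OF negligible_frontier_interval[of "(0, 0)" "(\<omega>1, \<omega>2)"]])
        (auto simp: cbox_Pair_eq mem_box Basis_prod_def)
  qed
  also have "\<dots> = integral (cbox 0 \<omega>1) (\<lambda>x. integral (cbox 0 \<omega>2) (\<lambda>y. \<eta> k (x, y)))"
    by (rule integral_prod_continuous[OF continuous_torus_char])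
  also have "\<dots> = integral {0..\<omega>1} (\<lambda>x. cis (2 * pi * of_int (fst k) * x / \<omega>1)
      * integral {0..\<omega>2} (\<lambda>y. cis (2 * pi * of_int (snd k) * y / \<omega>2)))"
    by (simp add: torus_char_def cis_mult[symmetric] distrib_left mult.assoc)
  also have "\<dots> = (if fst k = 0 then of_real \<omega>1 else 0) * (if snd k = 0 then of_real \<omega>2 else 0)"
    using \<omega> by (simp add: integral_cis_period)
  also have "\<dots> = (if k = 0 then of_real (\<omega>1 * \<omega>2) else 0)" by (cases k) (simp add: zero_prod_def)
  finally show ?thesis .
qed

lemma orthogonal_characters_torus: "orthogonal_characters \<mu> \<eta> (\<omega>1 * \<omega>2)"
proof -
  interpret finite_measure \<mu> by (rule finite_torus_measure)
  show ?thesis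
  proof
    fix j k :: "int \<times> int" and x
    show "\<omega>1 * \<omega>2 > 0" using \<omega> by simp
    show "\<eta> k \<in> borel_measurable \<mu>" by (intro continuous_measurable_torus continuous_torus_char)
    show "cmod (\<eta> k x) = 1" by simp
    have "\<eta> j x * cnj (\<eta> k x) = \<eta> (j - k) x" for x
      using torus_char_add[of \<omega>1 \<omega>2 j "- k" x] by (simp add: cnj_torus_char)
    then show "(\<integral>x. \<eta> j x * cnj (\<eta> k x) \<partial>\<mu>) = (if j = k then of_real (\<omega>1 * \<omega>2) else 0)"
      by (simp add: integral_torus_char)
  qed
qed

interpretation orthogonal_characters \<mu> \<eta> "\<omega>1 * \<omega>2" by (rule orthogonal_characters_torus)

lemma fourier_coeff_eq_coeff: "fourier_coeff \<omega>1 \<omega>2 f k = coeff f k"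
  by (simp add: fourier_coeff_def coeff_def torus_char_def cis_cnj case_prod_unfold)

lemma torus_L2_iff: "f \<in> torus_L2 \<omega>1 \<omega>2 \<longleftrightarrow> torus_periodic \<omega>1 \<omega>2 f \<and> square_integrable \<mu> f"
  by (auto simp: torus_L2_def square_integrable_def)

section \<open>Completeness of the torus characters\<close>

lemma integrable_mult_bounded:
  assumes "integrable \<mu> f" "h \<in> borel_measurable \<mu>" "\<And>x. cmod (h x) \<le> B"
  shows "integrable \<mu> (\<lambda>x. f x * h x)"
proof (rule Bochner_Integration.integrable_bound)
  show "integrable \<mu> (\<lambda>x. of_real B * f x)" using assms by simp
  show "(\<lambda>x. f x * h x) \<in> borel_measurable \<mu>" using assms by simp
  show "AE x in \<mu>. norm (f x * h x) \<le> norm (of_real B * f x)"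
  proof (intro AE_I2)
    fix x
    have "cmod (h x) * cmod (f x) \<le> \<bar>B\<bar> * cmod (f x)"
      using assms(3)[of x] by (intro mult_right_mono) auto
    then show "norm (f x * h x) \<le> norm (of_real B * f x)" by (simp add: norm_mult mult.commute)
  qed
qed

text \<open>The image lies in a product of two unit circles, which is compact, and on it the
  characters are monomials in the two coordinates and their conjugates. This brings
  Stone--Weierstrass for polynomial functions into reach.\<close>

definition torus_embed :: "real \<times> real \<Rightarrow> complex \<times> complex" where
  "torus_embed x = (\<eta> (1, 0) x, \<eta> (0, 1) x)"

lemma continuous_torus_embed: "continuous_on UNIV torus_embed"
  unfolding torus_embed_def by (intro continuous_on_Pair continuous_torus_char)

lemma torus_embed_measurable [measurable]: "torus_embed \<in> borel_measurable \<mu>"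
  by (intro continuous_measurable_torus continuous_torus_embed)

text \<open>\<open>Arg2pi\<close> takes values in \<open>[0, 2 * pi)\<close>, which fits the
  half-open cell and makes this a left inverse of the embedding there. Being measurable, it shows
  every Borel subset of the cell to be a preimage under \<open>torus_embed\<close>.\<close>

definition torus_unembed :: "complex \<times> complex \<Rightarrow> real \<times> real" where
  "torus_unembed w = (\<omega>1 / (2 * pi) * Arg2pi (fst w), \<omega>2 / (2 * pi) * Arg2pi (snd w))"

text \<open>\<open>Arg2pi\<close> is continuous off the nonnegative real axis and zero on it, so it
  equals its own product with an indicator.\<close>

lemma Arg2pi_measurable [measurable]: "Arg2pi \<in> borel_measurable borel"
proof -
  have "(\<lambda>z. indicat_real (- \<real>\<^sub>\<ge>\<^sub>0) z *\<^sub>R Arg2pi z) \<in> borel_measurable borel"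
    by (intro borel_measurable_continuous_on_indicator continuous_at_imp_continuous_on ballI continuous_at_Arg2pi)
      auto
  moreover have "(\<lambda>z. indicat_real (- \<real>\<^sub>\<ge>\<^sub>0) z *\<^sub>R Arg2pi z) = Arg2pi"
  proof (rule ext)
    fix z
    show "indicat_real (- \<real>\<^sub>\<ge>\<^sub>0) z *\<^sub>R Arg2pi z = Arg2pi z"
    proof (cases "z \<in> \<real>\<^sub>\<ge>\<^sub>0")
    case True
    then have "Arg2pi z = 0" by (simp add: Arg2pi_eq_0 complex_nonneg_Reals_iff complex_is_Real_iff)
    then show ?thesis by simp
    qed simp
  qed
  ultimately show ?thesis by (simp only:)
qed

lemma torus_unembed_measurable [measurable]: "torus_unembed \<in> borel_measurable borel"
  unfolding torus_unembed_def
  by (intro borel_measurable_Pair borel_measurable_times borel_measurable_const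
      measurable_compose[OF _ Arg2pi_measurable] borel_measurable_continuous_onI continuous_intros)

lemma torus_unembed_embed:
  assumes "x \<in> torus_cell" shows "torus_unembed (torus_embed x) = x"
proof -
  have *: "w / (2 * pi) * Arg2pi (cis (2 * pi * (s / w))) = s" if "0 \<le> s" "s < w" for s w
  proof -
    have "s / w < 1" using that by simp
    then have "2 * pi * (s / w) < 2 * pi * 1" by (intro mult_strict_left_mono) auto
    then have "Arg2pi (cis (2 * pi * (s / w))) = 2 * pi * (s / w)"
      using that by (intro Arg2pi_unique[of 1]) (auto simp: cis_conv_exp)
    then show ?thesis using that by simp
  qed
  show ?thesis
    using assms * by (cases x) (auto simp: torus_unembed_def torus_embed_def torus_char_def)
qed

context
  fixes f :: "real \<times> real \<Rightarrow> complex"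
  assumes f: "square_integrable \<mu> f" and f_coeff: "\<And>k. coeff f k = 0"
begin

lemma f_integrable: "integrable \<mu> f"
  by (rule square_integrable_imp_integrable[OF f])

lemma f_measurable [measurable]: "f \<in> borel_measurable \<mu>"
  using f by (simp add: square_integrable_def)

text \<open>All modes \<open>k\<close> are required, and not just a vanishing integral, so that
  multiplication by a character stays inside the class; boundedness keeps the product with
  \<open>f\<close> integrable.\<close>

definition annihilated :: "(real \<times> real \<Rightarrow> complex) \<Rightarrow> bool" where
  "annihilated h \<longleftrightarrow> h \<in> borel_measurable \<mu> \<and> (\<exists>B. \<forall>x. cmod (h x) \<le> B)
     \<and> (\<forall>k. (\<integral>x. f x * h x * \<eta> k x \<partial>\<mu>) = 0)"

lemma annihilated_integrable: "annihilated h \<Longrightarrow> integrable \<mu> (\<lambda>x. f x * h x * \<eta> k x)"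
proof -
  assume "annihilated h"
  then obtain B where h: "h \<in> borel_measurable \<mu>" "\<And>x. cmod (h x) \<le> B" by (auto simp: annihilated_def)
  then have "integrable \<mu> (\<lambda>x. f x * (h x * \<eta> k x))"
    by (intro integrable_mult_bounded f_integrable) (auto simp: norm_mult)
  then show ?thesis by (simp add: mult.assoc)
qed

lemma annihilated_1: "annihilated (\<lambda>x. 1)"
proof -
  have "(\<integral>x. f x * \<eta> k x \<partial>\<mu>) = 0" for k
    using f_coeff[of "- k"] \<omega> by (simp add: coeff_def cnj_torus_char)
  then show ?thesis by (auto simp: annihilated_def)
qed

lemma annihilated_add:
  assumes "annihilated g" "annihilated h" shows "annihilated (\<lambda>x. g x + h x)"
proof -
  obtain B C where B: "\<And>x. cmod (g x) \<le> B" and C: "\<And>x. cmod (h x) \<le> C"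
    using assms by (auto simp: annihilated_def)
  have "cmod (g x + h x) \<le> B + C" for x
    using norm_triangle_ineq[of "g x" "h x"] B[of x] C[of x] by linarith
  moreover have "(\<integral>x. f x * (g x + h x) * \<eta> k x \<partial>\<mu>) = 0" for k
  proof -
    have "(\<integral>x. f x * (g x + h x) * \<eta> k x \<partial>\<mu>) = (\<integral>x. f x * g x * \<eta> k x + f x * h x * \<eta> k x \<partial>\<mu>)"
      by (simp add: algebra_simps)
    also have "\<dots> = (\<integral>x. f x * g x * \<eta> k x \<partial>\<mu>) + (\<integral>x. f x * h x * \<eta> k x \<partial>\<mu>)"
      by (rule Bochner_Integration.integral_add[OF annihilated_integrable[OF assms(1)] annihilated_integrable[OF assms(2)]])
    also have "(\<integral>x. f x * g x * \<eta> k x \<partial>\<mu>) = 0" using assms(1) unfolding annihilated_def by blast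
    also have "(\<integral>x. f x * h x * \<eta> k x \<partial>\<mu>) = 0" using assms(2) unfolding annihilated_def by blast
    finally show ?thesis by simp
  qed
  ultimately show ?thesis using assms by (auto simp: annihilated_def)
qed

lemma annihilated_cmult_char:
  assumes "annihilated h" shows "annihilated (\<lambda>x. c * \<eta> j x * h x)"
proof -
  obtain B where B: "\<And>x. cmod (h x) \<le> B" using assms by (auto simp: annihilated_def)
  have "cmod (c * \<eta> j x * h x) \<le> cmod c * B" for x
    using B by (simp add: norm_mult mult_left_mono)
  moreover have "(\<integral>x. f x * (c * \<eta> j x * h x) * \<eta> k x \<partial>\<mu>) = 0" for k
  proof -
    have "(\<integral>x. f x * (c * \<eta> j x * h x) * \<eta> k x \<partial>\<mu>) = (\<integral>x. c * (f x * h x * \<eta> (j + k) x) \<partial>\<mu>)"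
      by (simp add: torus_char_add mult_ac)
    also have "\<dots> = c * (\<integral>x. f x * h x * \<eta> (j + k) x \<partial>\<mu>)" by simp
    also have "(\<integral>x. f x * h x * \<eta> (j + k) x \<partial>\<mu>) = 0" using assms unfolding annihilated_def by blast
    finally show ?thesis by simp
  qed
  ultimately show ?thesis using assms by (auto simp: annihilated_def)
qed

lemma annihilated_cmult: "annihilated h \<Longrightarrow> annihilated (\<lambda>x. c * h x)"
  using annihilated_cmult_char[of h c 0] by simp

text \<open>Having \<open>h\<close> arbitrary makes the product case two applications of the
  induction hypothesis. On the image of the embedding a real linear form is a combination of the
  characters at \<open>(1, 0)\<close>, \<open>(- 1, 0)\<close>, \<open>(0, 1)\<close> and
  \<open>(0, - 1)\<close>.\<close>

lemma annihilated_polynomial: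
  assumes "real_polynomial_function p"
  shows "annihilated h \<Longrightarrow> annihilated (\<lambda>x. of_real (p (torus_embed x)) * h x)"
  using assms
proof (induction arbitrary: h rule: real_polynomial_function.induct)
  case (linear L)
  interpret L: bounded_linear L by fact
  \<comment> \<open>On the first factor the form is \<open>2 * Re (a * z)\<close> for this
    \<open>a\<close>, which explains the half; \<open>b\<close> does the same on the second.\<close>
  define a where "a = (of_real (L (1, 0)) - \<i> * of_real (L (\<i>, 0))) / 2"
  define b where "b = (of_real (L (0, 1)) - \<i> * of_real (L (0, \<i>))) / 2"
  have L_eq: "of_real (L (z, w)) = a * z + cnj a * cnj z + b * w + cnj b * cnj w" for z w
  proof -
    have "(z, w) = Re z *\<^sub>R (1, 0) + Im z *\<^sub>R (\<i>, 0) + Re w *\<^sub>R (0, 1) + Im w *\<^sub>R (0, \<i>)"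
      by (simp add: complex_eq_iff)
    then have "L (z, w) = Re z * L (1, 0) + Im z * L (\<i>, 0) + Re w * L (0, 1) + Im w * L (0, \<i>)"
      by (simp only: L.add L.scaleR real_scaleR_def)
    then show ?thesis by (simp add: complex_eq_iff a_def b_def field_simps)
  qed
  have "annihilated (\<lambda>x. ((a * \<eta> (1, 0) x * h x + cnj a * \<eta> (- 1, 0) x * h x)
      + b * \<eta> (0, 1) x * h x) + cnj b * \<eta> (0, - 1) x * h x)"
    by (intro annihilated_add annihilated_cmult_char linear)
  then show ?case
    by (simp add: torus_embed_def L_eq cnj_torus_char distrib_right)
next
  case (const c)
  then show ?case by (rule annihilated_cmult)
next
  case (add p q)
  then show ?case by (simp add: distrib_right annihilated_add)
next
  case (mult p q)
  then show ?case by (simp add: mult.assoc)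
qed

text \<open>Uniform approximation by a polynomial on the product of circles, where all values of
  \<open>torus_embed\<close> lie, changes the integral by at most \<open>e\<close> times that of
  \<open>cmod (f x)\<close>.\<close>

lemma integral_continuous_eq_0:
  fixes \<phi> :: "complex \<times> complex \<Rightarrow> real"
  assumes \<phi>: "continuous_on UNIV \<phi>"
  shows "(\<integral>x. f x * of_real (\<phi> (torus_embed x)) \<partial>\<mu>) = 0"
proof -
  let ?C = "sphere 0 1 \<times> sphere 0 1 :: (complex \<times> complex) set"
  have C: "compact ?C" by (intro compact_Times compact_sphere)
  have inC: "torus_embed x \<in> ?C" for x by (simp add: torus_embed_def)
  have "compact (\<phi> ` ?C)" by (intro compact_continuous_image continuous_on_subset[OF \<phi>] C) auto
  then obtain B where B: "\<And>w. w \<in> ?C \<Longrightarrow> \<bar>\<phi> w\<bar> \<le> B"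
    by (meson bounded_real compact_imp_bounded image_eqI)
  have [measurable]: "\<phi> \<in> borel_measurable borel" by (rule borel_measurable_continuous_onI[OF \<phi>])
  have int: "integrable \<mu> (\<lambda>x. f x * of_real (\<phi> (torus_embed x)))"
    by (rule integrable_mult_bounded[OF f_integrable, where B = B]) (use B inC in auto)
  let ?I = "\<integral>x. f x * of_real (\<phi> (torus_embed x)) \<partial>\<mu>"
  have le: "cmod ?I \<le> e * (\<integral>x. cmod (f x) \<partial>\<mu>)" if e: "e > 0" for e
  proof -
    obtain p where p: "real_polynomial_function p" "\<And>w. w \<in> ?C \<Longrightarrow> \<bar>\<phi> w - p w\<bar> < e"
      using Stone_Weierstrass_real_polynomial_function[OF C continuous_on_subset[OF \<phi> subset_UNIV] e] by blast
    have a: "annihilated (\<lambda>x. of_real (p (torus_embed x)))"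
      using annihilated_polynomial[OF p(1) annihilated_1] by simp
    have intp: "integrable \<mu> (\<lambda>x. f x * of_real (p (torus_embed x)))"
      and I0: "(\<integral>x. f x * of_real (p (torus_embed x)) \<partial>\<mu>) = 0"
    proof -
      show "integrable \<mu> (\<lambda>x. f x * of_real (p (torus_embed x)))"
        using annihilated_integrable[OF a, of 0] by simp
      have "\<forall>k. (\<integral>x. f x * of_real (p (torus_embed x)) * \<eta> k x \<partial>\<mu>) = 0"
        using a unfolding annihilated_def by blast
      from spec[OF this, of 0] show "(\<integral>x. f x * of_real (p (torus_embed x)) \<partial>\<mu>) = 0" by simp
    qed
    have "?I = (\<integral>x. f x * of_real (\<phi> (torus_embed x)) - f x * of_real (p (torus_embed x)) \<partial>\<mu>)"
      using int intp I0 by simp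
    also have "cmod \<dots> \<le> (\<integral>x. cmod (f x * of_real (\<phi> (torus_embed x)) - f x * of_real (p (torus_embed x))) \<partial>\<mu>)"
      by (rule integral_norm_bound)
    also have "\<dots> \<le> (\<integral>x. e * cmod (f x) \<partial>\<mu>)"
    proof (rule integral_mono)
      show "integrable \<mu> (\<lambda>x. cmod (f x * of_real (\<phi> (torus_embed x)) - f x * of_real (p (torus_embed x))))"
        using int intp by (intro integrable_norm Bochner_Integration.integrable_diff)
      show "integrable \<mu> (\<lambda>x. e * cmod (f x))" using f_integrable by simp
      fix x
      have "cmod (f x * of_real (\<phi> (torus_embed x)) - f x * of_real (p (torus_embed x)))
          = cmod (f x) * \<bar>\<phi> (torus_embed x) - p (torus_embed x)\<bar>"
        by (simp flip: right_diff_distrib of_real_diff add: norm_mult)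
      also have "\<dots> \<le> cmod (f x) * e" using p(2)[OF inC[of x]] by (intro mult_left_mono) auto
      finally show "cmod (f x * of_real (\<phi> (torus_embed x)) - f x * of_real (p (torus_embed x))) \<le> e * cmod (f x)"
        by (simp add: mult.commute)
    qed
    finally show ?thesis by simp
  qed
  have "cmod ?I \<le> 0"
  proof (rule field_le_epsilon)
    fix e :: real assume e: "e > 0"
    let ?n = "\<integral>x. cmod (f x) \<partial>\<mu>"
    have n: "?n \<ge> 0" by simp
    \<comment> \<open>Dividing by \<open>?n + 1\<close> instead of \<open>?n\<close> covers
      \<open>?n = 0\<close>.\<close>
    have "cmod ?I \<le> e / (?n + 1) * ?n" using e n by (intro le) (simp add: add_nonneg_pos)
    also have "\<dots> \<le> e"
    proof -
      have "e / (r + 1) * r \<le> e" if "r \<ge> 0" for r using that e by (simp add: field_simps)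
      then show ?thesis using n by blast
    qed
    finally show "cmod ?I \<le> 0 + e" by simp
  qed
  then show ?thesis by simp
qed

lemma set_integrable_f: "B \<in> sets \<mu> \<Longrightarrow> set_integrable \<mu> B f"
  unfolding set_integrable_def using f_integrable by (intro integrable_mult_indicator)

text \<open>Continuous cut-offs built from the distance to \<open>K\<close> converge to its
  indicator because \<open>K\<close> is closed; dominated convergence does the rest.\<close>

lemma set_integral_closed_eq_0:
  assumes K: "closed K"
  shows "(LINT x:(torus_embed -` K \<inter> space \<mu>)|\<mu>. f x) = 0"
proof (cases "K = {}")
  \<comment> \<open>\<open>infdist\<close> to the empty set is 0 by convention, so the cut-offs
    below would be 1 everywhere and would not tend to the indicator.\<close>
  case True then show ?thesis by (simp add: set_lebesgue_integral_def)
next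
  case False
  define \<phi> where "\<phi> n w = max 0 (1 - real n * infdist w K)" for n w
  have \<phi>_cont: "continuous_on UNIV (\<phi> n)" for n
    unfolding \<phi>_def by (intro continuous_intros)
  have [measurable]: "\<phi> n \<in> borel_measurable borel" for n
    by (rule borel_measurable_continuous_onI[OF \<phi>_cont])
  have [measurable]: "K \<in> sets borel" using K by simp
  have \<phi>_lim: "(\<lambda>n. \<phi> n w) \<longlonglongrightarrow> indicator K w" for w
  proof (cases "w \<in> K")
    case True then show ?thesis by (simp add: \<phi>_def)
  next
    case w: False
    then have d: "infdist w K > 0"
      using in_closed_iff_infdist_zero[OF K False] infdist_nonneg[of w K] by (simp add: less_le)
    obtain N where N: "1 < real N * infdist w K" using reals_Archimedean3[OF d] by blast
    have "\<phi> n w = 0" if "n \<ge> N" for n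
    proof -
      have "real N * infdist w K \<le> real n * infdist w K" using that d by (intro mult_right_mono) auto
      then show ?thesis using N by (simp add: \<phi>_def)
    qed
    then have "\<forall>\<^sub>F n in sequentially. \<phi> n w = 0" by (auto simp: eventually_sequentially)
    then show ?thesis using w by (simp add: tendsto_eventually)
  qed
  have "(\<lambda>n. \<integral>x. f x * of_real (\<phi> n (torus_embed x)) \<partial>\<mu>)
      \<longlonglongrightarrow> (\<integral>x. f x * of_real (indicator K (torus_embed x)) \<partial>\<mu>)"
  proof (rule integral_dominated_convergence)
    show "integrable \<mu> (\<lambda>x. cmod (f x))" using f_integrable by simp
    show "AE x in \<mu>. (\<lambda>n. f x * of_real (\<phi> n (torus_embed x))) \<longlonglongrightarrow> f x * of_real (indicator K (torus_embed x))"
      by (intro AE_I2 tendsto_intros \<phi>_lim)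
    have "\<bar>\<phi> n w\<bar> \<le> 1" for n w by (auto simp: \<phi>_def max_def infdist_nonneg)
    then show "AE x in \<mu>. norm (f x * of_real (\<phi> n (torus_embed x))) \<le> cmod (f x)" for n
      by (intro AE_I2) (simp add: norm_mult mult_left_le)
  qed measurable
  then have "(\<integral>x. f x * of_real (indicator K (torus_embed x)) \<partial>\<mu>) = 0"
    using integral_continuous_eq_0[OF \<phi>_cont] by (simp add: LIMSEQ_const_iff)
  also have "(\<integral>x. f x * of_real (indicator K (torus_embed x)) \<partial>\<mu>)
      = (\<integral>x. indicator (torus_embed -` K \<inter> space \<mu>) x *\<^sub>R f x \<partial>\<mu>)"
    by (intro Bochner_Integration.integral_cong) (auto simp: indicator_def)
  finally show ?thesis by (simp add: set_lebesgue_integral_def)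
qed

text \<open>Dynkin's argument: closed sets generate the Borel sets and are stable under
  intersection, and vanishing of the integral passes to complements and to countable disjoint
  unions.\<close>

lemma set_integral_borel_eq_0:
  assumes "B \<in> sets borel"
  shows "(LINT x:(torus_embed -` B \<inter> space \<mu>)|\<mu>. f x) = 0"
proof -
  let ?E = "\<lambda>B. torus_embed -` B \<inter> space \<mu>"
  have meas: "?E B \<in> sets \<mu>" if "B \<in> sigma_sets UNIV (Collect closed)" for B
  proof -
    have "B \<in> sets borel" using that by (simp add: borel_eq_closed)
    then show ?thesis by (rule measurable_sets[OF torus_embed_measurable])
  qed
  have "Int_stable (Collect closed :: (complex \<times> complex) set set)" "Collect closed \<subseteq> Pow UNIV"
    "B \<in> sigma_sets UNIV (Collect closed)"
    using assms by (auto simp: Int_stable_def borel_eq_closed)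
  then show ?thesis
  proof (induction rule: sigma_sets_induct_disjoint)
    case (basic A)
    then show ?case by (intro set_integral_closed_eq_0) simp
  next
    case empty
    then show ?case by (simp add: set_lebesgue_integral_def)
  next
    case (compl A)
    have mA: "?E A \<in> sets \<mu>" "?E (UNIV - A) \<in> sets \<mu>" using compl(1) by (auto intro!: meas sigma_sets.Compl)
    have "(LINT x:(?E A \<union> ?E (UNIV - A))|\<mu>. f x) = (LINT x:?E A|\<mu>. f x) + (LINT x:?E (UNIV - A)|\<mu>. f x)"
      by (intro set_integral_Un set_integrable_f mA) auto
    moreover have "?E A \<union> ?E (UNIV - A) = ?E UNIV" by auto
    ultimately show ?case using compl(2) set_integral_closed_eq_0[of UNIV] by simp
  next
    case (union A)
    have mA: "?E (A i) \<in> sets \<mu>" for i using union(2) by (intro meas) auto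
    have "(LINT x:(\<Union>i. ?E (A i))|\<mu>. f x) = (\<Sum>i. (LINT x:?E (A i)|\<mu>. f x))"
    proof (rule lebesgue_integral_countable_add)
      show "?E (A i) \<inter> ?E (A j) = {}" if "i \<noteq> j" for i j
      proof -
        have "A i \<inter> A j = {}" using union(1) that by (auto simp: disjoint_family_on_def)
        then show ?thesis by blast
      qed
      show "set_integrable \<mu> (\<Union>i. ?E (A i)) f" using mA by (intro set_integrable_f sets.countable_UN) blast
    qed (rule mA)
    moreover have "(\<Union>i. ?E (A i)) = ?E (\<Union>i. A i)" by auto
    ultimately show ?case using union(3) by simp
  qed
qed

text \<open>The integral of \<open>f\<close> over the set where \<open>Re (f x)\<close> is positive
  vanishes, so that set is null. It is only Lebesgue measurable and is therefore replaced by its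
  Borel main part, which is a preimage under \<open>torus_embed\<close>.\<close>

lemma AE_Re_nonpos: "AE x in \<mu>. Re (f x) \<le> 0"
proof -
  define D where "D = {x \<in> space \<mu>. Re (f x) > 0}"
  have D: "D \<in> sets \<mu>" unfolding D_def by measurable
  have D_cell: "D \<subseteq> torus_cell" by (auto simp: D_def space_torus_measure)
  have "D \<in> sets lebesgue"
    using D torus_cell_sets unfolding torus_measure_def by (simp add: sets_restrict_space_iff)
  then have D': "D \<in> sets (completion lborel)" .
  define A where "A = main_part lborel D"
  have A: "A \<in> sets borel" using main_part_sets[OF D'] by (simp add: A_def)
  have AD: "A \<union> null_part lborel D = D" using main_part_null_part_Un[OF D'] by (simp add: A_def)
  have "torus_unembed -` A \<inter> space borel \<in> sets borel" by (rule measurable_sets[OF torus_unembed_measurable A])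
  then have "(LINT x:(torus_embed -` (torus_unembed -` A) \<inter> space \<mu>)|\<mu>. f x) = 0"
    by (intro set_integral_borel_eq_0) simp
  also have "torus_embed -` (torus_unembed -` A) \<inter> space \<mu> = A"
  proof (intro equalityI subsetI)
    fix x assume x: "x \<in> torus_embed -` (torus_unembed -` A) \<inter> space \<mu>"
    then have "torus_unembed (torus_embed x) = x"
      by (intro torus_unembed_embed) (simp add: space_torus_measure)
    then show "x \<in> A" using x by simp
  next
    fix x assume x: "x \<in> A"
    then have "x \<in> torus_cell" using AD D_cell by blast
    then show "x \<in> torus_embed -` (torus_unembed -` A) \<inter> space \<mu>"
      using x torus_unembed_embed[of x] by (simp add: space_torus_measure)
  qed
  finally have IA: "(LINT x:A|\<mu>. f x) = 0" .
  have "AE x in lebesgue. x \<notin> null_part lborel D"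
    by (intro AE_completion AE_notin_null_part D')
  then have "AE x in \<mu>. x \<notin> null_part lborel D"
    unfolding torus_measure_def using torus_cell_sets by (subst AE_restrict_space_iff) (auto elim: eventually_mono)
  then have "AE x in \<mu>. indicator A x *\<^sub>R f x = indicator D x *\<^sub>R f x"
    by eventually_elim (use AD in \<open>auto simp: indicator_def\<close>)
  moreover have "A \<in> sets \<mu>"
    using A AD D_cell torus_cell_sets unfolding torus_measure_def
    by (subst sets_restrict_space_iff) auto
  ultimately have "(LINT x:D|\<mu>. f x) = (LINT x:A|\<mu>. f x)"
    unfolding set_lebesgue_integral_def using D by (intro integral_cong_AE) auto
  then have "(\<integral>x. indicator D x *\<^sub>R f x \<partial>\<mu>) = 0" using IA by (simp add: set_lebesgue_integral_def)
  then have "(\<integral>x. Re (indicator D x *\<^sub>R f x) \<partial>\<mu>) = 0"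
    using set_integrable_f[OF D] by (subst integral_Re) (auto simp: set_integrable_def)
  moreover have "integrable \<mu> (\<lambda>x. Re (indicator D x *\<^sub>R f x))"
    using set_integrable_f[OF D] unfolding set_integrable_def by (rule integrable_Re)
  moreover have "AE x in \<mu>. 0 \<le> Re (indicator D x *\<^sub>R f x)"
    by (intro AE_I2) (auto simp: D_def indicator_def)
  ultimately have "AE x in \<mu>. Re (indicator D x *\<^sub>R f x) = 0"
    using integral_nonneg_eq_0_iff_AE by blast
  then show ?thesis
    using AE_space by eventually_elim (auto simp: D_def indicator_def split: if_splits)
qed

end

text \<open>Rotating \<open>f\<close> by 1, -1, \<open>\<i>\<close> and \<open>- \<i>\<close> bounds
  its real and imaginary parts from both sides.\<close>

lemma torus_complete:
  assumes f: "square_integrable \<mu> f" and f_coeff: "\<And>k. coeff f k = 0"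
  shows "AE x in \<mu>. f x = 0"
proof -
  have "AE x in \<mu>. Re (c * f x) \<le> 0" for c
  proof (rule AE_Re_nonpos)
    show "square_integrable \<mu> (\<lambda>x. c * f x)" by (rule square_integrable_cmult[OF f])
    show "coeff (\<lambda>x. c * f x) k = 0" for k
      using f_coeff[of k] \<omega> by (simp add: coeff_def mult.assoc)
  qed
  from this[of 1] this[of "- 1"] this[of \<i>] this[of "- \<i>"] show ?thesis
    by eventually_elim (simp add: complex_eq_iff)
qed

end

section \<open>Global well-posedness\<close>

text \<open>At translated points the partial sums form the same sequence, so \<open>lim\<close>
  returns the same value there even where the sequence diverges.\<close>

lemma torus_periodic_lim_partial_sum:
  assumes "\<omega>1 > 0" "\<omega>2 > 0"
  shows "torus_periodic \<omega>1 \<omega>2 (\<lambda>x. lim (\<lambda>n. \<Sum>k\<in>F n. c k * torus_char \<omega>1 \<omega>2 k x))"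
proof -
  have p: "cis (\<theta> + 2 * pi * of_int n) = cis \<theta>" for \<theta> n
    using cis_multiple_2pi[of "of_int n"] by (simp add: cis_mult[symmetric])
  have "torus_char \<omega>1 \<omega>2 k (x + \<omega>1, y) = torus_char \<omega>1 \<omega>2 k (x, y)"
    "torus_char \<omega>1 \<omega>2 k (x, y + \<omega>2) = torus_char \<omega>1 \<omega>2 k (x, y)" for k x y
    using assms p[of "2 * pi * (of_int (fst k) * x / \<omega>1 + of_int (snd k) * y / \<omega>2)" "fst k"]
      p[of "2 * pi * (of_int (fst k) * x / \<omega>1 + of_int (snd k) * y / \<omega>2)" "snd k"]
    by (simp_all add: torus_char_def distrib_left add_divide_distrib add_ac)
  then show ?thesis by (simp add: torus_periodic_def)
qed

section \<open>Fourier coefficients between \<open>L\<^sup>2\<close> and \<open>ell2\<close>\<close>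

definition fourier_ell2 :: "real \<Rightarrow> real \<Rightarrow> (real \<times> real \<Rightarrow> complex) \<Rightarrow> (int \<times> int) ell2" where
  "fourier_ell2 \<omega>1 \<omega>2 f = ell2_of (fourier_coeff \<omega>1 \<omega>2 f)"

context
  fixes \<omega>1 \<omega>2 :: real
  assumes \<omega>: "\<omega>1 > 0" "\<omega>2 > 0"
begin

interpretation orthogonal_characters "torus_measure \<omega>1 \<omega>2" "torus_char \<omega>1 \<omega>2" "\<omega>1 * \<omega>2"
  by (rule orthogonal_characters_torus[OF \<omega>])

lemma coord_fourier_ell2:
  assumes "f \<in> torus_L2 \<omega>1 \<omega>2"
  shows "coord (fourier_ell2 \<omega>1 \<omega>2 f) k = fourier_coeff \<omega>1 \<omega>2 f k"
proof -
  have "square_integrable (torus_measure \<omega>1 \<omega>2) f" using assms torus_L2_iff[OF \<omega>] by blast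
  from square_summable_coeff[OF this] show ?thesis
    by (simp add: fourier_ell2_def coord_ell2_of fourier_coeff_eq_coeff[OF \<omega>])
qed

text \<open>Parseval for the difference. Up to the constant \<open>fourier_ell2\<close> is thus an
  isometry, so continuity and distance estimates transfer in both directions.\<close>

lemma torus_L2_dist_eq:
  assumes "f \<in> torus_L2 \<omega>1 \<omega>2" "g \<in> torus_L2 \<omega>1 \<omega>2"
  shows "torus_L2_dist \<omega>1 \<omega>2 f g = sqrt (\<omega>1 * \<omega>2) * norm (fourier_ell2 \<omega>1 \<omega>2 f - fourier_ell2 \<omega>1 \<omega>2 g)"
proof -
  have fg: "square_integrable (torus_measure \<omega>1 \<omega>2) f" "square_integrable (torus_measure \<omega>1 \<omega>2) g"
    using assms torus_L2_iff[OF \<omega>] by blast+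
  have "(\<integral>x. (cmod (f x - g x))\<^sup>2 \<partial>torus_measure \<omega>1 \<omega>2)
      = \<omega>1 * \<omega>2 * (\<Sum>\<^sub>\<infinity>k. (cmod (coeff (\<lambda>x. f x - g x) k))\<^sup>2)"
    by (intro Parseval square_integrable_diff fg torus_complete[OF \<omega>])
  also have "\<dots> = \<omega>1 * \<omega>2 * (norm (fourier_ell2 \<omega>1 \<omega>2 f - fourier_ell2 \<omega>1 \<omega>2 g))\<^sup>2"
    using assms fg by (simp add: norm_ell2_power2 coord_fourier_ell2 fourier_coeff_eq_coeff[OF \<omega>] coeff_diff)
  finally show ?thesis by (simp add: torus_L2_dist_def torus_L2_norm_def real_sqrt_mult)
qed

lemma fourier_ell2_eq_imp_AE:
  assumes "f \<in> torus_L2 \<omega>1 \<omega>2" "g \<in> torus_L2 \<omega>1 \<omega>2" "fourier_ell2 \<omega>1 \<omega>2 f = fourier_ell2 \<omega>1 \<omega>2 g"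
  shows "AE x in torus_measure \<omega>1 \<omega>2. f x = g x"
proof -
  have fg: "square_integrable (torus_measure \<omega>1 \<omega>2) f" "square_integrable (torus_measure \<omega>1 \<omega>2) g"
    using assms torus_L2_iff[OF \<omega>] by blast+
  have "coeff f k = coeff g k" for k
    using assms coord_fourier_ell2 by (metis fourier_coeff_eq_coeff[OF \<omega>])
  then have "AE x in torus_measure \<omega>1 \<omega>2. f x - g x = 0"
    using fg by (intro torus_complete[OF \<omega>] square_integrable_diff) (auto simp: coeff_diff)
  then show ?thesis by simp
qed

lemma fourier_ell2_surj:
  obtains f where "f \<in> torus_L2 \<omega>1 \<omega>2" "fourier_ell2 \<omega>1 \<omega>2 f = x"
proof -
  obtain F where F: "square_integrable (torus_measure \<omega>1 \<omega>2) (\<lambda>y. lim (\<lambda>n. partial_sum (coord x) (F n) y))"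
    "coeff (\<lambda>y. lim (\<lambda>n. partial_sum (coord x) (F n) y)) = coord x"
    using Riesz_Fischer[OF coord_summable] by blast
  define f where "f = (\<lambda>y. lim (\<lambda>n. partial_sum (coord x) (F n) y))"
  have "torus_periodic \<omega>1 \<omega>2 f"
    unfolding f_def partial_sum_def by (rule torus_periodic_lim_partial_sum[OF \<omega>])
  then have f: "f \<in> torus_L2 \<omega>1 \<omega>2" using F torus_L2_iff[OF \<omega>] by (simp add: f_def)
  have "fourier_ell2 \<omega>1 \<omega>2 f = x"
    using F(2) f by (intro ell2_eqI) (simp add: coord_fourier_ell2 fourier_coeff_eq_coeff[OF \<omega>] f_def)
  then show ?thesis using f that by blast
qed

end

section \<open>The equation in the interaction picture\<close>

context
  fixes \<omega>1 \<omega>2 \<Lambda> \<tau> \<epsilon> :: real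
  assumes generic: "generic_irrational_pair \<omega>1 \<omega>2" and \<Lambda>: "\<Lambda> > 0" and \<tau>: "\<tau> > 0" and \<epsilon>: "\<epsilon> = 1 \<or> \<epsilon> = -1"
begin

lemma \<omega>_pos: "\<omega>1 > 0" "\<omega>2 > 0"
  using generic by (auto simp: generic_irrational_pair_def)

interpretation resonance_system "quasi_resonant \<omega>1 \<omega>2 \<Lambda> \<tau>" "4 + card (inexact_quartets \<omega>1 \<omega>2 \<Lambda> \<tau>)"
  by (rule resonance_system_quasi_resonant[OF generic \<Lambda> \<tau>])

abbreviation "ev \<equiv> laplace_eigenvalue \<omega>1 \<omega>2"
abbreviation "hat \<equiv> fourier_ell2 \<omega>1 \<omega>2"

definition linear_flow :: "real \<Rightarrow> (int \<times> int) ell2 \<Rightarrow> (int \<times> int) ell2" where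
  "linear_flow t = multiplier (\<lambda>k. cis (ev k * t))"

text \<open>If a mode obeys \<open>\<psi>' = \<i> * ev k * \<psi> - \<i> * \<epsilon> * N\<close>,
  then \<open>u = cis (- (ev k * t)) * \<psi>\<close> obeys
  \<open>u' = - \<i> * \<epsilon> * cis (- (ev k * t)) * N\<close>; this is that right-hand side in
  terms of \<open>u\<close>.\<close>

definition interaction_field :: "real \<Rightarrow> (int \<times> int) ell2 \<Rightarrow> (int \<times> int) ell2" where
  "interaction_field t x = multiplier (\<lambda>k. - \<i> * of_real \<epsilon> * cis (- (ev k * t))) (cubic (linear_flow t x) (linear_flow t x) (linear_flow t x))"

lemma cmod_symbol_le: "cmod (- \<i> * of_real \<epsilon> * cis \<theta>) \<le> 1"
  using \<epsilon> by (auto simp: norm_mult)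

lemma continuous_on_cis_mult: "continuous_on S (\<lambda>t. cis (c * t))" "continuous_on S (\<lambda>t. cis (- (c * t)))"
  unfolding cis_conv_exp by (intro continuous_intros)+

lemma coord_linear_flow: "coord (linear_flow t x) k = cis (ev k * t) * coord x k"
  unfolding linear_flow_def by (rule coord_multiplier) simp

lemma linear_flow_diff: "linear_flow t x - linear_flow t y = linear_flow t (x - y)"
  unfolding linear_flow_def by (rule multiplier_diff) simp

lemma norm_linear_flow_le: "norm (linear_flow t x) \<le> norm x"
  unfolding linear_flow_def by (rule norm_multiplier_le) simp

lemma linear_flow_minus: "linear_flow t (linear_flow (- t) x) = x"
  by (rule ell2_eqI) (simp add: coord_linear_flow cis_mult mult.assoc[symmetric])

lemma continuous_linear_flow: "continuous_on UNIV u \<Longrightarrow> continuous_on UNIV (\<lambda>t. linear_flow t (u t))"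
  unfolding linear_flow_def by (intro continuous_on_multiplier continuous_on_cis_mult) auto

lemma coord_interaction_field: "coord (interaction_field t x) k =
    - \<i> * of_real \<epsilon> * cis (- (ev k * t)) * coord (cubic (linear_flow t x) (linear_flow t x) (linear_flow t x)) k"
  unfolding interaction_field_def by (rule coord_multiplier[OF cmod_symbol_le])

interpretation norm_preserving_ode interaction_field
proof
  fix u :: "real \<Rightarrow> (int \<times> int) ell2" assume u: "continuous_on UNIV u"
  have "continuous_on UNIV (\<lambda>t. cubic (linear_flow t (u t)) (linear_flow t (u t)) (linear_flow t (u t)))"
    by (rule continuous_on_compose2[OF continuous_cubic continuous_linear_flow[OF u]]) simp
  then show "continuous_on UNIV (\<lambda>t. interaction_field t (u t))"
    unfolding interaction_field_def
    by (intro continuous_on_multiplier cmod_symbol_le continuous_on_mult continuous_on_const continuous_on_cis_mult)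
next
  fix R :: real
  let ?M = "3 * real (4 + card (inexact_quartets \<omega>1 \<omega>2 \<Lambda> \<tau>)) * R\<^sup>2"
  have "norm (interaction_field t x - interaction_field t y) \<le> ?M * norm (x - y)" if "norm x \<le> R" "norm y \<le> R" for t x y
  proof -
    let ?x = "linear_flow t x" and ?y = "linear_flow t y"
    have "norm (interaction_field t x - interaction_field t y) \<le> norm (cubic ?x ?x ?x - cubic ?y ?y ?y)"
      unfolding interaction_field_def multiplier_diff[OF cmod_symbol_le] by (rule norm_multiplier_le[OF cmod_symbol_le])
    also have "\<dots> \<le> ?M * norm (?x - ?y)"
      using cubic_Lipschitz[OF order_trans[OF norm_linear_flow_le that(1)] order_trans[OF norm_linear_flow_le that(2)]] by simp
    also have "\<dots> \<le> ?M * norm (x - y)"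
      unfolding linear_flow_diff by (intro mult_left_mono norm_linear_flow_le) auto
    finally show ?thesis .
  qed
  then show "\<exists>L. \<forall>t x y. norm x \<le> R \<longrightarrow> norm y \<le> R \<longrightarrow> norm (interaction_field t x - interaction_field t y) \<le> L * norm (x - y)"
    by blast
next
  fix t
  have "norm (linear_flow t 0) = 0" using norm_linear_flow_le[of t 0] by simp
  then have "norm (cubic (linear_flow t 0) (linear_flow t 0) (linear_flow t 0)) \<le> 0"
    using norm_cubic_le[of "linear_flow t 0" "linear_flow t 0" "linear_flow t 0"] by simp
  then show "interaction_field t 0 = 0"
    by (intro ell2_eqI) (simp add: coord_interaction_field)
next
  fix t x
  let ?y = "linear_flow t x"
  \<comment> \<open>The phase \<open>cis (- (ev k * t))\<close> moves to the conjugated factor and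
    turns \<open>x\<close> into \<open>?y\<close>, which leaves the pairing of \<open>?y\<close>
    with its own cubic term, rotated by \<open>- \<i> * \<epsilon>\<close>.\<close>
  have "coord (interaction_field t x) k * cnj (coord x k) = (- \<i> * of_real \<epsilon>) * (coord (cubic ?y ?y ?y) k * cnj (coord ?y k))" for k
    by (simp add: coord_interaction_field coord_linear_flow cis_cnj)
  then have "inner (interaction_field t x) x = (\<Sum>\<^sub>\<infinity>k. Re ((- \<i> * of_real \<epsilon>) * (coord (cubic ?y ?y ?y) k * cnj (coord ?y k))))"
    by (simp only: inner_ell2_def)
  also have "\<dots> = Re (\<Sum>\<^sub>\<infinity>k. (- \<i> * of_real \<epsilon>) * (coord (cubic ?y ?y ?y) k * cnj (coord ?y k)))"
    by (intro infsum_Re summable_on_cmult_right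
        abs_summable_summable[OF square_summable_inner[OF coord_summable coord_summable]])
  also have "\<dots> = \<epsilon> * Im (\<Sum>\<^sub>\<infinity>k. coord (cubic ?y ?y ?y) k * cnj (coord ?y k))"
    by (simp only: infsum_cmult_right') simp
  finally show "inner (interaction_field t x) x = 0" by (simp only: Im_cubic_pairing)
qed

lemma quasi_resonant_triples_eq: "quasi_resonant_triples \<omega>1 \<omega>2 \<Lambda> \<tau> k = triples k"
  by (simp add: quasi_resonant_triples_def triples_def)

lemma cubic_term_eq:
  "f \<in> torus_L2 \<omega>1 \<omega>2 \<Longrightarrow> cubic_term \<omega>1 \<omega>2 f = cubic_monomial (hat f) (hat f) (hat f)"
  by (simp add: cubic_term_def cubic_monomial_def fun_eq_iff coord_fourier_ell2[OF \<omega>_pos])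

lemma restricted_cubic_coeff_eq:
  "f \<in> torus_L2 \<omega>1 \<omega>2 \<Longrightarrow> restricted_cubic_coeff \<omega>1 \<omega>2 \<Lambda> \<tau> f k = coord (cubic (hat f) (hat f) (hat f)) k"
  by (simp add: restricted_cubic_coeff_def quasi_resonant_triples_eq cubic_term_eq coord_cubic)

text \<open>In the interaction picture \<open>u t = linear_flow (- t) (hat (\<psi> t))\<close> the Duhamel integral is an increment
  of an antiderivative of the interaction_field.\<close>

lemma Duhamel_integral:
  fixes V :: "real \<Rightarrow> (int \<times> int) ell2"
  assumes L2: "\<And>s. \<psi> s \<in> torus_L2 \<omega>1 \<omega>2" and x: "\<And>s. hat (\<psi> s) = linear_flow s (u s)"
    and u: "continuous_on UNIV u"
    and V: "\<And>s. (V has_vector_derivative interaction_field s (u s)) (at s)"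
  shows "interval_lebesgue_integrable lborel (ereal 0) (ereal t)
      (\<lambda>s. cis (ev k * (t - s)) * restricted_cubic_coeff \<omega>1 \<omega>2 \<Lambda> \<tau> (\<psi> s) k)" (is "interval_lebesgue_integrable _ _ _ ?f")
    "\<i> * of_real \<epsilon> * interval_lebesgue_integral lborel (ereal 0) (ereal t)
      (\<lambda>s. cis (ev k * (t - s)) * restricted_cubic_coeff \<omega>1 \<omega>2 \<Lambda> \<tau> (\<psi> s) k)
      = - cis (ev k * t) * (coord (V t) k - coord (V 0) k)"
proof -
  have \<epsilon>2: "\<epsilon> * \<epsilon> = 1" using \<epsilon> by auto
  \<comment> \<open>Since \<open>\<epsilon> * \<epsilon> = 1\<close>, the factor
    \<open>\<i> * \<epsilon>\<close> undoes the \<open>- \<i> * \<epsilon>\<close> of the field, and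
    \<open>H\<close> is an antiderivative of the Duhamel integrand for fixed
    \<open>t\<close>.\<close>
  define H where "H s = \<i> * of_real \<epsilon> * cis (ev k * t) * coord (V s) k" for s
  have f: "?f s = \<i> * of_real \<epsilon> * cis (ev k * t) * coord (interaction_field s (u s)) k" for s
  proof -
    have "\<i> * of_real \<epsilon> * cis (ev k * t) * coord (interaction_field s (u s)) k
        = of_real (\<epsilon> * \<epsilon>) * (cis (ev k * t) * cis (- (ev k * s))) * coord (cubic (hat (\<psi> s)) (hat (\<psi> s)) (hat (\<psi> s))) k"
      by (simp add: coord_interaction_field x mult_ac)
    also have "\<dots> = ?f s"
      by (simp add: \<epsilon>2 cis_mult restricted_cubic_coeff_eq[OF L2] right_diff_distrib)
    finally show ?thesis by simp
  qed
  have coord_cont: "continuous_on UNIV (\<lambda>s. coord (interaction_field s (u s)) k)"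
    by (rule bounded_linear.continuous_on[OF bounded_linear_coord continuous_along[OF u]])
  have f_cont: "continuous_on UNIV ?f"
    unfolding f by (intro continuous_intros coord_cont)
  then have "isCont ?f s" for s by (simp add: continuous_on_eq_continuous_at)
  then show "interval_lebesgue_integrable lborel (ereal 0) (ereal t) ?f"
    by (intro interval_integrable_isCont)
  have H: "(H has_vector_derivative ?f s) (at s)" for s
    unfolding H_def f
    by (intro bounded_linear.has_vector_derivative[OF bounded_linear_mult_right]
        bounded_linear.has_vector_derivative[OF bounded_linear_coord V])
  have I: "interval_lebesgue_integral lborel (ereal 0) (ereal t) ?f = H t - H 0"
    by (intro interval_integral_FTC_finite continuous_on_subset[OF f_cont] has_vector_derivative_at_within[OF H]) auto
  have "\<i> * of_real \<epsilon> * (H t - H 0) = - of_real (\<epsilon> * \<epsilon>) * (cis (ev k * t) * (coord (V t) k - coord (V 0) k))"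
    by (simp add: H_def algebra_simps)
  then show "\<i> * of_real \<epsilon> * interval_lebesgue_integral lborel (ereal 0) (ereal t) ?f
      = - cis (ev k * t) * (coord (V t) k - coord (V 0) k)"
    unfolding I \<epsilon>2 by simp
qed

lemma solves_imp_continuous: "solves u \<Longrightarrow> continuous_on UNIV u"
  unfolding solves_def by (meson continuous_at_imp_continuous_on has_vector_derivative_continuous)

lemma solution_exists:
  assumes \<psi>0: "\<psi>0 \<in> torus_L2 \<omega>1 \<omega>2"
  obtains \<psi> where "qr_nls_solution \<omega>1 \<omega>2 \<Lambda> \<tau> \<epsilon> \<psi>0 \<psi>"
proof -
  obtain u where u: "solves u" "u 0 = hat \<psi>0" using global_solution by blast
  have u_cont: "continuous_on UNIV u" by (rule solves_imp_continuous[OF u(1)])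
  \<comment> \<open>Representatives may be chosen independently for each time: the conditions on a
    solution see them, apart from membership in \<open>torus_L2\<close>, only up to null sets or
    through their Fourier coefficients.\<close>
  have "\<forall>t. \<exists>f. f \<in> torus_L2 \<omega>1 \<omega>2 \<and> hat f = linear_flow t (u t)"
    using fourier_ell2_surj[OF \<omega>_pos] by metis
  then obtain \<psi> where L2: "\<And>t. \<psi> t \<in> torus_L2 \<omega>1 \<omega>2" and x: "\<And>t. hat (\<psi> t) = linear_flow t (u t)" by metis
  have V: "(u has_vector_derivative interaction_field s (u s)) (at s)" for s using u(1) by (simp add: solves_def)
  note D = Duhamel_integral[OF L2 x u_cont V]
  have "linear_flow 0 y = y" for y by (rule ell2_eqI) (simp add: coord_linear_flow)
  then have init: "hat (\<psi> 0) = hat \<psi>0" using x u by simp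
  have "qr_nls_solution \<omega>1 \<omega>2 \<Lambda> \<tau> \<epsilon> \<psi>0 \<psi>"
    unfolding qr_nls_solution_def
  proof (intro conjI allI)
    show "\<psi> t \<in> torus_L2 \<omega>1 \<omega>2" for t by (rule L2)
    show "((\<lambda>s. torus_L2_dist \<omega>1 \<omega>2 (\<psi> s) (\<psi> t)) \<longlongrightarrow> 0) (at t)" for t
    proof -
      have "((\<lambda>s. linear_flow s (u s)) \<longlongrightarrow> linear_flow t (u t)) (at t)"
        using continuous_linear_flow[OF u_cont] by (simp add: continuous_on_def)
      then have "((\<lambda>s. sqrt (\<omega>1 * \<omega>2) * norm (linear_flow s (u s) - linear_flow t (u t))) \<longlongrightarrow> sqrt (\<omega>1 * \<omega>2) * 0) (at t)"
        by (intro tendsto_mult tendsto_const tendsto_norm_zero LIM_zero)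
      then show ?thesis by (simp add: torus_L2_dist_eq[OF \<omega>_pos L2 L2] x)
    qed
    show "AE x in torus_measure \<omega>1 \<omega>2. \<psi> 0 x = \<psi>0 x"
      by (rule fourier_ell2_eq_imp_AE[OF \<omega>_pos L2 \<psi>0 init])
    show "cubic_term \<omega>1 \<omega>2 (\<psi> t) summable_on quasi_resonant_triples \<omega>1 \<omega>2 \<Lambda> \<tau> k" for t k
      by (simp add: cubic_term_eq[OF L2] quasi_resonant_triples_eq cubic_monomial_summable)
    show "interval_lebesgue_integrable lborel (ereal 0) (ereal t)
        (\<lambda>s. cis (ev k * (t - s)) * restricted_cubic_coeff \<omega>1 \<omega>2 \<Lambda> \<tau> (\<psi> s) k)" for t k
      by (rule D(1))
    show "fourier_coeff \<omega>1 \<omega>2 (\<psi> t) k = cis (ev k * t) * fourier_coeff \<omega>1 \<omega>2 \<psi>0 k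
        - \<i> * of_real \<epsilon> * interval_lebesgue_integral lborel (ereal 0) (ereal t)
            (\<lambda>s. cis (ev k * (t - s)) * restricted_cubic_coeff \<omega>1 \<omega>2 \<Lambda> \<tau> (\<psi> s) k)" for t k
    proof -
      have "fourier_coeff \<omega>1 \<omega>2 (\<psi> t) k = cis (ev k * t) * coord (u t) k"
        by (simp add: coord_fourier_ell2[OF \<omega>_pos L2, symmetric] x coord_linear_flow)
      moreover have "fourier_coeff \<omega>1 \<omega>2 \<psi>0 k = coord (u 0) k"
        by (simp add: coord_fourier_ell2[OF \<omega>_pos \<psi>0, symmetric] u)
      ultimately show ?thesis unfolding D(2) by (simp add: algebra_simps)
    qed
  qed
  then show ?thesis by (rule that)
qed

text \<open>A Duhamel solution is assumed continuous in \<open>L\<^sup>2\<close> only. The field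
  along it is continuous in \<open>ell2\<close>, so an antiderivative exists in norm, and the
  Duhamel identity, mode by mode, equates it with the solution up to the initial value. This yields
  uniqueness in the whole class of continuous solutions.\<close>

lemma solution_imp_solves:
  assumes \<psi>0: "\<psi>0 \<in> torus_L2 \<omega>1 \<omega>2" and sol: "qr_nls_solution \<omega>1 \<omega>2 \<Lambda> \<tau> \<epsilon> \<psi>0 \<psi>"
  shows "solves (\<lambda>t. linear_flow (- t) (hat (\<psi> t)))" "linear_flow (- 0) (hat (\<psi> 0)) = hat \<psi>0"
proof -
  define u where "u t = linear_flow (- t) (hat (\<psi> t))" for t
  have L2: "\<psi> t \<in> torus_L2 \<omega>1 \<omega>2" for t using sol by (simp add: qr_nls_solution_def)
  have x_cont: "continuous_on UNIV (\<lambda>t. hat (\<psi> t))"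
  proof (rule continuous_at_imp_continuous_on, rule ballI)
    fix t
    have "((\<lambda>s. torus_L2_dist \<omega>1 \<omega>2 (\<psi> s) (\<psi> t)) \<longlongrightarrow> 0) (at t)" using sol by (simp add: qr_nls_solution_def)
    then have "((\<lambda>s. torus_L2_dist \<omega>1 \<omega>2 (\<psi> s) (\<psi> t) / sqrt (\<omega>1 * \<omega>2)) \<longlongrightarrow> 0 / sqrt (\<omega>1 * \<omega>2)) (at t)"
      using \<omega>_pos by (intro tendsto_divide tendsto_const) auto
    moreover have "torus_L2_dist \<omega>1 \<omega>2 (\<psi> s) (\<psi> t) / sqrt (\<omega>1 * \<omega>2) = norm (hat (\<psi> s) - hat (\<psi> t))" for s
      using \<omega>_pos by (simp add: torus_L2_dist_eq[OF \<omega>_pos L2 L2])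
    ultimately have "((\<lambda>s. norm (hat (\<psi> s) - hat (\<psi> t))) \<longlongrightarrow> 0) (at t)" by simp
    then show "isCont (\<lambda>t. hat (\<psi> t)) t"
      unfolding isCont_def by (rule LIM_zero_cancel[OF tendsto_norm_zero_cancel])
  qed
  have u_cont: "continuous_on UNIV u"
  proof -
    have "continuous_on UNIV (\<lambda>t. multiplier (\<lambda>k. cis (- (ev k * t))) (hat (\<psi> t)))"
      by (intro continuous_on_multiplier continuous_on_cis_mult x_cont) auto
    then show ?thesis by (simp add: u_def[abs_def] linear_flow_def)
  qed
  have x: "hat (\<psi> t) = linear_flow t (u t)" for t by (simp add: u_def linear_flow_minus)
  \<comment> \<open>\<open>u\<close> is not yet known to be differentiable, so it cannot serve as
    its own antiderivative as in the existence proof.\<close>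
  obtain V where V0: "V 0 = 0" and V: "\<And>t. (V has_vector_derivative interaction_field t (u t)) (at t)"
    using continuous_antiderivative[OF continuous_along[OF u_cont]] by blast
  note D = Duhamel_integral[OF L2 x u_cont V]
  have u_eq: "u t = hat \<psi>0 + V t" for t
  proof (rule ell2_eqI)
    fix k
    have "coord (hat (\<psi> t)) k = cis (ev k * t) * coord (hat \<psi>0) k
        - \<i> * of_real \<epsilon> * interval_lebesgue_integral lborel (ereal 0) (ereal t)
            (\<lambda>s. cis (ev k * (t - s)) * restricted_cubic_coeff \<omega>1 \<omega>2 \<Lambda> \<tau> (\<psi> s) k)"
      unfolding coord_fourier_ell2[OF \<omega>_pos L2] coord_fourier_ell2[OF \<omega>_pos \<psi>0]
      using sol unfolding qr_nls_solution_def by blast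
    also have "\<dots> = cis (ev k * t) * (coord (hat \<psi>0) k + coord (V t) k)"
      unfolding D(2) V0 by (simp add: algebra_simps)
    finally show "coord (u t) k = coord (hat \<psi>0 + V t) k"
      by (simp add: x coord_linear_flow)
  qed
  have "(u has_vector_derivative interaction_field t (u t)) (at t)" for t
    unfolding u_eq[abs_def] using V[of t, unfolded u_eq] by (auto intro!: derivative_eq_intros)
  then show "solves (\<lambda>t. linear_flow (- t) (hat (\<psi> t)))" unfolding solves_def u_def by blast
  show "linear_flow (- 0) (hat (\<psi> 0)) = hat \<psi>0" using u_eq[of 0] V0 by (simp add: u_def)
qed

text \<open>Serves both uniqueness, with equal data, and continuous dependence. A nonnegative
  constant makes the exponential monotone in \<open>\<bar>t\<bar>\<close>, as an estimate uniform on
  a time interval requires.\<close>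

lemma solutions_L2_close:
  obtains L where "L \<ge> 0"
    "\<And>\<psi>0 \<phi>0 \<psi> \<phi> t. \<lbrakk>\<psi>0 \<in> torus_L2 \<omega>1 \<omega>2; \<phi>0 \<in> torus_L2 \<omega>1 \<omega>2; norm (hat \<psi>0) \<le> R; norm (hat \<phi>0) \<le> R;
       qr_nls_solution \<omega>1 \<omega>2 \<Lambda> \<tau> \<epsilon> \<psi>0 \<psi>; qr_nls_solution \<omega>1 \<omega>2 \<Lambda> \<tau> \<epsilon> \<phi>0 \<phi>\<rbrakk> \<Longrightarrow>
       torus_L2_dist \<omega>1 \<omega>2 (\<psi> t) (\<phi> t) \<le> exp (L * \<bar>t\<bar>) * torus_L2_dist \<omega>1 \<omega>2 \<psi>0 \<phi>0"
proof -
  obtain L where L: "\<And>u v t. solves u \<Longrightarrow> solves v \<Longrightarrow> norm (u 0) \<le> R \<Longrightarrow> norm (v 0) \<le> R \<Longrightarrow>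
      norm (u t - v t) \<le> exp (L * \<bar>t\<bar>) * norm (u 0 - v 0)"
    using solutions_close by blast
  have "torus_L2_dist \<omega>1 \<omega>2 (\<psi> t) (\<phi> t) \<le> exp (max L 0 * \<bar>t\<bar>) * torus_L2_dist \<omega>1 \<omega>2 \<psi>0 \<phi>0"
    if L2: "\<psi>0 \<in> torus_L2 \<omega>1 \<omega>2" "\<phi>0 \<in> torus_L2 \<omega>1 \<omega>2" and R: "norm (hat \<psi>0) \<le> R" "norm (hat \<phi>0) \<le> R"
      and sol: "qr_nls_solution \<omega>1 \<omega>2 \<Lambda> \<tau> \<epsilon> \<psi>0 \<psi>" "qr_nls_solution \<omega>1 \<omega>2 \<Lambda> \<tau> \<epsilon> \<phi>0 \<phi>" for \<psi>0 \<phi>0 \<psi> \<phi> t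
  proof -
    have L2t: "\<psi> t \<in> torus_L2 \<omega>1 \<omega>2" "\<phi> t \<in> torus_L2 \<omega>1 \<omega>2" using sol by (simp_all add: qr_nls_solution_def)
    note u = solution_imp_solves[OF L2(1) sol(1)] and v = solution_imp_solves[OF L2(2) sol(2)]
    have "norm (hat (\<psi> t) - hat (\<phi> t)) = norm (linear_flow t (linear_flow (- t) (hat (\<psi> t)) - linear_flow (- t) (hat (\<phi> t))))"
      by (simp only: linear_flow_diff linear_flow_minus)
    also have "\<dots> \<le> norm (linear_flow (- t) (hat (\<psi> t)) - linear_flow (- t) (hat (\<phi> t)))" by (rule norm_linear_flow_le)
    also have "\<dots> \<le> exp (L * \<bar>t\<bar>) * norm (hat \<psi>0 - hat \<phi>0)"
      using L[OF u(1) v(1), of t] R by (simp only: u(2) v(2))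
    also have "\<dots> \<le> exp (max L 0 * \<bar>t\<bar>) * norm (hat \<psi>0 - hat \<phi>0)"
      by (intro mult_right_mono iffD2[OF exp_le_cancel_iff]) auto
    finally have "sqrt (\<omega>1 * \<omega>2) * norm (hat (\<psi> t) - hat (\<phi> t))
        \<le> sqrt (\<omega>1 * \<omega>2) * (exp (max L 0 * \<bar>t\<bar>) * norm (hat \<psi>0 - hat \<phi>0))"
      using \<omega>_pos by (intro mult_left_mono) auto
    then show ?thesis
      by (simp add: torus_L2_dist_eq[OF \<omega>_pos L2t] torus_L2_dist_eq[OF \<omega>_pos L2] mult_ac)
  qed
  then show ?thesis by (rule that[of "max L 0", rotated]) auto
qed

lemma globally_well_posed: "qr_nls_globally_well_posed \<omega>1 \<omega>2 \<Lambda> \<tau> \<epsilon>"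
  unfolding qr_nls_globally_well_posed_def
proof (intro conjI ballI allI impI)
  show "\<exists>\<psi>. qr_nls_solution \<omega>1 \<omega>2 \<Lambda> \<tau> \<epsilon> \<psi>0 \<psi>" if "\<psi>0 \<in> torus_L2 \<omega>1 \<omega>2" for \<psi>0
    using solution_exists[OF that] by blast
next
  fix \<psi>0 \<psi> \<phi> t
  assume \<psi>0: "\<psi>0 \<in> torus_L2 \<omega>1 \<omega>2"
    and sol: "qr_nls_solution \<omega>1 \<omega>2 \<Lambda> \<tau> \<epsilon> \<psi>0 \<psi>" "qr_nls_solution \<omega>1 \<omega>2 \<Lambda> \<tau> \<epsilon> \<psi>0 \<phi>"
  have L2t: "\<psi> t \<in> torus_L2 \<omega>1 \<omega>2" "\<phi> t \<in> torus_L2 \<omega>1 \<omega>2" using sol by (simp_all add: qr_nls_solution_def)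
  have "torus_L2_dist \<omega>1 \<omega>2 \<psi>0 \<psi>0 = 0" by (simp add: torus_L2_dist_eq[OF \<omega>_pos \<psi>0 \<psi>0])
  then have "torus_L2_dist \<omega>1 \<omega>2 (\<psi> t) (\<phi> t) \<le> 0"
    using solutions_L2_close[of "norm (hat \<psi>0)"] \<psi>0 sol by (metis mult_zero_right order_refl)
  then have "hat (\<psi> t) = hat (\<phi> t)"
    using \<omega>_pos by (simp add: torus_L2_dist_eq[OF \<omega>_pos L2t] mult_le_0_iff)
  then show "AE x in torus_measure \<omega>1 \<omega>2. \<psi> t x = \<phi> t x"
    by (rule fourier_ell2_eq_imp_AE[OF \<omega>_pos L2t])
next
  fix \<psi>0 and T e :: real
  assume \<psi>0: "\<psi>0 \<in> torus_L2 \<omega>1 \<omega>2" and T: "T > 0" and e: "e > 0"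
  define R where "R = norm (hat \<psi>0) + 1"
  obtain L where L: "L \<ge> 0" "\<And>\<psi>0 \<phi>0 \<psi> \<phi> t. \<lbrakk>\<psi>0 \<in> torus_L2 \<omega>1 \<omega>2; \<phi>0 \<in> torus_L2 \<omega>1 \<omega>2; norm (hat \<psi>0) \<le> R; norm (hat \<phi>0) \<le> R;
       qr_nls_solution \<omega>1 \<omega>2 \<Lambda> \<tau> \<epsilon> \<psi>0 \<psi>; qr_nls_solution \<omega>1 \<omega>2 \<Lambda> \<tau> \<epsilon> \<phi>0 \<phi>\<rbrakk> \<Longrightarrow>
       torus_L2_dist \<omega>1 \<omega>2 (\<psi> t) (\<phi> t) \<le> exp (L * \<bar>t\<bar>) * torus_L2_dist \<omega>1 \<omega>2 \<psi>0 \<phi>0"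
    using solutions_L2_close[of R] by blast
  \<comment> \<open>The first bound puts \<open>\<phi>0\<close> within coefficient distance 1 of
    \<open>\<psi>0\<close>, hence into the ball of radius \<open>R\<close>; the second compensates
    the exponential growth up to time \<open>T\<close>.\<close>
  define d where "d = min (sqrt (\<omega>1 * \<omega>2)) (e / exp (L * T))"
  show "\<exists>d>0. \<forall>\<phi>0\<in>torus_L2 \<omega>1 \<omega>2. \<forall>\<psi> \<phi>. torus_L2_dist \<omega>1 \<omega>2 \<psi>0 \<phi>0 < d \<longrightarrow>
      qr_nls_solution \<omega>1 \<omega>2 \<Lambda> \<tau> \<epsilon> \<psi>0 \<psi> \<longrightarrow> qr_nls_solution \<omega>1 \<omega>2 \<Lambda> \<tau> \<epsilon> \<phi>0 \<phi> \<longrightarrow>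
      (\<forall>t\<in>{- T..T}. torus_L2_dist \<omega>1 \<omega>2 (\<psi> t) (\<phi> t) < e)"
  proof (intro exI[of _ d] conjI ballI allI impI)
    show "d > 0" using \<omega>_pos e by (simp add: d_def)
    fix \<phi>0 \<psi> \<phi> t
    assume \<phi>0: "\<phi>0 \<in> torus_L2 \<omega>1 \<omega>2" and dist: "torus_L2_dist \<omega>1 \<omega>2 \<psi>0 \<phi>0 < d"
      and sol: "qr_nls_solution \<omega>1 \<omega>2 \<Lambda> \<tau> \<epsilon> \<psi>0 \<psi>" "qr_nls_solution \<omega>1 \<omega>2 \<Lambda> \<tau> \<epsilon> \<phi>0 \<phi>"
      and t: "t \<in> {- T..T}"
    have nn: "torus_L2_dist \<omega>1 \<omega>2 \<psi>0 \<phi>0 \<ge> 0" using \<omega>_pos by (simp add: torus_L2_dist_eq[OF \<omega>_pos \<psi>0 \<phi>0])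
    have "sqrt (\<omega>1 * \<omega>2) * norm (hat \<psi>0 - hat \<phi>0) < sqrt (\<omega>1 * \<omega>2) * 1"
      using dist by (simp add: torus_L2_dist_eq[OF \<omega>_pos \<psi>0 \<phi>0] d_def)
    then have "norm (hat \<psi>0 - hat \<phi>0) < 1"
      using \<omega>_pos by (subst (asm) mult_less_cancel_left_pos) auto
    then have R: "norm (hat \<psi>0) \<le> R" "norm (hat \<phi>0) \<le> R"
      using norm_triangle_ineq3[of "hat \<psi>0" "hat \<phi>0"] by (auto simp: R_def)
    have "torus_L2_dist \<omega>1 \<omega>2 (\<psi> t) (\<phi> t) \<le> exp (L * \<bar>t\<bar>) * torus_L2_dist \<omega>1 \<omega>2 \<psi>0 \<phi>0"
      by (rule L(2)[OF \<psi>0 \<phi>0 R sol])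
    also have "\<dots> \<le> exp (L * T) * torus_L2_dist \<omega>1 \<omega>2 \<psi>0 \<phi>0"
      using t L(1) nn by (intro mult_right_mono iffD2[OF exp_le_cancel_iff] mult_left_mono) auto
    also have "\<dots> < exp (L * T) * (e / exp (L * T))"
      using dist by (intro mult_strict_left_mono) (auto simp: d_def)
    also have "\<dots> = e" by simp
    finally show "torus_L2_dist \<omega>1 \<omega>2 (\<psi> t) (\<phi> t) < e" .
  qed
qed

end

theorem theorem1:
  fixes \<omega>1 \<omega>2 \<Lambda> \<tau> \<epsilon> :: real
  assumes "generic_irrational_pair \<omega>1 \<omega>2"
    and "\<Lambda> > 0"
    and "\<tau> > 1"
    and "\<epsilon> = 1 \<or> \<epsilon> = -1"
  shows "qr_nls_globally_well_posed \<omega>1 \<omega>2 \<Lambda> \<tau> \<epsilon>"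
  using assms by (intro globally_well_posed) auto

end
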